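(* Let $\mathcal{L}$ be a backward parabolic operator on $[0,T]\times\mathbb{R}^n$, $$\mathcal{L}u=\partial_t u+\sum_{i,j=1}^n\partial_{x_i}\left(a_{i,j}(t)\partial_{x_j}u\right)+\sum_{j=1}^n b_j(t)\partial_{x_j}u+c(t)u,$$ satisfying the structural assumptions (S) listed in the context, with constants $k_A,k_B,k_C$ and a modulus of continuity $\omega$ satisfying the Osgood condition. For all $T'\in\,]0,T[$ and all $D>0$ there exist $\rho'>0$ and an increasing continuous function $G:[0,+\infty[\,\to[0,+\infty[$ with $G(0)=0$ such that, if $u\in\mathcal{H}_0$ is a solution of $\mathcal{L}u=0$ on $[0,T]\times\mathbb{R}^n$ with $\|u(t,\cdot)\|_{L^2}\le D$ for all $t\in[0,T]$ and $\|u(0,\cdot)\|_{L^2}\le\rho'$, then $$\sup_{t\in[0,T']}\|u(t,\cdot)\|_{L^2}^2\le G\left(\|u(0,\cdot)\|_{L^2}^2\right).$$ The constant $\rho'$ and the function $G$ depend on $k_A,k_B,k_C,\omega,n,T,T'$ and $D$.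
   Context: $T>0$, $n\ge1$. A modulus of continuity is a function $\omega:[0,1]\to[0,1]$ which is continuous, increasing, concave, with $\omega(0)=0$. It satisfies the Osgood condition if $\int_0^1\frac{ds}{\omega(s)}=+\infty$. A function $f$ on $[0,T]$ belongs to $C^\omega([0,T])$ if $\sup_{0<|t-s|<1}\frac{|f(t)-f(s)|}{\omega(|t-s|)}<+\infty$. Assumptions (S) on $\mathcal{L}$ (all coefficients depend on $t$ only; $a_{i,j}$ are real-valued, $b_i,c$ are bounded and may be complex-valued): $a_{i,j}(t)=a_{j,i}(t)$ for all $i,j$ and $t\in[0,T]$; there is $k_A\in\,]0,1[$ with $k_A|\xi|^2\le\sum_{i,j}a_{i,j}(t)\xi_i\xi_j\le k_A^{-1}|\xi|^2$ for all $(t,\xi)\in[0,T]\times\mathbb{R}^n$; there are $k_B,k_C>0$ with $|b_i(t)|\le k_B$ and $|c(t)|\le k_C$ for all $t\in[0,T]$ and all $i$; $a_{i,j}\in C^\omega([0,T])$ for all $i,j$, where $\omega$ is a modulus of continuity satisfying the Osgood condition. $\mathcal{H}_0=C([0,T],L^2)\cap C([0,T[,H^1)\cap C^1([0,T[,L^2)$, where $L^2=L^2(\mathbb{R}^n)$, $H^1=H^1(\mathbb{R}^n)$. A solution $u\in\mathcal{H}_0$ of $\mathcal{L}u=0$ satisfies the equation in $H^{-1}(\mathbb{R}^n)$ for a.e. $t\in\,]0,T[$. *)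

theory Defs
  imports "HOL-Analysis.Analysis"
begin

section \<open>Moduli of continuity\<close>

definition modulus_of_continuity :: "(real \<Rightarrow> real) \<Rightarrow> bool" where
  "modulus_of_continuity \<omega> \<longleftrightarrow>
     \<omega> ` {0..1} \<subseteq> {0..1} \<and> continuous_on {0..1} \<omega> \<and> mono_on {0..1} \<omega> \<and>
     concave_on {0..1} \<omega> \<and> \<omega> 0 = 0"

text \<open>For a modulus of continuity this forces \<open>\<omega> s > 0\<close> for \<open>s \<in> {0<..1}\<close>: otherwise \<open>\<omega>\<close> vanishes
  identically on the interval by concavity, and then the integral is \<open>0\<close> because \<open>1 / 0 = 0\<close>.
  Hence the quotients in \<open>C_omega\<close> are genuine.\<close>

definition osgood :: "(real \<Rightarrow> real) \<Rightarrow> bool" where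
  "osgood \<omega> \<longleftrightarrow> (\<integral>\<^sup>+ s \<in> {0..1}. ennreal (1 / \<omega> s) \<partial>lborel) = \<infinity>"

definition C_omega :: "(real \<Rightarrow> real) \<Rightarrow> real \<Rightarrow> (real \<Rightarrow> real) set" where
  "C_omega \<omega> T = {f. bdd_above {\<bar>f t - f s\<bar> / \<omega> \<bar>t - s\<bar> | t s.
      t \<in> {0..T} \<and> s \<in> {0..T} \<and> 0 < \<bar>t - s\<bar> \<and> \<bar>t - s\<bar> < 1}}"

section \<open>Lebesgue and Sobolev spaces of complex functions\<close>

text \<open>Elements of \<open>L\<^sup>2\<close> are handled through Borel measurable representatives; everything below
  is invariant under modification on null sets.\<close>

definition L2 :: "('a::euclidean_space \<Rightarrow> complex) set" where
  "L2 = {f. f \<in> borel_measurable lborel \<and> integrable lborel (\<lambda>x. (norm (f x))\<^sup>2)}"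

definition L2_norm :: "('a::euclidean_space \<Rightarrow> complex) \<Rightarrow> real" where
  "L2_norm f = sqrt (LINT x|lborel. (norm (f x))\<^sup>2)"

definition pd :: "'n \<Rightarrow> (real^'n \<Rightarrow> complex) \<Rightarrow> real^'n \<Rightarrow> complex" where
  "pd i \<phi> x = frechet_derivative \<phi> (at x) (axis i 1)"

text \<open>\<open>C\<^sub>c\<^sup>\<infinity>\<close>: all iterated partial derivatives exist and are (totally) differentiable, hence
  continuous, everywhere; and the support is compact.\<close>

definition test_function :: "(real^'n \<Rightarrow> complex) \<Rightarrow> bool" where
  "test_function \<phi> \<longleftrightarrow>
     (\<forall>is x. fold pd is \<phi> differentiable (at x)) \<and> (\<exists>K. compact K \<and> (\<forall>x. x \<notin> K \<longrightarrow> \<phi> x = 0))"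

definition weak_pd :: "'n \<Rightarrow> (real^'n \<Rightarrow> complex) \<Rightarrow> (real^'n \<Rightarrow> complex) \<Rightarrow> bool" where
  "weak_pd i f g \<longleftrightarrow>
     (\<forall>\<phi>. test_function \<phi> \<longrightarrow> (LINT x|lborel. f x * pd i \<phi> x) = - (LINT x|lborel. g x * \<phi> x))"

definition H1 :: "(real^'n \<Rightarrow> complex) set" where
  "H1 = {f \<in> L2. \<forall>i. \<exists>g\<in>L2. weak_pd i f g}"

text \<open>The choice is unique up to a null set, which does not affect any norm or integral.\<close>

definition wpd :: "'n \<Rightarrow> (real^'n \<Rightarrow> complex) \<Rightarrow> real^'n \<Rightarrow> complex" where
  "wpd i f = (SOME g. g \<in> L2 \<and> weak_pd i f g)"

definition H1_norm :: "(real^'n \<Rightarrow> complex) \<Rightarrow> real" where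
  "H1_norm f = sqrt ((L2_norm f)\<^sup>2 + (\<Sum>i\<in>UNIV. (L2_norm (wpd i f))\<^sup>2))"

section \<open>Curves in function spaces\<close>

definition cont_into ::
  "real set \<Rightarrow> ('a \<Rightarrow> complex) set \<Rightarrow> (('a \<Rightarrow> complex) \<Rightarrow> real) \<Rightarrow> (real \<Rightarrow> 'a \<Rightarrow> complex) \<Rightarrow> bool" where
  "cont_into I X N u \<longleftrightarrow>
     (\<forall>t\<in>I. u t \<in> X \<and> ((\<lambda>s. N (\<lambda>x. u s x - u t x)) \<longlongrightarrow> 0) (at t within I))"

definition has_L2_derivative ::
  "(real \<Rightarrow> 'a::euclidean_space \<Rightarrow> complex) \<Rightarrow> ('a \<Rightarrow> complex) \<Rightarrow> real \<Rightarrow> real set \<Rightarrow> bool" where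
  "has_L2_derivative u w t I \<longleftrightarrow> w \<in> L2 \<and>
     ((\<lambda>s. L2_norm (\<lambda>x. (u s x - u t x) / complex_of_real (s - t) - w x)) \<longlongrightarrow> 0) (at t within I)"

definition C1_into_L2 :: "real set \<Rightarrow> (real \<Rightarrow> 'a::euclidean_space \<Rightarrow> complex) \<Rightarrow> bool" where
  "C1_into_L2 I u \<longleftrightarrow> (\<forall>t\<in>I. u t \<in> L2) \<and>
     (\<exists>u'. cont_into I L2 L2_norm u' \<and> (\<forall>t\<in>I. has_L2_derivative u (u' t) t I))"

definition dt :: "real \<Rightarrow> (real \<Rightarrow> 'a::euclidean_space \<Rightarrow> complex) \<Rightarrow> real \<Rightarrow> 'a \<Rightarrow> complex" where
  "dt T u t = (SOME w. has_L2_derivative u w t {0..<T})"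

definition H0_space :: "real \<Rightarrow> (real \<Rightarrow> real^'n \<Rightarrow> complex) set" where
  "H0_space T = {u. cont_into {0..T} L2 L2_norm u \<and> cont_into {0..<T} H1 H1_norm u \<and>
     C1_into_L2 {0..<T} u}"

section \<open>The operator\<close>

text \<open>\<open>H\<^sup>-\<^sup>1\<close> is the dual of \<open>H\<^sup>1\<close> with respect to the bilinear pairing extending
  \<open>\<integral> f v\<close>; \<open>L2_embed\<close> is the inclusion of \<open>L\<^sup>2\<close> in it and \<open>pd_Hm1\<close> the partial
  derivative from \<open>L\<^sup>2\<close> to \<open>H\<^sup>-\<^sup>1\<close>.\<close>

definition L2_embed :: "(real^'n \<Rightarrow> complex) \<Rightarrow> (real^'n \<Rightarrow> complex) \<Rightarrow> complex" where
  "L2_embed f v = (LINT x|lborel. f x * v x)"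

definition pd_Hm1 :: "'n \<Rightarrow> (real^'n \<Rightarrow> complex) \<Rightarrow> (real^'n \<Rightarrow> complex) \<Rightarrow> complex" where
  "pd_Hm1 i g v = - (LINT x|lborel. g x * wpd i v x)"

definition L_op ::
  "('n \<Rightarrow> 'n \<Rightarrow> real \<Rightarrow> real) \<Rightarrow> ('n \<Rightarrow> real \<Rightarrow> complex) \<Rightarrow> (real \<Rightarrow> complex) \<Rightarrow> real \<Rightarrow>
   (real \<Rightarrow> real^'n \<Rightarrow> complex) \<Rightarrow> real \<Rightarrow> (real^'n \<Rightarrow> complex) \<Rightarrow> complex" where
  "L_op a b c T u t v =
     L2_embed (dt T u t) v
     + (\<Sum>i\<in>UNIV. \<Sum>j\<in>UNIV. pd_Hm1 i (\<lambda>x. complex_of_real (a i j t) * wpd j (u t) x) v)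
     + (\<Sum>j\<in>UNIV. L2_embed (\<lambda>x. b j t * wpd j (u t) x) v)
     + L2_embed (\<lambda>x. c t * u t x) v"

definition solution ::
  "('n \<Rightarrow> 'n \<Rightarrow> real \<Rightarrow> real) \<Rightarrow> ('n \<Rightarrow> real \<Rightarrow> complex) \<Rightarrow> (real \<Rightarrow> complex) \<Rightarrow> real \<Rightarrow>
   (real \<Rightarrow> real^'n \<Rightarrow> complex) \<Rightarrow> bool" where
  "solution a b c T u \<longleftrightarrow> u \<in> H0_space T \<and>
     (AE t in lborel. t \<in> {0<..<T} \<longrightarrow> (\<forall>v\<in>H1. L_op a b c T u t v = 0))"

definition structural ::
  "real \<Rightarrow> real \<Rightarrow> real \<Rightarrow> (real \<Rightarrow> real) \<Rightarrow> real \<Rightarrow>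
   ('n::finite \<Rightarrow> 'n \<Rightarrow> real \<Rightarrow> real) \<Rightarrow> ('n \<Rightarrow> real \<Rightarrow> complex) \<Rightarrow> (real \<Rightarrow> complex) \<Rightarrow> bool" where
  "structural kA kB kC \<omega> T a b c \<longleftrightarrow>
     (\<forall>i j. \<forall>t\<in>{0..T}. a i j t = a j i t) \<and>
     (\<forall>t\<in>{0..T}. \<forall>\<xi>::real^'n.
        kA * (norm \<xi>)\<^sup>2 \<le> (\<Sum>i\<in>UNIV. \<Sum>j\<in>UNIV. a i j t * \<xi> $ i * \<xi> $ j) \<and>
        (\<Sum>i\<in>UNIV. \<Sum>j\<in>UNIV. a i j t * \<xi> $ i * \<xi> $ j) \<le> inverse kA * (norm \<xi>)\<^sup>2) \<and>
     (\<forall>i. \<forall>t\<in>{0..T}. norm (b i t) \<le> kB) \<and>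
     (\<forall>t\<in>{0..T}. norm (c t) \<le> kC) \<and>
     (\<forall>i j. a i j \<in> C_omega \<omega> T)"

end

theory Submission
  imports Defs "HOL-Computational_Algebra.Polynomial"
begin

text \<open>
  Since the coefficients depend on \<open>t\<close> only, the equation commutes with every translation invariant
  smoothing, and one gets a Hoelder estimate \<open>G y = M y\<^sup>\<lambda>\<close>. Let \<open>e\<^sup>-\<^sup>s\<^sup>B\<close>, \<open>s \<ge> 0\<close>, be the heat semigroup of a
  discrete Laplacian \<open>- B\<close> of mesh \<open>h\<close> and \<open>\<Phi>(t, s) = \<langle>e\<^sup>-\<^sup>s\<^sup>B u(t), u(t)\<rangle>\<close>. Ellipticity gives, up to an
  error that vanishes with \<open>h\<close>,
  \<open>- k \<partial>\<^sub>s\<Phi> - C \<Phi> \<le> \<partial>\<^sub>t\<Phi> \<le> - K \<partial>\<^sub>s\<Phi> + C \<Phi>\<close>. Integrating along \<open>s = K t\<close> and along \<open>s = k (t - t\<^sub>1)\<close> yields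
  \<open>\<Phi>(\<tau>, K \<tau>) \<lesssim> \<Phi>(0, 0)\<close> and \<open>\<Phi>(t\<^sub>1, 0) \<lesssim> \<Phi>(\<tau>, k (\<tau> - t\<^sub>1))\<close>, and \<open>\<Phi>(\<tau>, \<sqdot>)\<close> is log-convex.
  The semigroup is the series \<open>\<Sum>\<^sub>m e\<^sup>-\<^sup>N\<^sup>s (N s)\<^sup>m / m! Q\<^sup>m\<close> with the average \<open>Q = 1 - B / N\<close> of translations, so
  that only the sequences \<open>q\<^sub>m(t) = \<langle>Q\<^sup>m u(t), u(t)\<rangle>\<close> enter. No Fourier transform is needed.
\<close>

section \<open>Sequences averaged by Poisson weights\<close>

text \<open>The obstacle is the weak sense of the equation: it holds in the dual of
  \<open>H1\<close> and for almost every \<open>t\<close>, so it may only be tested against elements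
  of \<open>H1\<close>. \<open>Q^m u\<close> is such an element, because \<open>Q\<close> is a
  convex combination of translations and commutes with weak derivatives. With \<open>S_j\<close> the
  translation by \<open>h\<close> along axis \<open>j\<close>, \<open>4 n (1 - Q)\<close> is the sum
  over \<open>j\<close> of \<open>1 - S_j\<close> composed with its adjoint. Hence
  \<open>N (q_m - q_(m+1))\<close> is the \<open>Q^m\<close>-energy of the difference quotients of
  \<open>u\<close>, whereas the equation produces the same energy of the weak derivatives. The gap
  between the two is the error that vanishes with \<open>h\<close>. It does so uniformly in
  \<open>m\<close>, and uniformly in \<open>t\<close> on compact parts of \<open>[0,T[\<close>,
  which is why the argument runs up to some \<tau> < T only. \<open>N\<close> blows up as
  \<open>h\<close> tends to 0, but the final estimate does not contain it. In time the series is
  differentiated only after truncation at an index \<open>M\<close>, which costs one boundary term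
  of known sign. Log-convexity in \<open>s\<close> comes from Cauchy-Schwarz in the form
  \<open>q_(m+1)^2 \<le> q_m q_(m+2)\<close>.\<close>

definition poisson :: "real \<Rightarrow> nat \<Rightarrow> real \<Rightarrow> real" where
  "poisson N m s = exp (- (N * s)) * (N * s) ^ m / fact m"

lemma poisson_nonneg: "0 \<le> N * s \<Longrightarrow> 0 \<le> poisson N m s"
  by (simp add: poisson_def)

lemma poisson_zero: "poisson N m 0 = (if m = 0 then 1 else 0)"
  by (simp add: poisson_def)

lemma poisson_le: "0 \<le> N * s \<Longrightarrow> poisson N m s \<le> (N * s) ^ m / fact m"
  unfolding poisson_def by (intro divide_right_mono mult_left_le_one_le) auto

text \<open>The weights form a subprobability, so an error \<open>\<delta>\<close> made in each
  index contributes at most \<open>\<delta>\<close> to an average.\<close>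

lemma sum_poisson_le_1:
  assumes "0 \<le> N * s"
  shows "(\<Sum>m\<le>M. poisson N m s) \<le> 1"
proof -
  have "(\<Sum>m\<le>M. (N * s) ^ m /\<^sub>R fact m) \<le> exp (N * s)"
    unfolding exp_def using assms by (intro sum_le_suminf summable_exp_generic) auto
  moreover have "(\<Sum>m\<le>M. poisson N m s) = exp (- (N * s)) * (\<Sum>m\<le>M. (N * s) ^ m /\<^sub>R fact m)"
    by (simp add: poisson_def sum_distrib_left divide_inverse_commute mult_ac)
  ultimately have "(\<Sum>m\<le>M. poisson N m s) \<le> exp (- (N * s)) * exp (N * s)"
    by simp
  then show ?thesis by (simp flip: exp_add)
qed

text \<open>The forward equation of a Poisson process of rate \<open>\<kappa> * N\<close>. Weight
  \<open>m\<close> is fed by weight \<open>m - 1\<close>; for \<open>m = 0\<close> there is no such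
  weight, and the case distinction guards against truncated subtraction.\<close>

lemma poisson_deriv:
  "((\<lambda>t. poisson N m (\<kappa> * (t - t\<^sub>0))) has_real_derivative
     \<kappa> * N * ((if m = 0 then 0 else poisson N (m - 1) (\<kappa> * (t - t\<^sub>0))) - poisson N m (\<kappa> * (t - t\<^sub>0)))) (at t)"
proof (cases m)
  case 0
  then show ?thesis
    unfolding poisson_def by (auto intro!: derivative_eq_intros)
next
  case (Suc k)
  define E x where "E = exp (- (N * (\<kappa> * (t - t\<^sub>0))))" and "x = N * (\<kappa> * (t - t\<^sub>0))"
  have "((\<lambda>t. exp (- (N * (\<kappa> * (t - t\<^sub>0)))) * (N * (\<kappa> * (t - t\<^sub>0))) ^ Suc k * inverse (fact (Suc k)))
      has_real_derivative (- (N * \<kappa>) * E * x ^ Suc k + E * (real (Suc k) * (N * \<kappa>) * x ^ k)) * inverse (fact (Suc k))) (at t)"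
    unfolding E_def x_def by (rule derivative_eq_intros refl | simp)+
  also have "(- (N * \<kappa>) * E * x ^ Suc k + E * (real (Suc k) * (N * \<kappa>) * x ^ k)) * inverse (fact (Suc k))
      = \<kappa> * N * (E * x ^ k * (real (Suc k) * inverse (fact (Suc k))) - E * x ^ Suc k * inverse (fact (Suc k)))"
    by (simp add: algebra_simps)
  also have "real (Suc k) * inverse (fact (Suc k)) = inverse (fact k)"
    by (simp add: field_simps del: of_nat_Suc)
  finally show ?thesis
    using Suc by (simp add: poisson_def E_def x_def divide_inverse)
qed

text \<open>The Poisson flow turns the difference \<open>q m - q (Suc m)\<close> into a transport term, so that
  only the boundary term at the truncation index survives.\<close>

lemma poisson_sum_deriv:
  assumes "\<And>m. (q m has_real_derivative q' m) (at t)"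
  shows "((\<lambda>t. \<Sum>m\<le>M. poisson N m (\<kappa> * (t - t\<^sub>0)) * q m t) has_real_derivative
     (\<Sum>m\<le>M. poisson N m (\<kappa> * (t - t\<^sub>0)) * (q' m - \<kappa> * N * (q m t - q (Suc m) t)))
       - \<kappa> * N * poisson N M (\<kappa> * (t - t\<^sub>0)) * q (Suc M) t) (at t)"
proof (induction M)
  case 0
  show ?case
    using DERIV_mult[OF poisson_deriv[of N 0 \<kappa> t\<^sub>0 t] assms[of 0]] by (simp add: algebra_simps)
next
  case (Suc M)
  show ?case
    using DERIV_add[OF Suc.IH DERIV_mult[OF poisson_deriv[of N "Suc M" \<kappa> t\<^sub>0 t] assms[of "Suc M"]]]
    by (simp add: algebra_simps)
qed

lemma poisson_sum_continuous:
  assumes "\<And>m. continuous_on S (q m)"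
  shows "continuous_on S (\<lambda>t. \<Sum>m\<le>M. poisson N m (\<kappa> * (t - t\<^sub>0)) * q m t)"
  unfolding poisson_def by (intro continuous_intros assms) auto

text \<open>The boundary term at index \<open>M\<close> is nonpositive and is dropped, so the bound
  is the same for all \<open>M\<close>. What remains is a Gronwall argument.\<close>

lemma poisson_sum_upper:
  assumes t: "t\<^sub>0 \<le> t\<^sub>1" and pos: "0 \<le> N" "0 \<le> \<kappa>" "0 \<le> C" "0 \<le> \<delta>"
    and cont: "\<And>m. continuous_on {t\<^sub>0..t\<^sub>1} (q m)"
    and deriv: "\<And>m t. t \<in> {t\<^sub>0<..<t\<^sub>1} \<Longrightarrow> (q m has_real_derivative q' m t) (at t)"
    and nonneg: "\<And>m t. t \<in> {t\<^sub>0..t\<^sub>1} \<Longrightarrow> 0 \<le> q m t"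
    and le: "\<And>m t. t \<in> {t\<^sub>0<..<t\<^sub>1} \<Longrightarrow> q' m t \<le> \<kappa> * N * (q m t - q (Suc m) t) + C * q m t + \<delta>"
  shows "(\<Sum>m\<le>M. poisson N m (\<kappa> * (t\<^sub>1 - t\<^sub>0)) * q m t\<^sub>1) \<le> exp (C * (t\<^sub>1 - t\<^sub>0)) * (q 0 t\<^sub>0 + \<delta> * (t\<^sub>1 - t\<^sub>0))"
proof -
  let ?p = "\<lambda>m t. poisson N m (\<kappa> * (t - t\<^sub>0))"
  define S where "S t = (\<Sum>m\<le>M. ?p m t * q m t)" for t
  define S' where "S' t = (\<Sum>m\<le>M. ?p m t * (q' m t - \<kappa> * N * (q m t - q (Suc m) t)))
       - \<kappa> * N * ?p M t * q (Suc M) t" for t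
  \<comment> \<open>Since the exponential factor is at most 1, the slope \<open>\<delta>\<close> of
    the subtracted linear term dominates the weighted error.\<close>
  define F where "F t = exp (- (C * (t - t\<^sub>0))) * S t - \<delta> * (t - t\<^sub>0)" for t
  have p: "0 \<le> ?p m t" if "t\<^sub>0 \<le> t" for m t
    using that pos by (intro poisson_nonneg) auto
  have S: "(S has_real_derivative S' t) (at t)" if "t \<in> {t\<^sub>0<..<t\<^sub>1}" for t
    unfolding S_def S'_def using deriv[OF that] by (intro poisson_sum_deriv)
  have S': "S' t \<le> C * S t + \<delta>" if "t \<in> {t\<^sub>0<..<t\<^sub>1}" for t
  proof -
    have "S' t \<le> (\<Sum>m\<le>M. ?p m t * (q' m t - \<kappa> * N * (q m t - q (Suc m) t)))"
      using p[of t] nonneg[of t] that pos by (simp add: S'_def)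
    also have "\<dots> \<le> (\<Sum>m\<le>M. ?p m t * (C * q m t + \<delta>))"
      using p[of t] le[OF that] that
      by (intro sum_mono mult_left_mono) (auto simp: algebra_simps)
    also have "\<dots> = C * S t + \<delta> * (\<Sum>m\<le>M. ?p m t)"
      by (simp add: S_def algebra_simps sum.distrib sum_distrib_left)
    also have "\<dots> \<le> C * S t + \<delta> * 1"
      using sum_poisson_le_1[of N "\<kappa> * (t - t\<^sub>0)" M] that pos by (intro add_left_mono mult_left_mono) auto
    finally show ?thesis by simp
  qed
  have "F t\<^sub>1 \<le> F t\<^sub>0"
  proof (rule DERIV_nonpos_imp_decreasing_open[OF t])
    fix t assume "t\<^sub>0 < t" "t < t\<^sub>1"
    then have t: "t \<in> {t\<^sub>0<..<t\<^sub>1}" by simp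
    have "(F has_real_derivative exp (- (C * (t - t\<^sub>0))) * (S' t - C * S t) - \<delta>) (at t)"
      unfolding F_def by (auto intro!: derivative_eq_intros S[OF t] simp: algebra_simps)
    moreover have "exp (- (C * (t - t\<^sub>0))) * (S' t - C * S t) \<le> exp (- (C * (t - t\<^sub>0))) * \<delta>"
      using S'[OF t] by (intro mult_left_mono) auto
    then have "exp (- (C * (t - t\<^sub>0))) * (S' t - C * S t) \<le> 1 * \<delta>"
      by (rule order_trans) (use pos t in \<open>intro mult_right_mono, auto\<close>)
    then have "exp (- (C * (t - t\<^sub>0))) * (S' t - C * S t) - \<delta> \<le> 0" by simp
    ultimately show "\<exists>y. (F has_real_derivative y) (at t) \<and> y \<le> 0"
      by blast
  next
    show "continuous_on {t\<^sub>0..t\<^sub>1} F"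
      unfolding F_def S_def by (intro continuous_intros poisson_sum_continuous cont)
  qed
  \<comment> \<open>At the start of the flow all Poisson mass sits at index 0.\<close>
  moreover have "S t\<^sub>0 = q 0 t\<^sub>0"
    unfolding S_def by (simp add: poisson_zero if_distrib[of "\<lambda>x. x * _"] cong: if_cong)
  ultimately have "exp (- (C * (t\<^sub>1 - t\<^sub>0))) * S t\<^sub>1 \<le> q 0 t\<^sub>0 + \<delta> * (t\<^sub>1 - t\<^sub>0)"
    by (simp add: F_def)
  then have "exp (C * (t\<^sub>1 - t\<^sub>0)) * (exp (- (C * (t\<^sub>1 - t\<^sub>0))) * S t\<^sub>1)
      \<le> exp (C * (t\<^sub>1 - t\<^sub>0)) * (q 0 t\<^sub>0 + \<delta> * (t\<^sub>1 - t\<^sub>0))"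
    by (intro mult_left_mono) auto
  then show ?thesis
    by (simp add: S_def mult.assoc[symmetric] flip: exp_add)
qed

text \<open>Here the boundary term has the wrong sign. The bound \<open>B\<close> and the size of
  the last weight turn it into an error of order \<open>x^M / M!\<close>, which disappears for large
  \<open>M\<close>.\<close>

lemma poisson_sum_lower:
  assumes t: "t\<^sub>0 \<le> t\<^sub>1" and pos: "0 \<le> N" "0 \<le> \<kappa>" "0 \<le> C" "0 \<le> \<delta>"
    and cont: "\<And>m. continuous_on {t\<^sub>0..t\<^sub>1} (q m)"
    and deriv: "\<And>m t. t \<in> {t\<^sub>0<..<t\<^sub>1} \<Longrightarrow> (q m has_real_derivative q' m t) (at t)"
    and nonneg: "\<And>m t. t \<in> {t\<^sub>0..t\<^sub>1} \<Longrightarrow> 0 \<le> q m t"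
    and bound: "\<And>m t. t \<in> {t\<^sub>0..t\<^sub>1} \<Longrightarrow> q m t \<le> B"
    and ge: "\<And>m t. t \<in> {t\<^sub>0<..<t\<^sub>1} \<Longrightarrow> \<kappa> * N * (q m t - q (Suc m) t) - C * q m t - \<delta> \<le> q' m t"
  shows "q 0 t\<^sub>0 \<le> exp (C * (t\<^sub>1 - t\<^sub>0)) * ((\<Sum>m\<le>M. poisson N m (\<kappa> * (t\<^sub>1 - t\<^sub>0)) * q m t\<^sub>1)
            + (\<delta> + \<kappa> * N * B * ((N * (\<kappa> * (t\<^sub>1 - t\<^sub>0))) ^ M / fact M)) * (t\<^sub>1 - t\<^sub>0))"
proof -
  let ?p = "\<lambda>m t. poisson N m (\<kappa> * (t - t\<^sub>0))"
  define R where "R = \<delta> + \<kappa> * N * B * ((N * (\<kappa> * (t\<^sub>1 - t\<^sub>0))) ^ M / fact M)"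
  define S where "S t = (\<Sum>m\<le>M. ?p m t * q m t)" for t
  define S' where "S' t = (\<Sum>m\<le>M. ?p m t * (q' m t - \<kappa> * N * (q m t - q (Suc m) t)))
       - \<kappa> * N * ?p M t * q (Suc M) t" for t
  \<comment> \<open>The factor of the linear term is frozen at the largest value of the exponential,
    so that its derivative is constant and still dominates the error
    \<open>exp (C * (t - t\<^sub>0)) * R\<close>.\<close>
  define F where "F t = exp (C * (t - t\<^sub>0)) * S t + exp (C * (t\<^sub>1 - t\<^sub>0)) * R * (t - t\<^sub>0)" for t
  have B: "0 \<le> B"
    using nonneg[of t\<^sub>0 0] bound[of t\<^sub>0 0] t by auto
  have R: "0 \<le> R"
    using pos B t unfolding R_def by auto
  have p: "0 \<le> ?p m t" if "t\<^sub>0 \<le> t" for m t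
    using that pos by (intro poisson_nonneg) auto
  have S: "(S has_real_derivative S' t) (at t)" if "t \<in> {t\<^sub>0<..<t\<^sub>1}" for t
    unfolding S_def S'_def using deriv[OF that] by (intro poisson_sum_deriv)
  have S': "- C * S t - R \<le> S' t" if "t \<in> {t\<^sub>0<..<t\<^sub>1}" for t
  proof -
    have "?p M t \<le> (N * (\<kappa> * (t - t\<^sub>0))) ^ M / fact M"
      using that pos by (intro poisson_le) auto
    also have "\<dots> \<le> (N * (\<kappa> * (t\<^sub>1 - t\<^sub>0))) ^ M / fact M"
      using that pos by (intro divide_right_mono power_mono mult_left_mono) auto
    finally have "?p M t * q (Suc M) t \<le> (N * (\<kappa> * (t\<^sub>1 - t\<^sub>0))) ^ M / fact M * B"
      using that bound nonneg p pos by (intro mult_mono) auto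
    then have "\<kappa> * N * (?p M t * q (Suc M) t) \<le> \<kappa> * N * ((N * (\<kappa> * (t\<^sub>1 - t\<^sub>0))) ^ M / fact M * B)"
      using pos by (intro mult_left_mono) auto
    then have "- C * S t - R \<le> - C * S t - \<delta> * 1 - \<kappa> * N * ?p M t * q (Suc M) t"
      by (simp add: R_def algebra_simps)
    also have "\<dots> \<le> - C * S t - \<delta> * (\<Sum>m\<le>M. ?p m t) - \<kappa> * N * ?p M t * q (Suc M) t"
      using sum_poisson_le_1[of N "\<kappa> * (t - t\<^sub>0)" M] that pos
      by (intro diff_right_mono diff_left_mono mult_left_mono) auto
    also have "\<dots> = (\<Sum>m\<le>M. ?p m t * (- C * q m t - \<delta>)) - \<kappa> * N * ?p M t * q (Suc M) t"
      by (simp add: S_def algebra_simps sum.distrib sum_distrib_left sum_negf sum_subtractf)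
    also have "\<dots> \<le> S' t"
      unfolding S'_def using p[of t] ge[OF that] that
      by (intro diff_right_mono sum_mono mult_left_mono) (auto simp: algebra_simps)
    finally show ?thesis .
  qed
  have "F t\<^sub>0 \<le> F t\<^sub>1"
  proof (rule DERIV_nonneg_imp_increasing_open[OF t])
    fix t assume "t\<^sub>0 < t" "t < t\<^sub>1"
    then have t: "t \<in> {t\<^sub>0<..<t\<^sub>1}" by simp
    have "(F has_real_derivative exp (C * (t - t\<^sub>0)) * (S' t + C * S t) + exp (C * (t\<^sub>1 - t\<^sub>0)) * R) (at t)"
      unfolding F_def by (auto intro!: derivative_eq_intros S[OF t] simp: algebra_simps)
    moreover have "exp (C * (t - t\<^sub>0)) * (- R) \<le> exp (C * (t - t\<^sub>0)) * (S' t + C * S t)"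
      using S'[OF t] by (intro mult_left_mono) auto
    then have "0 \<le> exp (C * (t - t\<^sub>0)) * (S' t + C * S t) + exp (C * (t - t\<^sub>0)) * R"
      by (simp add: algebra_simps)
    then have "0 \<le> exp (C * (t - t\<^sub>0)) * (S' t + C * S t) + exp (C * (t\<^sub>1 - t\<^sub>0)) * R"
      by (rule order_trans) (use pos t R in \<open>auto intro!: mult_right_mono mult_left_mono\<close>)
    ultimately show "\<exists>y. (F has_real_derivative y) (at t) \<and> 0 \<le> y"
      by blast
  next
    show "continuous_on {t\<^sub>0..t\<^sub>1} F"
      unfolding F_def S_def by (intro continuous_intros poisson_sum_continuous cont)
  qed
  moreover have "S t\<^sub>0 = q 0 t\<^sub>0"
    unfolding S_def by (simp add: poisson_zero if_distrib[of "\<lambda>x. x * _"] cong: if_cong)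
  ultimately show ?thesis
    by (simp add: F_def S_def R_def algebra_simps)
qed

section \<open>Exponential generating functions, their log-convexity, and the heat average\<close>

definition exp_gen :: "(nat \<Rightarrow> real) \<Rightarrow> real \<Rightarrow> real" where
  "exp_gen q x = (\<Sum>m. q m / fact m * x ^ m)"

lemma exp_gen_summable:
  assumes "\<And>m. \<bar>q m\<bar> \<le> B"
  shows "summable (\<lambda>m. q m / fact m * (x::real) ^ m)"
proof (rule summable_comparison_test')
  have "summable (\<lambda>m. (\<bar>x\<bar>) ^ m /\<^sub>R fact m)" by (rule summable_exp_generic)
  then show "summable (\<lambda>m. B * ((\<bar>x\<bar>) ^ m /\<^sub>R fact m))" by (rule summable_mult)
  show "norm (q m / fact m * x ^ m) \<le> B * (\<bar>x\<bar> ^ m /\<^sub>R fact m)" for m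
    using mult_right_mono[OF assms[of m], of "\<bar>x\<bar> ^ m /\<^sub>R fact m"]
    by (simp add: abs_mult power_abs divide_inverse mult_ac)
qed

text \<open>Differentiation shifts the sequence, as the factorials absorb the factor produced by
  \<open>diffs\<close>; boundedness of \<open>q\<close> gives convergence everywhere.\<close>

lemma exp_gen_deriv:
  assumes "\<And>m. \<bar>q m\<bar> \<le> B"
  shows "(exp_gen q has_real_derivative exp_gen (\<lambda>m. q (Suc m)) x) (at x)"
proof -
  have "diffs (\<lambda>m. q m / fact m) = (\<lambda>m. q (Suc m) / fact m)"
    by (rule ext) (simp add: diffs_def field_simps del: of_nat_Suc)
  then show ?thesis
    unfolding exp_gen_def[abs_def]
    using termdiffs_strong_converges_everywhere[of "\<lambda>m. q m / fact m" x] exp_gen_summable[OF assms] by simp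
qed

lemma exp_gen_zero: "exp_gen (\<lambda>_. 0) x = 0"
  by (simp add: exp_gen_def)

lemma exp_gen_mono:
  assumes "\<And>m. \<bar>q m\<bar> \<le> B" "\<And>m. \<bar>r m\<bar> \<le> B'" "\<And>m. q m \<le> r m" "0 \<le> x"
  shows "exp_gen q x \<le> exp_gen r x"
  unfolding exp_gen_def using assms(3,4)
  by (intro suminf_le exp_gen_summable[where q = q, OF assms(1)] exp_gen_summable[where q = r, OF assms(2)]
      mult_right_mono divide_right_mono) auto

lemma exp_gen_pos:
  assumes "\<And>m. \<bar>q m\<bar> \<le> B" "\<And>m. 0 \<le> q m" "0 < q 0" "0 \<le> x"
  shows "0 < exp_gen q x"
proof -
  have "q 0 = (\<Sum>m<1. q m / fact m * x ^ m)" by simp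
  also have "\<dots> \<le> exp_gen q x"
    unfolding exp_gen_def using assms(2,4)
    by (intro sum_le_suminf exp_gen_summable[OF assms(1)] mult_nonneg_nonneg divide_nonneg_nonneg) auto
  finally show ?thesis using assms(3) by simp
qed

text \<open>For \<open>g = exp_gen q\<close> the claim is \<open>g'^2 \<le> g * g''\<close>. It is
  obtained termwise: the hypothesis and the inequality of means give
  \<open>2 * l * q (Suc m) \<le> l^2 * q m + q (Suc (Suc m))\<close> for each
  \<open>l \<ge> 0\<close>, and this can be summed.\<close>

lemma log_convex_exp_gen:
  assumes pos: "\<And>m. 0 \<le> q m" and q0: "0 < q 0" and bdd: "\<And>m. \<bar>q m\<bar> \<le> B"
    and lc: "\<And>m. (q (Suc m))\<^sup>2 \<le> q m * q (Suc (Suc m))"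
  shows "convex_on {0..} (\<lambda>x. ln (exp_gen q x))"
proof -
  define q1 q2 where "q1 m = q (Suc m)" and "q2 m = q (Suc (Suc m))" for m
  have bdd': "\<bar>q1 m\<bar> \<le> B" "\<bar>q2 m\<bar> \<le> B" for m
    by (auto simp: q1_def q2_def bdd)
  have gpos: "exp_gen q x > 0" if "0 \<le> x" for x
    using exp_gen_pos[of q, OF bdd pos q0 that] .
  have d0: "(exp_gen q has_real_derivative exp_gen q1 x) (at x)" for x
    unfolding q1_def by (rule exp_gen_deriv[OF bdd])
  have d1: "(exp_gen q1 has_real_derivative exp_gen q2 x) (at x)" for x
    using exp_gen_deriv[of q1 B, OF bdd'(1)] by (simp add: q1_def[abs_def] q2_def[abs_def])
  have nonneg: "0 \<le> exp_gen q1 x" "0 \<le> exp_gen q2 x" if "0 \<le> x" for x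
    using exp_gen_mono[of "\<lambda>_. 0" 0 q1 B x] exp_gen_mono[of "\<lambda>_. 0" 0 q2 B x] that bdd' pos
    by (auto simp: q1_def q2_def exp_gen_zero)
  have cs: "(exp_gen q1 x)\<^sup>2 \<le> exp_gen q x * exp_gen q2 x" if x: "0 \<le> x" for x
  proof -
    \<comment> \<open>The optimal parameter: with it \<open>2 * l * g' \<le> l^2 * g + g''\<close>
      becomes \<open>g'^2 \<le> g * g''\<close>.\<close>
    define l where "l = exp_gen q1 x / exp_gen q x"
    have "2 * l * q1 m \<le> l\<^sup>2 * q m + q2 m" for m
    proof -
      have "q1 m \<le> sqrt (q m * q2 m)"
        using lc[of m] by (intro real_le_rsqrt) (simp add: q1_def q2_def)
      then have "2 * l * q1 m \<le> 2 * l * sqrt (q m * q2 m)"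
        using nonneg[OF x] gpos[OF x] by (intro mult_left_mono) (auto simp: l_def)
      also have "\<dots> \<le> l\<^sup>2 * q m + q2 m"
        using zero_le_power2[of "l * sqrt (q m) - sqrt (q2 m)"] pos[of m] pos[of "Suc (Suc m)"]
        by (simp add: power2_diff power_mult_distrib real_sqrt_mult q2_def algebra_simps)
      finally show ?thesis .
    qed
    then have "2 * l * q1 m / fact m * x ^ m \<le> (l\<^sup>2 * q m + q2 m) / fact m * x ^ m" for m
      using x by (intro mult_right_mono divide_right_mono) auto
    then have "(\<Sum>m. 2 * l * (q1 m / fact m * x ^ m))
        \<le> (\<Sum>m. l\<^sup>2 * (q m / fact m * x ^ m) + q2 m / fact m * x ^ m)"
      by (intro suminf_le summable_mult summable_add exp_gen_summable[OF bdd] exp_gen_summable[OF bdd'(1)]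
          exp_gen_summable[OF bdd'(2)]) (simp add: algebra_simps add_divide_distrib)
    also have "\<dots> = l\<^sup>2 * exp_gen q x + exp_gen q2 x"
      unfolding exp_gen_def
      by (simp only: suminf_mult[OF exp_gen_summable[of q, OF bdd]]
          suminf_add[OF summable_mult[OF exp_gen_summable[of q, OF bdd]] exp_gen_summable[of q2, OF bdd'(2)], symmetric])
    finally have "2 * l * exp_gen q1 x \<le> l\<^sup>2 * exp_gen q x + exp_gen q2 x"
      by (simp only: exp_gen_def suminf_mult[OF exp_gen_summable[of q1, OF bdd'(1)]])
    then show ?thesis
      using gpos[OF x] by (simp add: l_def power2_eq_square field_simps)
  qed
  show ?thesis
  proof (rule f''_ge0_imp_convex)
    show "convex {0::real..}" by simp
    fix x :: real assume "x \<in> {0..}"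
    then have x: "0 \<le> x" by simp
    show "((\<lambda>x. ln (exp_gen q x)) has_real_derivative exp_gen q1 x / exp_gen q x) (at x)"
      using gpos[OF x] by (auto intro!: derivative_eq_intros d0)
    show "((\<lambda>x. exp_gen q1 x / exp_gen q x) has_real_derivative
        (exp_gen q2 x * exp_gen q x - exp_gen q1 x * exp_gen q1 x) / (exp_gen q x * exp_gen q x)) (at x)"
      using gpos[OF x] by (auto intro!: derivative_eq_intros d0 d1)
    show "0 \<le> (exp_gen q2 x * exp_gen q x - exp_gen q1 x * exp_gen q1 x) / (exp_gen q x * exp_gen q x)"
      using cs[OF x] by (simp add: power2_eq_square mult_ac)
  qed
qed

definition heat :: "real \<Rightarrow> (nat \<Rightarrow> real) \<Rightarrow> real \<Rightarrow> real" where
  "heat N q s = exp (- (N * s)) * exp_gen q (N * s)"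

lemma heat_sums:
  assumes "\<And>m. \<bar>q m\<bar> \<le> B"
  shows "(\<lambda>m. poisson N m s * q m) sums heat N q s"
proof -
  have "(\<lambda>m. exp (- (N * s)) * (q m / fact m * (N * s) ^ m)) sums heat N q s"
    unfolding heat_def exp_gen_def
    by (intro sums_mult summable_sums exp_gen_summable[OF assms])
  then show ?thesis
    by (simp add: poisson_def mult_ac)
qed

text \<open>The factor \<open>exp (- (N * s))\<close> is log-linear and equals 1 at 0, so
  log-convexity passes from \<open>exp_gen q\<close> to \<open>heat\<close>. The logarithm needs
  \<open>q 0 > 0\<close>; otherwise monotonicity makes the whole sequence vanish.\<close>

lemma heat_interpolation:
  assumes pos: "\<And>m. 0 \<le> q m" and dec: "\<And>m. q (Suc m) \<le> q m"
    and lc: "\<And>m. (q (Suc m))\<^sup>2 \<le> q m * q (Suc (Suc m))"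
    and N: "0 \<le> N" "0 \<le> s" and l: "0 < l" "l < 1"
  shows "heat N q (l * s) \<le> q 0 powr (1 - l) * heat N q s powr l"
proof (cases "q 0 = 0")
  case True
  have "q m = 0" for m
  proof (induction m)
    case (Suc m)
    then show ?case using dec[of m] pos[of "Suc m"] by simp
  qed (use True in simp)
  then show ?thesis
    by (simp add: heat_def exp_gen_def)
next
  case False
  then have q0: "0 < q 0" using pos[of 0] by simp
  have le0: "q m \<le> q 0" for m
    by (induction m) (use dec order_trans in blast)+
  have bdd: "\<bar>q m\<bar> \<le> q 0" for m
    using pos le0 by simp
  have gpos: "exp_gen q x > 0" if "0 \<le> x" for x
    using exp_gen_pos[of q, OF bdd pos q0 that] .
  have g0: "exp_gen q 0 = q 0"
    unfolding exp_gen_def by (subst powser_zero) simp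
  have "ln (exp_gen q ((1 - l) *\<^sub>R 0 + l *\<^sub>R (N * s))) \<le> (1 - l) * ln (exp_gen q 0) + l * ln (exp_gen q (N * s))"
    using l N by (intro convex_onD[OF log_convex_exp_gen[OF pos q0 bdd lc]]) auto
  then have "exp (ln (exp_gen q (l * (N * s)))) \<le> exp ((1 - l) * ln (q 0) + l * ln (exp_gen q (N * s)))"
    by (simp add: g0)
  then have "exp_gen q (l * (N * s)) \<le> q 0 powr (1 - l) * exp_gen q (N * s) powr l"
    using l N gpos[of "l * (N * s)"] gpos[of "N * s"] q0 by (simp add: exp_add powr_def)
  then have "exp (- (N * (l * s))) * exp_gen q (N * (l * s))
      \<le> exp (- (N * (l * s))) * (q 0 powr (1 - l) * exp_gen q (N * s) powr l)"
    by (intro mult_left_mono) (auto simp: mult_ac)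
  also have "exp (- (N * (l * s))) * (q 0 powr (1 - l) * exp_gen q (N * s) powr l)
      = q 0 powr (1 - l) * heat N q s powr l"
  proof -
    have "exp (- (N * (l * s))) = exp (- (N * s)) powr l"
      by (simp add: exp_powr_real mult_ac)
    then show ?thesis
      using gpos[of "N * s"] N unfolding heat_def by (simp add: powr_mult mult_ac)
  qed
  finally show ?thesis unfolding heat_def .
qed

text \<open>The derivative is \<open>N\<close> times the Poisson average of the nonpositive
  increments \<open>q (Suc m) - q m\<close>.\<close>

lemma heat_antimono:
  assumes pos: "\<And>m. 0 \<le> q m" and dec: "\<And>m. q (Suc m) \<le> q m"
    and N: "0 \<le> N" "0 \<le> s" "s \<le> s'"
  shows "heat N q s' \<le> heat N q s"
proof (rule DERIV_nonpos_imp_nonincreasing[OF N(3)])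
  have le0: "q m \<le> q 0" for m
    by (induction m) (use dec order_trans in blast)+
  have bdd: "\<bar>q m\<bar> \<le> q 0" for m
    using pos le0 by simp
  fix x assume x: "s \<le> x" "x \<le> s'"
  have "((\<lambda>x. exp_gen q (N * x)) has_real_derivative exp_gen (\<lambda>m. q (Suc m)) (N * x) * N) (at x)"
    by (rule DERIV_chain2[OF exp_gen_deriv[OF bdd]]) (auto intro!: derivative_eq_intros)
  then have "(heat N q has_real_derivative
      exp (- (N * x)) * N * (exp_gen (\<lambda>m. q (Suc m)) (N * x) - exp_gen q (N * x))) (at x)"
    unfolding heat_def[abs_def] by (auto intro!: derivative_eq_intros simp: algebra_simps)
  moreover have "exp_gen (\<lambda>m. q (Suc m)) (N * x) \<le> exp_gen q (N * x)"
    using N x dec bdd by (intro exp_gen_mono[where B = "q 0" and B' = "q 0"]) auto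
  ultimately show "\<exists>y. (heat N q has_real_derivative y) (at x) \<and> y \<le> 0"
    using N by (intro exI conjI) (auto intro!: mult_nonneg_nonpos)
qed

text \<open>Three lines argument: the two differential inequalities propagate \<open>heat\<close> along the
  characteristics \<open>s = K t\<close> and \<open>s = k (t - t\<^sub>1)\<close>, and \<open>heat\<close> is log-convex in \<open>s\<close>.\<close>

lemma interpolation_in_time:
  fixes q :: "nat \<Rightarrow> real \<Rightarrow> real"
  assumes t: "0 \<le> t\<^sub>1" "t\<^sub>1 \<le> t\<^sub>2" "0 < t\<^sub>2" "t\<^sub>2 < \<tau>" and N: "0 \<le> N"
    and k: "0 < k" "k \<le> K" and C: "0 \<le> C" and \<delta>: "0 \<le> \<delta>"
    and cont: "\<And>m. continuous_on {0..\<tau>} (q m)"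
    and deriv: "\<And>m t. t \<in> {0<..<\<tau>} \<Longrightarrow> (q m has_real_derivative q' m t) (at t)"
    and pos: "\<And>m t. t \<in> {0..\<tau>} \<Longrightarrow> 0 \<le> q m t"
    and dec: "\<And>m t. t \<in> {0..\<tau>} \<Longrightarrow> q (Suc m) t \<le> q m t"
    and lc: "\<And>m t. t \<in> {0..\<tau>} \<Longrightarrow> (q (Suc m) t)\<^sup>2 \<le> q m t * q (Suc (Suc m)) t"
    and upper: "\<And>m t. t \<in> {0<..<\<tau>} \<Longrightarrow> q' m t \<le> K * N * (q m t - q (Suc m) t) + C * q m t + \<delta>"
    and lower: "\<And>m t. t \<in> {0<..<\<tau>} \<Longrightarrow> k * N * (q m t - q (Suc m) t) - C * q m t - \<delta> \<le> q' m t"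
    and bound: "\<And>t. t \<in> {0..\<tau>} \<Longrightarrow> q 0 t \<le> B"
    and l: "l = k * (\<tau> - t\<^sub>2) / (K * \<tau>)"
  shows "q 0 t\<^sub>1 \<le> exp (C * \<tau>) * (B powr (1 - l) * (exp (C * \<tau>) * (q 0 0 + \<delta> * \<tau>)) powr l + \<delta> * \<tau>)"
proof -
  have \<tau>: "0 < \<tau>" using t by simp
  have le0: "q m t \<le> q 0 t" if "t \<in> {0..\<tau>}" for m t
    by (induction m) (use dec[OF that] order_trans in blast)+
  have bdd: "\<bar>q m t\<bar> \<le> B" if "t \<in> {0..\<tau>}" for m t
    using pos[OF that] order_trans[OF le0[OF that] bound[OF that]] by simp
  have B: "0 \<le> B" using bdd[of 0 0] \<tau> by simp
  \<comment> \<open>Both characteristics end at time \<open>\<tau>\<close>, at the parameters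
    \<open>K * \<tau>\<close> and \<open>k * (\<tau> - t\<^sub>1)\<close>, so only the sequence at
    this time is interpolated.\<close>
  define Q where "Q m = q m \<tau>" for m
  have Q: "0 \<le> Q m" "Q (Suc m) \<le> Q m" "(Q (Suc m))\<^sup>2 \<le> Q m * Q (Suc (Suc m))" "\<bar>Q m\<bar> \<le> B" for m
    using pos[of \<tau>] dec[of \<tau>] lc[of \<tau>] bdd[of \<tau>] \<tau> by (auto simp: Q_def)
  have heat0: "0 \<le> heat N Q s" if "0 \<le> s" for s
    using that N Q(1)
    by (intro sums_le[OF _ sums_zero heat_sums[of Q B, OF Q(4)]] mult_nonneg_nonneg poisson_nonneg) auto
  have lim: "(\<lambda>M. \<Sum>m\<le>M. poisson N m s * Q m) \<longlonglongrightarrow> heat N Q s" for s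
    using heat_sums[of Q B, OF Q(4)] by (simp add: sums_def_le)
  have up: "heat N Q (K * \<tau>) \<le> exp (C * \<tau>) * (q 0 0 + \<delta> * \<tau>)"
  proof (rule LIMSEQ_le_const2[OF lim])
    have "(\<Sum>m\<le>M. poisson N m (K * (\<tau> - 0)) * q m \<tau>) \<le> exp (C * (\<tau> - 0)) * (q 0 0 + \<delta> * (\<tau> - 0))" for M
      using t k by (intro poisson_sum_upper[where q' = q']) (auto intro: cont deriv pos upper N C \<delta>)
    then show "\<exists>M\<^sub>0. \<forall>M\<ge>M\<^sub>0. (\<Sum>m\<le>M. poisson N m (K * \<tau>) * Q m) \<le> exp (C * \<tau>) * (q 0 0 + \<delta> * \<tau>)"
      by (auto simp: Q_def)
  qed
  have low: "q 0 t\<^sub>1 \<le> exp (C * (\<tau> - t\<^sub>1)) * (heat N Q (k * (\<tau> - t\<^sub>1)) + \<delta> * (\<tau> - t\<^sub>1))"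
  proof (rule LIMSEQ_le_const)
    let ?x = "N * (k * (\<tau> - t\<^sub>1))"
    have "(\<lambda>M. ?x ^ M / fact M) \<longlonglongrightarrow> 0"
      using summable_LIMSEQ_zero[OF summable_exp_generic[of ?x]] by (simp add: divide_inverse_commute)
    then have "(\<lambda>M. exp (C * (\<tau> - t\<^sub>1)) * ((\<Sum>m\<le>M. poisson N m (k * (\<tau> - t\<^sub>1)) * Q m)
            + (\<delta> + k * N * B * (?x ^ M / fact M)) * (\<tau> - t\<^sub>1)))
         \<longlonglongrightarrow> exp (C * (\<tau> - t\<^sub>1)) * (heat N Q (k * (\<tau> - t\<^sub>1)) + (\<delta> + k * N * B * 0) * (\<tau> - t\<^sub>1))"
      by (intro tendsto_intros lim)
    then show "(\<lambda>M. exp (C * (\<tau> - t\<^sub>1)) * ((\<Sum>m\<le>M. poisson N m (k * (\<tau> - t\<^sub>1)) * Q m)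
            + (\<delta> + k * N * B * (?x ^ M / fact M)) * (\<tau> - t\<^sub>1)))
         \<longlonglongrightarrow> exp (C * (\<tau> - t\<^sub>1)) * (heat N Q (k * (\<tau> - t\<^sub>1)) + \<delta> * (\<tau> - t\<^sub>1))"
      by simp
    have "q m t \<le> B" if "t \<in> {0..\<tau>}" for m t
      using bdd[OF that] abs_le_D1 by blast
    then have "q 0 t\<^sub>1 \<le> exp (C * (\<tau> - t\<^sub>1)) * ((\<Sum>m\<le>M. poisson N m (k * (\<tau> - t\<^sub>1)) * q m \<tau>)
            + (\<delta> + k * N * B * (?x ^ M / fact M)) * (\<tau> - t\<^sub>1))" for M
      using t k by (intro poisson_sum_lower[where q' = q'])
        (auto intro: deriv pos lower N C \<delta> continuous_on_subset[OF cont])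
    then show "\<exists>M\<^sub>0. \<forall>M\<ge>M\<^sub>0. q 0 t\<^sub>1 \<le> exp (C * (\<tau> - t\<^sub>1)) * ((\<Sum>m\<le>M. poisson N m (k * (\<tau> - t\<^sub>1)) * Q m)
            + (\<delta> + k * N * B * (?x ^ M / fact M)) * (\<tau> - t\<^sub>1))"
      by (auto simp: Q_def)
  qed
  have "k * (\<tau> - t\<^sub>2) < K * \<tau>"
    using k t \<tau> by (intro mult_le_less_imp_less) auto
  then have l01: "0 < l" "l < 1"
    using k t \<tau> by (auto simp: l)
  \<comment> \<open>The relative position of \<open>k * (\<tau> - t\<^sub>2)\<close> between 0 and
    \<open>K * \<tau>\<close> is the Hoelder exponent.\<close>
  have ls: "l * (K * \<tau>) = k * (\<tau> - t\<^sub>2)"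
    using k \<tau> by (simp add: l)
  have "heat N Q (l * (K * \<tau>)) \<le> Q 0 powr (1 - l) * heat N Q (K * \<tau>) powr l"
    using l01 k \<tau> by (intro heat_interpolation Q N) auto
  also have "\<dots> \<le> B powr (1 - l) * heat N Q (K * \<tau>) powr l"
    using Q(1)[of 0] Q(4)[of 0] l01 by (intro mult_right_mono powr_mono2) auto
  finally have inter: "heat N Q (k * (\<tau> - t\<^sub>2)) \<le> B powr (1 - l) * heat N Q (K * \<tau>) powr l"
    by (simp add: ls)
  have "q 0 t\<^sub>1 \<le> exp (C * (\<tau> - t\<^sub>1)) * (heat N Q (k * (\<tau> - t\<^sub>1)) + \<delta> * (\<tau> - t\<^sub>1))" by (rule low)
  \<comment> \<open>Monotonicity of \<open>heat\<close> replaces the end point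
    \<open>k * (\<tau> - t\<^sub>1)\<close> by the smaller \<open>k * (\<tau> - t\<^sub>2)\<close>,
    so that \<open>l\<close> is the same for all \<open>t\<^sub>1\<close>.\<close>
  also have "\<dots> \<le> exp (C * \<tau>) * (heat N Q (k * (\<tau> - t\<^sub>2)) + \<delta> * \<tau>)"
    using t k C \<delta> N
    by (intro mult_mono add_mono heat_antimono Q add_nonneg_nonneg heat0) (auto intro!: mult_left_mono)
  also have "\<dots> \<le> exp (C * \<tau>) * (B powr (1 - l) * heat N Q (K * \<tau>) powr l + \<delta> * \<tau>)"
    using inter by simp
  also have "\<dots> \<le> exp (C * \<tau>) * (B powr (1 - l) * (exp (C * \<tau>) * (q 0 0 + \<delta> * \<tau>)) powr l + \<delta> * \<tau>)"
    using up heat0[of "K * \<tau>"] l01 k \<tau>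
    by (intro mult_left_mono add_right_mono powr_mono2) auto
  finally show ?thesis .
qed

section \<open>Test functions\<close>

text \<open>The classical flat function for \<open>k = 0\<close>; the divisors \<open>y ^ k\<close>
  are those that occur in its derivatives.\<close>

definition bump :: "nat \<Rightarrow> real \<Rightarrow> real" where
  "bump k y = (if y > 0 then exp (- (1 / y)) / y ^ k else 0)"

lemma bump_shift: "bump k y = y ^ j * bump (k + j) y"
  by (auto simp: bump_def power_add)

lemma bump_nonneg: "0 \<le> bump k y"
  by (simp add: bump_def)

lemma bump_0_le_1: "bump 0 y \<le> 1"
  by (simp add: bump_def)

lemma bump_nonpos: "y \<le> 0 \<Longrightarrow> bump k y = 0"
  by (simp add: bump_def)

text \<open>A single term of the exponential series at \<open>1 / y\<close> dominates
  \<open>(1 / y) ^ k\<close> up to the factor \<open>fact k\<close>.\<close>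

lemma bump_bounded: "bump k y \<le> fact k"
proof (cases "y > 0")
  case True
  have "(1 / y) ^ k /\<^sub>R fact k = (\<Sum>m\<in>{k}. (1 / y) ^ m /\<^sub>R fact m)" by simp
  also have "\<dots> \<le> exp (1 / y)"
    unfolding exp_def using True by (intro sum_le_suminf summable_exp_generic) auto
  finally have "fact k * ((1 / y) ^ k /\<^sub>R fact k) \<le> fact k * exp (1 / y)"
    by (intro mult_left_mono) auto
  then have "(1 / y) ^ k \<le> fact k * exp (1 / y)"
    by (simp only: scaleR_conv_of_real mult.assoc[symmetric]) simp
  then have "exp (- (1 / y)) * (1 / y) ^ k \<le> exp (- (1 / y)) * (fact k * exp (1 / y))"
    by (intro mult_left_mono) auto
  also have "\<dots> = fact k"
    by (simp add: exp_minus field_simps)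
  finally show ?thesis
    using True by (simp add: bump_def power_divide)
qed (simp add: bump_def)

lemma bump_deriv:
  "(bump k has_real_derivative bump (k + 2) y - real k * bump (k + 1) y) (at y)"
proof -
  consider "y > 0" | "y < 0" | "y = 0" by linarith
  then show ?thesis
  proof cases
    case 1
    have "((\<lambda>y. exp (- (1 / y)) / y ^ k) has_real_derivative
        (exp (- (1 / y)) * (1 / y\<^sup>2) * y ^ k - exp (- (1 / y)) * (real k * y ^ (k - 1))) / (y ^ k * y ^ k)) (at y)"
      using 1 by (auto intro!: derivative_eq_intros simp: power2_eq_square)
    moreover have "real k * y ^ (k - 1) = real k * y ^ k / y"
      using 1 by (cases k) auto
    ultimately have "((\<lambda>y. exp (- (1 / y)) / y ^ k) has_real_derivative bump (k + 2) y - real k * bump (k + 1) y) (at y)"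
      using 1 by (simp add: bump_def diff_divide_distrib power_add power2_eq_square mult.commute)
    then show ?thesis
      by (rule has_field_derivative_transform_within_open[of _ _ _ "{0<..}"]) (use 1 in \<open>auto simp: bump_def\<close>)
  next
    case 2
    have "((\<lambda>y. 0) has_real_derivative bump (k + 2) y - real k * bump (k + 1) y) (at y)"
      using 2 by (simp add: bump_def)
    then show ?thesis
      by (rule has_field_derivative_transform_within_open[of _ _ _ "{..<0}"]) (use 2 in \<open>auto simp: bump_def\<close>)
  next
    case 3
    \<comment> \<open>Near the origin \<open>bump k h / h = h * bump (k + 2) h\<close>, whose second
      factor is bounded.\<close>
    have "((\<lambda>h. bump k h / h) \<longlongrightarrow> 0) (at 0)"
    proof (rule tendsto_0_le[where K = "fact (Suc (Suc k))"])
      show "((\<lambda>h::real. h) \<longlongrightarrow> 0) (at 0)" by (rule tendsto_ident_at)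
      have "\<bar>bump k h / h\<bar> \<le> \<bar>h\<bar> * fact (Suc (Suc k))" for h
        using bump_nonneg[of "k + 2" h] bump_bounded[of "k + 2" h]
        by (subst bump_shift[of k h 2]) (auto simp: power2_eq_square abs_mult intro!: mult_left_mono)
      then show "eventually (\<lambda>h. norm (bump k h / h) \<le> norm h * fact (Suc (Suc k))) (at 0)"
        by simp
    qed
    then show ?thesis
      using 3 by (simp add: has_field_derivative_iff bump_def)
  qed
qed

text \<open>As \<open>bump k y = y\<^sup>2 * bump (k + 2) y\<close>, the functions \<open>bump_fun q k p\<close> are closed under
  differentiation without sums, which makes iterated partial derivatives of products explicit.\<close>

definition bump_fun :: "real poly \<Rightarrow> nat \<Rightarrow> real poly \<Rightarrow> real \<Rightarrow> real" where
  "bump_fun q k p s = poly p s * bump k (poly q s)"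

lemma bump_fun_deriv:
  "(bump_fun q k p has_real_derivative
     bump_fun q (k + 2) (pderiv p * q\<^sup>2 + p * pderiv q - smult (real k) (p * pderiv q * q)) s) (at s)"
proof -
  have "(bump_fun q k p has_real_derivative
      poly p s * ((bump (k + 2) (poly q s) - real k * bump (k + 1) (poly q s)) * poly (pderiv q) s)
        + poly (pderiv p) s * bump k (poly q s)) (at s)"
    unfolding bump_fun_def[abs_def]
    by (intro DERIV_mult' DERIV_chain2[OF bump_deriv] poly_DERIV)
  moreover have "bump k (poly q s) = (poly q s)\<^sup>2 * bump (k + 2) (poly q s)"
    by (rule bump_shift)
  moreover have "bump (k + 1) (poly q s) = poly q s * bump (k + 2) (poly q s)"
    using bump_shift[of "k + 1" "poly q s" 1] by simp
  ultimately show ?thesis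
    by (simp add: bump_fun_def algebra_simps)
qed

definition bump_prod :: "('n \<Rightarrow> real poly) \<Rightarrow> ('n \<Rightarrow> nat) \<Rightarrow> ('n \<Rightarrow> real poly) \<Rightarrow> real^'n::finite \<Rightarrow> complex" where
  "bump_prod q k p x = complex_of_real (\<Prod>i\<in>UNIV. bump_fun (q i) (k i) (p i) (x $ i))"

lemma bump_prod_has_derivative:
  "(bump_prod q k p has_derivative (\<lambda>h. complex_of_real (\<Sum>i\<in>UNIV.
      (bump_fun (q i) (k i + 2) (pderiv (p i) * (q i)\<^sup>2 + p i * pderiv (q i) - smult (real (k i)) (p i * pderiv (q i) * q i)) (x $ i) * h $ i)
       * (\<Prod>j\<in>UNIV - {i}. bump_fun (q j) (k j) (p j) (x $ j))))) (at x)"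
  unfolding bump_prod_def[abs_def]
  by (intro has_derivative_of_real has_derivative_prod has_derivative_compose[OF _ has_field_derivative_imp_has_derivative[OF bump_fun_deriv]]
      bounded_linear_imp_has_derivative bounded_linear_vec_nth)

lemma pd_eqI: "(\<phi> has_derivative D) (at x) \<Longrightarrow> pd i \<phi> x = D (axis i 1)"
  unfolding pd_def by (simp flip: frechet_derivative_at)

text \<open>In direction \<open>axis i 1\<close> only factor \<open>i\<close> is differentiated, and
  the result is again a single \<open>bump_fun\<close>. So the family is closed under
  \<open>pd\<close>, and smoothness follows by induction on the list of directions.\<close>

lemma bump_prod_pd:
  "pd i (bump_prod q k p) = bump_prod q (k(i := k i + 2))
     (p(i := pderiv (p i) * (q i)\<^sup>2 + p i * pderiv (q i) - smult (real (k i)) (p i * pderiv (q i) * q i)))"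
proof
  fix x
  let ?g = "\<lambda>i. bump_fun (q i) (k i + 2) (pderiv (p i) * (q i)\<^sup>2 + p i * pderiv (q i) - smult (real (k i)) (p i * pderiv (q i) * q i)) (x $ i)"
  have "pd i (bump_prod q k p) x = complex_of_real (\<Sum>j\<in>UNIV. (?g j * (axis i 1 :: real^'a) $ j)
       * (\<Prod>j\<in>UNIV - {j}. bump_fun (q j) (k j) (p j) (x $ j)))"
    by (rule pd_eqI[OF bump_prod_has_derivative])
  also have "(\<Sum>j\<in>UNIV. (?g j * (axis i 1 :: real^'a) $ j) * (\<Prod>j\<in>UNIV - {j}. bump_fun (q j) (k j) (p j) (x $ j)))
      = (\<Sum>j\<in>{i}. (?g j * (axis i 1 :: real^'a) $ j) * (\<Prod>j\<in>UNIV - {j}. bump_fun (q j) (k j) (p j) (x $ j)))"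
    by (rule sum.mono_neutral_right) (auto simp: axis_def)
  also have "\<dots> = ?g i * (\<Prod>j\<in>UNIV - {i}. bump_fun (q j) (k j) (p j) (x $ j))"
    by (simp add: axis_def)
  also have "(\<Prod>j\<in>UNIV - {i}. bump_fun (q j) (k j) (p j) (x $ j))
      = (\<Prod>j\<in>UNIV - {i}. bump_fun (q j) ((k(i := k i + 2)) j) ((p(i := pderiv (p i) * (q i)\<^sup>2 + p i * pderiv (q i) - smult (real (k i)) (p i * pderiv (q i) * q i))) j) (x $ j))"
    by (rule prod.cong) auto
  finally show "pd i (bump_prod q k p) x = bump_prod q (k(i := k i + 2))
     (p(i := pderiv (p i) * (q i)\<^sup>2 + p i * pderiv (q i) - smult (real (k i)) (p i * pderiv (q i) * q i))) x"
    unfolding bump_prod_def by (subst prod.remove[of UNIV i]) auto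
qed

lemma fold_pd_bump_prod: "fold pd is (bump_prod q k p) differentiable (at x)"
proof (induction "is" arbitrary: k p)
  case Nil
  then show ?case
    using bump_prod_has_derivative differentiableI by fastforce
next
  case (Cons i "is")
  then show ?case by (simp add: bump_prod_pd)
qed

text \<open>For \<open>a_i \<le> b_i\<close> and \<open>m > 0\<close> the argument of factor
  \<open>i\<close>, \<open>m (x_i - a_i) (b_i - x_i)\<close>, is positive exactly strictly between
  \<open>a_i\<close> and \<open>b_i\<close>. As \<open>exp (- 1 / (m y))\<close> tends to 1 for
  \<open>y > 0\<close>, large \<open>m\<close> approximates the indicator of the open box.\<close>

definition box_bump :: "real^'n::finite \<Rightarrow> real^'n \<Rightarrow> nat \<Rightarrow> real^'n \<Rightarrow> complex" where
  "box_bump a b m = bump_prod (\<lambda>i. [:real m:] * [:- (a $ i), 1:] * [:b $ i, -1:]) (\<lambda>_. 0) (\<lambda>_. 1)"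

lemma box_bump_eq: "box_bump a b m x = complex_of_real (\<Prod>i\<in>UNIV. bump 0 (real m * ((x $ i - a $ i) * (b $ i - x $ i))))"
  by (simp add: box_bump_def bump_prod_def bump_fun_def algebra_simps)

lemma box_bump_outside:
  assumes "x \<notin> box a b" "\<And>i. a $ i \<le> b $ i"
  shows "box_bump a b m x = 0"
proof -
  obtain i where "x $ i \<le> a $ i \<or> b $ i \<le> x $ i"
    using assms by (auto simp: mem_box_cart not_less)
  then have "(x $ i - a $ i) * (b $ i - x $ i) \<le> 0"
    using assms(2)[of i] unfolding mult_le_0_iff by linarith
  then have "real m * ((x $ i - a $ i) * (b $ i - x $ i)) \<le> 0"
    by (rule mult_nonneg_nonpos[OF of_nat_0_le_iff])
  then show ?thesis
    unfolding box_bump_eq of_real_eq_0_iff by (intro prod_zero bexI[of _ i] bump_nonpos) auto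
qed

lemma norm_box_bump_le:
  assumes "\<And>i. a $ i \<le> b $ i"
  shows "norm (box_bump a b m x) \<le> indicator (box a b) x"
proof (cases "x \<in> box a b")
  case True
  have "norm (box_bump a b m x) = (\<Prod>i\<in>UNIV. bump 0 (real m * ((x $ i - a $ i) * (b $ i - x $ i))))"
    by (simp only: box_bump_eq norm_of_real) (simp add: abs_prod bump_nonneg)
  also have "\<dots> \<le> 1"
    by (intro prod_le_1) (auto simp: bump_nonneg bump_0_le_1)
  finally show ?thesis using True by simp
qed (simp add: box_bump_outside assms)

lemma box_bump_tendsto:
  assumes "\<And>i. a $ i \<le> b $ i"
  shows "(\<lambda>m. box_bump a b m x) \<longlonglongrightarrow> indicator (box a b) x"
proof (cases "x \<in> box a b")
  case True
  then have pos: "0 < (x $ i - a $ i) * (b $ i - x $ i)" for i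
    by (auto simp: mem_box_cart)
  have "(\<lambda>m. bump 0 (real m * ((x $ i - a $ i) * (b $ i - x $ i)))) \<longlonglongrightarrow> 1" for i
  proof -
    have "(\<lambda>m. inverse (real m) * (1 / ((x $ i - a $ i) * (b $ i - x $ i)))) \<longlonglongrightarrow> 0"
      by (intro tendsto_mult_left_zero lim_inverse_n)
    then have "(\<lambda>m. 1 / (real m * ((x $ i - a $ i) * (b $ i - x $ i)))) \<longlonglongrightarrow> 0"
      by (simp add: divide_inverse)
    then have "(\<lambda>m. exp (- (1 / (real m * ((x $ i - a $ i) * (b $ i - x $ i)))))) \<longlonglongrightarrow> exp (- 0)"
      by (intro tendsto_intros)
    then show ?thesis
      unfolding minus_zero exp_zero
      by (rule Lim_transform_eventually)
         (use pos[of i] in \<open>auto simp: bump_def intro!: eventually_mono[OF eventually_gt_at_top[of 0]]\<close>)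
  qed
  then have "(\<lambda>m. complex_of_real (\<Prod>i\<in>UNIV. bump 0 (real m * ((x $ i - a $ i) * (b $ i - x $ i)))))
      \<longlonglongrightarrow> complex_of_real (\<Prod>i\<in>(UNIV::'a set). 1)"
    by (intro tendsto_intros)
  then show ?thesis
    using True by (simp add: box_bump_eq[abs_def])
qed (simp add: box_bump_outside assms)

lemma test_function_box_bump:
  assumes "\<And>i. a $ i \<le> b $ i"
  shows "test_function (box_bump a b m)"
  unfolding test_function_def
proof (intro conjI allI exI[of _ "cbox a b"] impI)
  show "fold pd is (box_bump a b m) differentiable (at x)" for "is" x
    unfolding box_bump_def by (rule fold_pd_bump_prod)
  show "box_bump a b m x = 0" if "x \<notin> cbox a b" for x
    using that box_subset_cbox[of a b] by (intro box_bump_outside assms) auto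
qed (rule compact_cbox)

text \<open>Conjugation, scalar multiplication and translation commute with \<open>pd\<close> on
  differentiable functions, which carries differentiability through all iterated derivatives; one
  induction over the directions serves all three.\<close>

lemma test_function_transform:
  assumes test: "test_function \<phi>"
    and diff: "\<And>f x. (\<forall>x. f differentiable (at x)) \<Longrightarrow> T f differentiable (at x)"
    and pd: "\<And>f i. (\<forall>x. f differentiable (at x)) \<Longrightarrow> pd i (T f) = T (pd i f)"
    and supp: "\<And>K. compact K \<Longrightarrow> \<forall>x. x \<notin> K \<longrightarrow> \<phi> x = 0 \<Longrightarrow> \<exists>K'. compact K' \<and> (\<forall>x. x \<notin> K' \<longrightarrow> T \<phi> x = 0)"
  shows "test_function (T \<phi>)"
proof -
  have "fold pd is (T f) differentiable (at x)" if "\<forall>is x. fold pd is f differentiable (at x)" for "is" x f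
    using that
  proof (induction "is" arbitrary: f)
    case Nil
    have "\<forall>x. f differentiable (at x)"
      using spec[OF Nil, of "[]"] by simp
    then show ?case by (simp add: diff)
  next
    case (Cons i "is")
    have "\<forall>x. f differentiable (at x)"
      using spec[OF Cons.prems, of "[]"] by simp
    moreover have "fold pd is' (pd i f) differentiable (at x)" for is' x
      using Cons.prems[rule_format, of "i # is'" x] by simp
    ultimately show ?case
      using Cons.IH[of "pd i f"] by (simp add: pd)
  qed
  moreover obtain K where "compact K" "\<forall>x. x \<notin> K \<longrightarrow> \<phi> x = 0"
    using test by (auto simp: test_function_def)
  ultimately show ?thesis
    using test supp[of K] by (auto simp: test_function_def)
qed

lemma test_function_differentiable: "test_function \<phi> \<Longrightarrow> \<phi> differentiable (at x)"
  unfolding test_function_def by (metis fold_simps(1))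

lemma has_derivative_frechet: "\<phi> differentiable (at x) \<Longrightarrow> (\<phi> has_derivative frechet_derivative \<phi> (at x)) (at x)"
  by (simp add: frechet_derivative_works)

lemma test_function_cnj:
  assumes "test_function \<phi>"
  shows "test_function (\<lambda>x. cnj (\<phi> x))" "pd i (\<lambda>x. cnj (\<phi> x)) = (\<lambda>x. cnj (pd i \<phi> x))"
proof -
  have d: "((\<lambda>x. cnj (f x)) has_derivative (\<lambda>h. cnj (frechet_derivative f (at x) h))) (at x)"
    if "\<forall>x. f differentiable (at x)" for f :: "real^'a \<Rightarrow> complex" and x
    using that by (intro has_derivative_cnj has_derivative_frechet) auto
  have pd: "pd i (\<lambda>x. cnj (f x)) = (\<lambda>x. cnj (pd i f x))" if "\<forall>x. f differentiable (at x)"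
    for f :: "real^'a \<Rightarrow> complex" and i
    using pd_eqI[OF d[OF that]] by (auto simp: pd_def)
  show "pd i (\<lambda>x. cnj (\<phi> x)) = (\<lambda>x. cnj (pd i \<phi> x))"
    using assms by (intro pd) (auto intro: test_function_differentiable)
  show "test_function (\<lambda>x. cnj (\<phi> x))"
    by (rule test_function_transform[OF assms, of "\<lambda>f x. cnj (f x)"])
       (auto intro: differentiableI[OF d] pd)
qed

lemma test_function_cmult:
  assumes "test_function \<phi>"
  shows "test_function (\<lambda>x. c * \<phi> x)" "pd i (\<lambda>x. c * \<phi> x) = (\<lambda>x. c * pd i \<phi> x)"
proof -
  have d: "((\<lambda>x. c * f x) has_derivative (\<lambda>h. c * frechet_derivative f (at x) h)) (at x)"
    if "\<forall>x. f differentiable (at x)" for f :: "real^'a \<Rightarrow> complex" and x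
    using that by (intro has_derivative_mult_right has_derivative_frechet) auto
  have pd: "pd i (\<lambda>x. c * f x) = (\<lambda>x. c * pd i f x)" if "\<forall>x. f differentiable (at x)"
    for f :: "real^'a \<Rightarrow> complex" and i
    using pd_eqI[OF d[OF that]] by (auto simp: pd_def)
  show "pd i (\<lambda>x. c * \<phi> x) = (\<lambda>x. c * pd i \<phi> x)"
    using assms by (intro pd) (auto intro: test_function_differentiable)
  show "test_function (\<lambda>x. c * \<phi> x)"
    by (rule test_function_transform[OF assms, of "\<lambda>f x. c * f x"])
       (auto intro: differentiableI[OF d] pd)
qed

lemma test_function_shift:
  assumes "test_function \<phi>"
  shows "test_function (\<lambda>x. \<phi> (x + y))" "pd i (\<lambda>x. \<phi> (x + y)) = (\<lambda>x. pd i \<phi> (x + y))"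
proof -
  have d: "((\<lambda>x. f (x + y)) has_derivative frechet_derivative f (at (x + y))) (at x)"
    if "\<forall>x. f differentiable (at x)" for f :: "real^'a \<Rightarrow> complex" and x
  proof -
    have "((\<lambda>x. x + y) has_derivative (\<lambda>h. h)) (at x)"
      by (auto intro!: derivative_eq_intros)
    from has_derivative_compose[OF this has_derivative_frechet[of f]] show ?thesis
      using that by simp
  qed
  have pd: "pd i (\<lambda>x. f (x + y)) = (\<lambda>x. pd i f (x + y))" if "\<forall>x. f differentiable (at x)"
    for f :: "real^'a \<Rightarrow> complex" and i
    using pd_eqI[OF d[OF that]] by (auto simp: pd_def)
  show "pd i (\<lambda>x. \<phi> (x + y)) = (\<lambda>x. pd i \<phi> (x + y))"
    using assms by (intro pd) (auto intro: test_function_differentiable)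
  show "test_function (\<lambda>x. \<phi> (x + y))"
  proof (rule test_function_transform[OF assms, of "\<lambda>f x. f (x + y)"])
    fix K assume K: "compact K" "\<forall>x. x \<notin> K \<longrightarrow> \<phi> x = 0"
    show "\<exists>K'. compact K' \<and> (\<forall>x. x \<notin> K' \<longrightarrow> \<phi> (x + y) = 0)"
    proof (intro exI[of _ "(\<lambda>x. - y + x) ` K"] conjI allI impI)
      show "compact ((\<lambda>x. - y + x) ` K)"
        by (rule compact_translation[OF K(1)])
      fix x assume "x \<notin> (\<lambda>x. - y + x) ` K"
      then have "x + y \<notin> K" by (force simp: image_iff)
      then show "\<phi> (x + y) = 0" using K(2) by blast
    qed
  qed (auto intro: differentiableI[OF d] pd)
qed

lemma test_function_pd:
  assumes "test_function \<phi>"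
  shows "test_function (pd i \<phi>)"
proof -
  have "fold pd is (pd i \<phi>) differentiable (at x)" for "is" x
    using assms[unfolded test_function_def, THEN conjunct1, rule_format, of "i # is" x] by simp
  moreover obtain K where K: "compact K" "\<And>x. x \<notin> K \<Longrightarrow> \<phi> x = 0"
    using assms by (auto simp: test_function_def)
  have "pd i \<phi> x = 0" if "x \<notin> K" for x
  proof -
    have "((\<lambda>_. 0) has_derivative (\<lambda>_. 0)) (at x)" by simp
    then have "(\<phi> has_derivative (\<lambda>_. 0)) (at x)"
      by (rule has_derivative_transform_within_open[of _ _ _ _ "- K"])
         (use K that compact_imp_closed in auto)
    then show ?thesis by (simp add: pd_eqI)
  qed
  ultimately show ?thesis
    unfolding test_function_def using K(1) by blast
qed

lemma test_function_continuous: "test_function \<phi> \<Longrightarrow> continuous_on S \<phi>"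
  by (meson continuous_at_imp_continuous_on differentiable_imp_continuous_within test_function_differentiable)

lemma test_function_bounded:
  assumes "test_function \<phi>"
  obtains B where "0 \<le> B" "\<And>x. norm (\<phi> x) \<le> B"
proof -
  obtain K where K: "compact K" "\<And>x. x \<notin> K \<Longrightarrow> \<phi> x = 0"
    using assms by (auto simp: test_function_def)
  have "bounded (\<phi> ` K)"
    by (intro compact_imp_bounded compact_continuous_image test_function_continuous[OF assms] K)
  then obtain B where "\<And>x. x \<in> K \<Longrightarrow> norm (\<phi> x) \<le> B"
    by (auto simp: bounded_iff)
  then show ?thesis
    using K by (intro that[of "max B 0"]) (auto simp: le_max_iff_disj)
qed

lemma test_function_vector_derivative:
  assumes "test_function \<phi>"
  shows "((\<lambda>t. \<phi> (x + t *\<^sub>R axis i 1)) has_vector_derivative pd i \<phi> (x + t *\<^sub>R axis i 1)) (at t within S)"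
proof -
  let ?D = "frechet_derivative \<phi> (at (x + t *\<^sub>R axis i 1))"
  have D: "(\<phi> has_derivative ?D) (at (x + t *\<^sub>R axis i 1))"
    by (intro has_derivative_frechet test_function_differentiable assms)
  have "((\<lambda>t. \<phi> (x + t *\<^sub>R axis i 1)) has_derivative (\<lambda>h. ?D (h *\<^sub>R axis i 1))) (at t within S)"
    by (rule has_derivative_compose[where f = "\<lambda>t. x + t *\<^sub>R axis i 1" and g = \<phi>, OF _ D])
       (auto intro!: derivative_eq_intros)
  then show ?thesis
    unfolding has_vector_derivative_def pd_def
    using linear_scale[OF has_derivative_linear[OF D]] by simp
qed

text \<open>The mean value inequality is applied twice along the axis, first to
  \<open>pd i \<phi>\<close>, then to \<open>\<phi>\<close> minus its linear part. Only the order
  \<open>h^2\<close> matters, so the factor 1/2 of the Taylor remainder is given away.\<close>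

lemma test_function_taylor:
  assumes \<phi>: "test_function \<phi>" and B: "\<And>x. norm (pd i (pd i \<phi>) x) \<le> B"
  shows "norm (\<phi> (x + h *\<^sub>R axis i 1) - \<phi> x - h *\<^sub>R pd i \<phi> x) \<le> h\<^sup>2 * B"
proof -
  have lip: "norm (pd i \<phi> (x + t *\<^sub>R axis i 1) - pd i \<phi> x) \<le> \<bar>h\<bar> * B" if "t \<in> closed_segment 0 h" for t
  proof -
    have "norm (pd i \<phi> (x + t *\<^sub>R axis i 1) - pd i \<phi> (x + 0 *\<^sub>R axis i 1)) \<le> B * norm (t - 0)"
      by (rule differentiable_bound[where S = UNIV and f' = "\<lambda>t h. h *\<^sub>R pd i (pd i \<phi>) (x + t *\<^sub>R axis i 1)"])
         (use B in \<open>auto intro!: onorm_le mult_right_mono test_function_vector_derivative test_function_pd \<phi>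
           simp: mult.commute[of "\<bar>_\<bar>"] simp flip: has_vector_derivative_def\<close>)
    also have "\<dots> \<le> \<bar>h\<bar> * B"
      using that order_trans[OF norm_ge_zero B] by (auto simp: closed_segment_eq_real_ivl mult.commute intro!: mult_left_mono split: if_splits)
    finally show ?thesis by simp
  qed
  have "norm (\<phi> (x + h *\<^sub>R axis i 1) - \<phi> (x + 0 *\<^sub>R axis i 1) - (h - 0) *\<^sub>R pd i \<phi> (x + 0 *\<^sub>R axis i 1)) \<le> norm (h - 0) * (\<bar>h\<bar> * B)"
    by (rule vector_differentiable_bound_linearization[where S = "closed_segment 0 h" and f' = "\<lambda>t. pd i \<phi> (x + t *\<^sub>R axis i 1)"])
       (use lip in \<open>auto intro!: test_function_vector_derivative \<phi>\<close>)
  then show ?thesis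
    by (simp add: power2_eq_square mult_ac)
qed

section \<open>The Hilbert space of square integrable functions\<close>

lemma L2_measurable: "f \<in> L2 \<Longrightarrow> f \<in> borel_measurable borel"
  by (simp add: L2_def)

lemma L2I: "f \<in> borel_measurable borel \<Longrightarrow> integrable lborel (\<lambda>x. (norm (f x))\<^sup>2) \<Longrightarrow> f \<in> L2"
  by (simp add: L2_def)

lemma L2_bound:
  assumes f: "f \<in> borel_measurable borel" and g: "integrable lborel g"
    and le: "\<And>x. (norm (f x))\<^sup>2 \<le> g x"
  shows "f \<in> L2"
proof (rule L2I[OF f Bochner_Integration.integrable_bound[OF g]])
  show "AE x in lborel. norm ((norm (f x))\<^sup>2) \<le> norm (g x)"
    using order_trans[OF le abs_ge_self] by (intro AE_I2) simp
qed (use f in measurable)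

lemma L2_integrable: "f \<in> L2 \<Longrightarrow> integrable lborel (\<lambda>x. (norm (f x))\<^sup>2)"
  by (simp add: L2_def)

lemma L2_zero: "(\<lambda>_. 0) \<in> L2"
  by (simp add: L2_def)

lemma L2_add:
  assumes "f \<in> L2" "g \<in> L2"
  shows "(\<lambda>x. f x + g x) \<in> L2"
proof (rule L2_bound)
  show "(\<lambda>x. f x + g x) \<in> borel_measurable borel"
    using assms[THEN L2_measurable] by measurable
  show "integrable lborel (\<lambda>x. 2 * (norm (f x))\<^sup>2 + 2 * (norm (g x))\<^sup>2)"
    using assms by (simp add: L2_integrable)
  show "(norm (f x + g x))\<^sup>2 \<le> 2 * (norm (f x))\<^sup>2 + 2 * (norm (g x))\<^sup>2" for x
  proof -
    have "(norm (f x + g x))\<^sup>2 \<le> (norm (f x) + norm (g x))\<^sup>2"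
      by (intro power_mono norm_triangle_ineq) auto
    also have "\<dots> \<le> 2 * (norm (f x))\<^sup>2 + 2 * (norm (g x))\<^sup>2"
      using zero_le_power2[of "norm (f x) - norm (g x)"] by (simp add: power2_sum power2_diff)
    finally show ?thesis .
  qed
qed

lemma L2_cmult: "f \<in> L2 \<Longrightarrow> (\<lambda>x. c * f x) \<in> L2"
  using L2_measurable[of f] L2_integrable[of f]
  by (intro L2I) (auto simp: norm_mult power_mult_distrib)

lemma L2_scaleR: "f \<in> L2 \<Longrightarrow> (\<lambda>x. r *\<^sub>R f x) \<in> L2"
  using L2_cmult[of f "complex_of_real r"] by (simp add: scaleR_conv_of_real)

lemma L2_uminus: "f \<in> L2 \<Longrightarrow> (\<lambda>x. - f x) \<in> L2"
  using L2_cmult[of f "-1"] by simp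

lemma L2_diff: "f \<in> L2 \<Longrightarrow> g \<in> L2 \<Longrightarrow> (\<lambda>x. f x - g x) \<in> L2"
  using L2_add[OF _ L2_uminus] by fastforce

lemma measurable_cnj [measurable]: "cnj \<in> borel_measurable borel"
  by (intro borel_measurable_continuous_onI continuous_intros)

lemma L2_cnj: "f \<in> L2 \<Longrightarrow> (\<lambda>x. cnj (f x)) \<in> L2"
  using L2_measurable[of f] L2_integrable[of f]
  by (intro L2I measurable_compose[OF _ measurable_cnj]) auto

lemma integrable_lborel_shift:
  fixes f :: "'a::euclidean_space \<Rightarrow> 'b::{banach,second_countable_topology}"
  assumes "integrable lborel f"
  shows "integrable lborel (\<lambda>x. f (x + y))"
proof -
  have "integrable (distr lborel borel ((+) y)) f"
    using assms by (simp only: lborel_distr_plus)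
  then have "integrable lborel (\<lambda>x. f (y + x))"
    using assms by (subst (asm) integrable_distr_eq) auto
  then show ?thesis by (simp add: add.commute)
qed

lemma integral_lborel_shift:
  fixes f :: "'a::euclidean_space \<Rightarrow> 'b::{banach,second_countable_topology}"
  assumes "f \<in> borel_measurable borel"
  shows "(LINT x|lborel. f (x + y)) = (LINT x|lborel. f x)"
proof -
  have "(LINT x|lborel. f x) = (LINT x|distr lborel borel ((+) y). f x)"
    by (simp only: lborel_distr_plus)
  also have "\<dots> = (LINT x|lborel. f (y + x))"
    using assms by (intro integral_distr) auto
  finally show ?thesis by (simp add: add.commute)
qed

lemma AE_lborel_shift:
  fixes y :: "'a::euclidean_space"
  assumes "AE x in lborel. P x"
  shows "AE x in lborel. P (x + y)"
proof -
  have "AE x in distr lborel borel ((+) y). P x"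
    using assms by (simp only: lborel_distr_plus)
  then obtain N where N: "{x. \<not> P x} \<subseteq> N" "N \<in> sets borel" "emeasure (distr lborel borel ((+) y)) N = 0"
    by (auto elim!: AE_E)
  have N': "(+) y -` N \<in> sets borel"
    using measurable_sets[of "(+) y" borel borel N] N by simp
  have "AE x in lborel. y + x \<notin> N"
  proof (rule AE_I')
    show "(+) y -` N \<inter> space lborel \<in> null_sets lborel"
      using N N' by (auto simp: emeasure_distr null_sets_def)
  qed auto
  then show ?thesis
    by (rule AE_mp) (use N in \<open>auto simp: add.commute\<close>)
qed

lemma L2_shift: "f \<in> L2 \<Longrightarrow> (\<lambda>x. f (x + y)) \<in> L2"
  using integrable_lborel_shift[of "\<lambda>x. (norm (f x))\<^sup>2" y]
  by (auto simp: L2_def intro!: measurable_compose[of "\<lambda>x. x + y" borel borel f borel])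

lemma L2_mult_integrable:
  assumes "f \<in> L2" "g \<in> L2"
  shows "integrable lborel (\<lambda>x. f x * g x)"
proof (rule Bochner_Integration.integrable_bound)
  show "integrable lborel (\<lambda>x. (norm (f x))\<^sup>2 + (norm (g x))\<^sup>2)"
    using assms by (simp add: L2_integrable)
  show "(\<lambda>x. f x * g x) \<in> borel_measurable lborel"
    using assms[THEN L2_measurable] by simp
  have "norm (f x * g x) \<le> (norm (f x))\<^sup>2 + (norm (g x))\<^sup>2" for x
    using sum_squares_bound[of "norm (f x)" "norm (g x)"] mult_nonneg_nonneg[OF norm_ge_zero norm_ge_zero, of "f x" "g x"]
    unfolding norm_mult by linarith
  then show "AE x in lborel. norm (f x * g x) \<le> norm ((norm (f x))\<^sup>2 + (norm (g x))\<^sup>2)"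
    by (intro AE_I2) (use abs_ge_self order_trans in fastforce)
qed

lemma integrable_Re_mult_cnj: "f \<in> L2 \<Longrightarrow> g \<in> L2 \<Longrightarrow> integrable lborel (\<lambda>x. Re (f x * cnj (g x)))"
  by (intro integrable_Re L2_mult_integrable L2_cnj)

\<comment> \<open>Classes modulo null sets form a type with a genuine norm, to which the calculus of
  \<open>has_vector_derivative\<close>, \<open>continuous_on\<close> and \<open>closure\<close>
  applies. The relation is partial because functions outside \<open>L2\<close> belong to no
  class.\<close>
quotient_type (overloaded) 'a l2 = "'a::euclidean_space \<Rightarrow> complex" /
  partial: "\<lambda>f g. f \<in> L2 \<and> g \<in> L2 \<and> (AE x in lborel. f x = g x)"
proof (rule part_equivpI)
  show "\<exists>f::'a \<Rightarrow> complex. f \<in> L2 \<and> f \<in> L2 \<and> (AE x in lborel. f x = f x)"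
    using L2_zero by auto
  show "symp (\<lambda>f (g :: 'a \<Rightarrow> complex). f \<in> L2 \<and> g \<in> L2 \<and> (AE x in lborel. f x = g x))"
    by (rule sympI) (auto elim: eventually_mono)
  show "transp (\<lambda>f (g :: 'a \<Rightarrow> complex). f \<in> L2 \<and> g \<in> L2 \<and> (AE x in lborel. f x = g x))"
    by (rule transpI) (auto elim: eventually_elim2)
qed

instantiation l2 :: (euclidean_space) real_vector
begin

lift_definition zero_l2 :: "'a l2" is "\<lambda>_. 0"
  by (simp add: L2_zero)

lift_definition plus_l2 :: "'a l2 \<Rightarrow> 'a l2 \<Rightarrow> 'a l2" is "\<lambda>f g x. f x + g x"
  by (auto intro: L2_add elim: eventually_elim2)

lift_definition uminus_l2 :: "'a l2 \<Rightarrow> 'a l2" is "\<lambda>f x. - f x"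
  by (auto intro: L2_uminus elim: eventually_mono)

lift_definition minus_l2 :: "'a l2 \<Rightarrow> 'a l2 \<Rightarrow> 'a l2" is "\<lambda>f g x. f x - g x"
  by (auto intro: L2_diff elim: eventually_elim2)

lift_definition scaleR_l2 :: "real \<Rightarrow> 'a l2 \<Rightarrow> 'a l2" is "\<lambda>r f x. r *\<^sub>R f x"
  by (auto intro: L2_scaleR elim: eventually_mono)

instance
proof
  fix F G H :: "'a l2" and r s :: real
  show "F + G + H = F + (G + H)"
    by transfer (auto intro!: L2_add simp: add.assoc)
  show "F + G = G + F"
    by transfer (auto intro!: L2_add simp: add.commute)
  show "0 + F = F"
    by transfer auto
  show "- F + F = 0"
    by transfer (auto simp: L2_zero)
  show "F - G = F + - G"
    by transfer (auto intro!: L2_add L2_diff L2_uminus)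
  show "r *\<^sub>R (F + G) = r *\<^sub>R F + r *\<^sub>R G"
    by transfer (auto intro!: L2_add L2_scaleR simp: scaleR_add_right)
  show "(r + s) *\<^sub>R F = r *\<^sub>R F + s *\<^sub>R F"
    by transfer (auto intro!: L2_add L2_scaleR simp: scaleR_add_left)
  show "r *\<^sub>R s *\<^sub>R F = (r * s) *\<^sub>R F"
    by transfer (auto intro!: L2_scaleR)
  show "1 *\<^sub>R F = F"
    by transfer auto
qed

end

instantiation l2 :: (euclidean_space) real_inner
begin

text \<open>The real part of the Hermitian product: the space is treated as a real one, and complex
  scalars act on it through \<open>cmul\<close>.\<close>

lift_definition inner_l2 :: "'a l2 \<Rightarrow> 'a l2 \<Rightarrow> real" is "\<lambda>f g. LINT x|lborel. Re (f x * cnj (g x))"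
  by (rule integral_cong_AE) (auto dest!: L2_measurable elim: eventually_elim2)

definition norm_l2 :: "'a l2 \<Rightarrow> real" where "norm_l2 F = sqrt (inner F F)"
definition dist_l2 :: "'a l2 \<Rightarrow> 'a l2 \<Rightarrow> real" where "dist_l2 F G = norm (F - G)"
definition sgn_l2 :: "'a l2 \<Rightarrow> 'a l2" where "sgn_l2 F = inverse (norm F) *\<^sub>R F"
definition uniformity_l2 :: "('a l2 \<times> 'a l2) filter" where
  "uniformity_l2 = (INF e\<in>{0<..}. principal {(x, y). dist x y < e})"
definition open_l2 :: "'a l2 set \<Rightarrow> bool" where
  "open_l2 U = (\<forall>x\<in>U. \<forall>\<^sub>F (x', y) in uniformity. x' = x \<longrightarrow> y \<in> U)"

instance
proof
  fix F G H :: "'a l2" and r :: real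
  show "dist F G = norm (F - G)" "sgn F = F /\<^sub>R norm F" "norm F = sqrt (inner F F)"
    by (simp_all add: dist_l2_def sgn_l2_def norm_l2_def)
  show "uniformity = (INF e\<in>{0<..}. principal {(x, y :: 'a l2). dist x y < e})"
    by (rule uniformity_l2_def)
  show "open U = (\<forall>x\<in>U. \<forall>\<^sub>F (x', y) in uniformity. x' = x \<longrightarrow> y \<in> U)" for U :: "'a l2 set"
    by (rule open_l2_def)
  show "inner F G = inner G F"
    by transfer (simp add: mult.commute)
  show "inner (F + G) H = inner F H + inner G H"
    by transfer (simp only: distrib_right plus_complex.sel Bochner_Integration.integral_add[OF integrable_Re_mult_cnj integrable_Re_mult_cnj] )
  show "inner (r *\<^sub>R F) G = r * inner F G"
    by transfer (simp add: algebra_simps flip: integral_mult_right_zero)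
  show "0 \<le> inner F F"
    by transfer (auto intro!: integral_nonneg_AE simp flip: power2_eq_square)
  show "inner F F = 0 \<longleftrightarrow> F = 0"
  proof transfer
    fix f :: "'a \<Rightarrow> complex" assume "f \<in> L2 \<and> f \<in> L2 \<and> (AE x in lborel. f x = f x)"
    then have f: "f \<in> L2" by simp
    have eq: "Re (f x * cnj (f x)) = (norm (f x))\<^sup>2" for x
      by (simp add: complex_mult_cnj cmod_power2)
    have "(LINT x|lborel. Re (f x * cnj (f x))) = 0 \<longleftrightarrow> (AE x in lborel. (norm (f x))\<^sup>2 = 0)"
      unfolding eq by (intro integral_nonneg_eq_0_iff_AE L2_integrable f) auto
    then show "(LINT x|lborel. Re (f x * cnj (f x))) = 0 \<longleftrightarrow>
        f \<in> L2 \<and> (\<lambda>_. 0) \<in> L2 \<and> (AE x in lborel. f x = 0)"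
      using f by (simp add: L2_zero)
  qed
qed

end

lemma rep_l2_L2: "rep_l2 F \<in> L2"
  using Quotient3_rep_reflp[OF Quotient3_l2] by blast

lemma abs_rep_l2 [simp]: "abs_l2 (rep_l2 F) = F"
  using Quotient3_abs_rep[OF Quotient3_l2] .

lemma abs_l2_eq_iff: "f \<in> L2 \<Longrightarrow> g \<in> L2 \<Longrightarrow> abs_l2 f = abs_l2 g \<longleftrightarrow> (AE x in lborel. f x = g x)"
  using Quotient3_rel[OF Quotient3_l2, of f g] by auto

lemma l2_cases:
  obtains f where "f \<in> L2" "F = abs_l2 f"
  using rep_l2_L2 abs_rep_l2 by metis

lemma abs_l2_add: "f \<in> L2 \<Longrightarrow> g \<in> L2 \<Longrightarrow> abs_l2 (\<lambda>x. f x + g x) = abs_l2 f + abs_l2 g"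
  by (simp add: plus_l2.abs_eq)

lemma abs_l2_diff: "f \<in> L2 \<Longrightarrow> g \<in> L2 \<Longrightarrow> abs_l2 (\<lambda>x. f x - g x) = abs_l2 f - abs_l2 g"
  by (simp add: minus_l2.abs_eq)

lemma abs_l2_scaleR: "f \<in> L2 \<Longrightarrow> abs_l2 (\<lambda>x. r *\<^sub>R f x) = r *\<^sub>R abs_l2 f"
  by (simp add: scaleR_l2.abs_eq)

lemma inner_abs_l2: "f \<in> L2 \<Longrightarrow> g \<in> L2 \<Longrightarrow> inner (abs_l2 f) (abs_l2 g) = (LINT x|lborel. Re (f x * cnj (g x)))"
  by (simp add: inner_l2.abs_eq)

lemma norm_abs_l2: "f \<in> L2 \<Longrightarrow> norm (abs_l2 f) = L2_norm f"
  by (simp add: norm_l2_def inner_abs_l2 L2_norm_def complex_mult_cnj cmod_power2)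

section \<open>Complex scalars and translations as operators on \<open>l2\<close>\<close>

lift_definition cmul :: "complex \<Rightarrow> 'a::euclidean_space l2 \<Rightarrow> 'a l2" is "\<lambda>c f x. c * f x"
  by (auto intro: L2_cmult elim: eventually_mono)

lift_definition shift :: "'a::euclidean_space \<Rightarrow> 'a l2 \<Rightarrow> 'a l2" is "\<lambda>y f x. f (x + y)"
proof -
  fix y :: 'a and f g :: "'a \<Rightarrow> complex"
  assume "f \<in> L2 \<and> g \<in> L2 \<and> (AE x in lborel. f x = g x)"
  then show "(\<lambda>x. f (x + y)) \<in> L2 \<and> (\<lambda>x. g (x + y)) \<in> L2 \<and> (AE x in lborel. f (x + y) = g (x + y))"
    using AE_lborel_shift[of "\<lambda>x. f x = g x" y] by (simp add: L2_shift)
qed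

lemma inner_cmul_cmul: "inner (cmul c F) (cmul c G) = (norm c)\<^sup>2 * inner F G"
proof transfer
  fix c and f g :: "'a \<Rightarrow> complex"
  have "Re (c * f x * cnj (c * g x)) = (norm c)\<^sup>2 * Re (f x * cnj (g x))" for x
  proof -
    have "c * f x * cnj (c * g x) = (c * cnj c) * (f x * cnj (g x))" by simp
    then show ?thesis
      by (simp only: complex_norm_square[symmetric] times_complex.sel Re_complex_of_real Im_complex_of_real)
  qed
  then show "(LINT x|lborel. Re (c * f x * cnj (c * g x))) = (norm c)\<^sup>2 * (LINT x|lborel. Re (f x * cnj (g x)))"
    by simp
qed

lemma cmul_add: "cmul c (F + G) = cmul c F + cmul c G"
  by transfer (auto intro!: L2_add L2_cmult simp: algebra_simps)

lemma cmul_scaleR: "cmul c (r *\<^sub>R F) = r *\<^sub>R cmul c F"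
  by transfer (auto intro!: L2_scaleR L2_cmult)

lemma shift_add: "shift y (F + G) = shift y F + shift y G"
  by transfer (auto intro!: L2_add L2_shift)

lemma shift_scaleR: "shift y (r *\<^sub>R F) = r *\<^sub>R shift y F"
  by transfer (auto intro!: L2_scaleR L2_shift)

lemma shift_cmul: "shift y (cmul c F) = cmul c (shift y F)"
  by transfer (auto intro!: L2_cmult L2_shift)

lemma shift_0 [simp]: "shift 0 F = F"
  by transfer auto

lemma shift_shift: "shift y (shift z F) = shift (y + z) F"
  by transfer (auto intro!: L2_shift simp: add.assoc)

lemma linear_shift: "linear (shift y)"
  by (intro linearI shift_add shift_scaleR)

lemma inner_shift_shift [simp]: "inner (shift y F) (shift y G) = inner F G"
proof transfer
  fix y :: 'a and f g :: "'a \<Rightarrow> complex"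
  assume "f \<in> L2 \<and> f \<in> L2 \<and> (AE x in lborel. f x = f x)" "g \<in> L2 \<and> g \<in> L2 \<and> (AE x in lborel. g x = g x)"
  then show "(LINT x|lborel. Re (f (x + y) * cnj (g (x + y)))) = (LINT x|lborel. Re (f x * cnj (g x)))"
    by (intro integral_lborel_shift[of "\<lambda>x. Re (f x * cnj (g x))"] borel_measurable_integrable[of lborel, simplified]
        integrable_Re_mult_cnj) auto
qed

lemma norm_shift [simp]: "norm (shift y F) = norm F"
  by (simp add: norm_eq_sqrt_inner)

lemma inner_shift_left: "inner (shift y F) G = inner F (shift (- y) G)"
  using inner_shift_shift[of y F "shift (- y) G"] by (simp add: shift_shift)

section \<open>Density of test functions\<close>

text \<open>Turns uniform estimates, such as the Taylor bound for test functions, into estimates in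
  \<open>L2\<close>.\<close>

lemma L2_bounded_support:
  assumes f: "f \<in> borel_measurable borel" and "bounded K" "K \<in> sets borel"
    and supp: "\<And>x. x \<notin> K \<Longrightarrow> f x = 0" and B: "\<And>x. norm (f x) \<le> B"
  shows "f \<in> L2" "L2_norm f \<le> B * sqrt (measure lborel K)"
proof -
  have fin: "emeasure lborel K < \<infinity>"
    using emeasure_bounded_finite[OF \<open>bounded K\<close>] .
  have int: "integrable lborel (\<lambda>x. B\<^sup>2 * indicator K x :: real)"
    using fin \<open>K \<in> sets borel\<close> by (intro integrable_mult_right) (auto intro: integrable_real_indicator)
  have le: "(norm (f x))\<^sup>2 \<le> B\<^sup>2 * indicator K x" for x
    using supp[of x] B[of x] by (cases "x \<in> K") (auto intro!: power_mono)
  show L2: "f \<in> L2"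
    by (rule L2_bound[OF f int le])
  have B0: "0 \<le> B" using order_trans[OF norm_ge_zero B] .
  have "(LINT x|lborel. (norm (f x))\<^sup>2) \<le> (LINT x|lborel. B\<^sup>2 * indicator K x)"
    by (intro integral_mono L2_integrable L2 int le)
  also have "\<dots> = B\<^sup>2 * measure lborel K"
    using fin \<open>K \<in> sets borel\<close> by simp
  finally have "L2_norm f \<le> sqrt (B\<^sup>2 * measure lborel K)"
    unfolding L2_norm_def by (rule real_sqrt_le_mono)
  also have "\<dots> = B * sqrt (measure lborel K)"
    using B0 by (simp add: real_sqrt_mult)
  finally show "L2_norm f \<le> B * sqrt (measure lborel K)" .
qed

lemma test_function_L2:
  assumes "test_function \<phi>"
  shows "\<phi> \<in> L2"
proof -
  obtain K where K: "compact K" "\<And>x. x \<notin> K \<Longrightarrow> \<phi> x = 0"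
    using assms by (auto simp: test_function_def)
  obtain B where "\<And>x. norm (\<phi> x) \<le> B"
    using test_function_bounded[OF assms] by metis
  then show ?thesis
    using K by (intro L2_bounded_support(1)[of _ K B] borel_measurable_continuous_onI test_function_continuous assms)
      (auto intro: compact_imp_bounded compact_imp_closed borel_closed)
qed

lemma test_function_add:
  assumes "test_function \<phi>" "test_function \<psi>"
  shows "test_function (\<lambda>x. \<phi> x + \<psi> x)"
proof -
  have "fold pd is (\<lambda>x. f x + g x) differentiable (at x)"
    if "\<forall>is x. fold pd is f differentiable (at x)" "\<forall>is x. fold pd is g differentiable (at x)"
    for "is" x and f g :: "real^'a \<Rightarrow> complex"
    using that
  proof (induction "is" arbitrary: f g)
    case Nil
    then show ?case
      using Nil(1)[rule_format, of "[]"] Nil(2)[rule_format, of "[]"] by simp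
  next
    case (Cons i "is")
    have D: "\<forall>is' x. fold pd is' (pd i f) differentiable (at x)" "\<forall>is' x. fold pd is' (pd i g) differentiable (at x)"
      using Cons.prems[rule_format, of "i # _"] by auto
    have "pd i (\<lambda>x. f x + g x) = (\<lambda>x. pd i f x + pd i g x)"
    proof
      fix x
      have "f differentiable (at x)" "g differentiable (at x)"
        using Cons.prems[rule_format, of "[]" x] by auto
      then show "pd i (\<lambda>x. f x + g x) x = pd i f x + pd i g x"
        using pd_eqI[OF has_derivative_add[OF has_derivative_frechet has_derivative_frechet], of f x g]
        by (simp add: pd_def)
    qed
    then show ?case
      using Cons.IH[OF D] by simp
  qed
  moreover obtain K K' where "compact K" "compact K'" "\<And>x. x \<notin> K \<Longrightarrow> \<phi> x = 0" "\<And>x. x \<notin> K' \<Longrightarrow> \<psi> x = 0"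
    using assms by (auto simp: test_function_def)
  then have "\<exists>K. compact K \<and> (\<forall>x. x \<notin> K \<longrightarrow> \<phi> x + \<psi> x = 0)"
    by (intro exI[of _ "K \<union> K'"]) auto
  ultimately show ?thesis
    using assms unfolding test_function_def by simp
qed

text \<open>Dominated convergence for the squared differences; every limit in the density argument
  is taken in this way.\<close>

lemma abs_l2_dominated:
  fixes f :: "'a::euclidean_space \<Rightarrow> complex"
  assumes f: "\<And>k. f' k \<in> L2" "f \<in> L2" and w: "integrable lborel w"
    and le: "\<And>k x. (norm (f' k x - f x))\<^sup>2 \<le> w x"
    and lim: "\<And>x. (\<lambda>k. f' k x) \<longlonglongrightarrow> f x"
  shows "(\<lambda>k. abs_l2 (f' k)) \<longlonglongrightarrow> abs_l2 f"
proof -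
  have "(\<lambda>k. LINT x|lborel. (norm (f' k x - f x))\<^sup>2) \<longlonglongrightarrow> (LINT x|(lborel::'a measure). 0 :: real)"
  proof (rule integral_dominated_convergence[where w = w and s = "\<lambda>k x. (norm (f' k x - f x))\<^sup>2" and f = "\<lambda>_. 0"])
    show "(\<lambda>x. (norm (f' k x - f x))\<^sup>2) \<in> borel_measurable lborel" for k
      using L2_measurable[OF L2_diff[OF f]] by measurable
    have "(\<lambda>k. (norm (f' k x - f x))\<^sup>2) \<longlonglongrightarrow> (norm (f x - f x))\<^sup>2" for x
      by (intro tendsto_intros lim)
    then show "AE x in lborel. (\<lambda>k. (norm (f' k x - f x))\<^sup>2) \<longlonglongrightarrow> 0"
      by simp
    show "AE x in lborel. norm ((norm (f' k x - f x))\<^sup>2) \<le> w x" for k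
      using le by simp
  qed (use w in auto)
  then have "(\<lambda>k. sqrt (LINT x|lborel. (norm (f' k x - f x))\<^sup>2)) \<longlonglongrightarrow> sqrt 0"
    by (intro tendsto_real_sqrt) simp
  moreover have "norm (abs_l2 (f' k) - abs_l2 f) = sqrt (LINT x|lborel. (norm (f' k x - f x))\<^sup>2)" for k
    by (simp add: abs_l2_diff[symmetric] f norm_abs_l2 L2_diff L2_norm_def)
  ultimately have "(\<lambda>k. norm (abs_l2 (f' k) - abs_l2 f)) \<longlonglongrightarrow> 0"
    by simp
  then show ?thesis
    by (rule LIM_zero_cancel[OF tendsto_norm_zero_cancel])
qed

definition tests :: "(real^'n) l2 set" where
  "tests = abs_l2 ` {\<phi>. test_function \<phi>}"

lemma abs_l2_zero: "abs_l2 (\<lambda>_. 0) = 0"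
  by (simp add: zero_l2_def)

lemma abs_l2_cmult: "f \<in> L2 \<Longrightarrow> abs_l2 (\<lambda>x. c * f x) = cmul c (abs_l2 f)"
  by (simp add: cmul.abs_eq)

lemma abs_l2_shift: "f \<in> L2 \<Longrightarrow> abs_l2 (\<lambda>x. f (x + y)) = shift y (abs_l2 f)"
  by (simp add: shift.abs_eq)

lemma norm_cmul: "norm (cmul c F) = norm c * norm F"
  by (simp add: norm_eq_sqrt_inner inner_cmul_cmul real_sqrt_mult)

lemma cmul_diff: "cmul c (F - G) = cmul c F - cmul c G"
  using cmul_add[of c F "- G"] cmul_scaleR[of c "-1" G] by simp

lemma closure_tests_add: "F \<in> closure tests \<Longrightarrow> G \<in> closure tests \<Longrightarrow> F + G \<in> closure tests"
proof -
  assume "F \<in> closure tests" "G \<in> closure tests"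
  then obtain X Y where X: "\<And>n. X n \<in> tests" "X \<longlonglongrightarrow> F" and Y: "\<And>n. Y n \<in> tests" "Y \<longlonglongrightarrow> G"
    unfolding closure_sequential by blast
  have "X n + Y n \<in> tests" for n
    using X(1)[of n] Y(1)[of n] unfolding tests_def
    by (auto simp: abs_l2_add[symmetric] test_function_L2 intro!: imageI test_function_add)
  then show ?thesis
    unfolding closure_sequential using tendsto_add[OF X(2) Y(2)]
    by (intro exI[of _ "\<lambda>n. X n + Y n"]) simp
qed

lemma closure_tests_cmul: "F \<in> closure tests \<Longrightarrow> cmul c F \<in> closure tests"
proof -
  assume "F \<in> closure tests"
  then obtain X where X: "\<And>n. X n \<in> tests" "X \<longlonglongrightarrow> F"
    unfolding closure_sequential by blast
  have "cmul c (X n) \<in> tests" for n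
    using X(1)[of n] unfolding tests_def
    by (auto simp: abs_l2_cmult[symmetric] test_function_L2 intro!: imageI test_function_cmult)
  moreover have "(\<lambda>n. cmul c (X n)) \<longlonglongrightarrow> cmul c F"
  proof (rule LIM_zero_cancel, rule tendsto_norm_zero_cancel)
    have "(\<lambda>n. norm c * norm (X n - F)) \<longlonglongrightarrow> norm c * 0"
      by (intro tendsto_intros tendsto_norm_zero LIM_zero X)
    then show "(\<lambda>n. norm (cmul c (X n) - cmul c F)) \<longlonglongrightarrow> 0"
      by (simp add: cmul_diff[symmetric] norm_cmul)
  qed
  ultimately show ?thesis
    unfolding closure_sequential by (intro exI[of _ "\<lambda>n. cmul c (X n)"]) simp
qed

lemma closure_tests_limit: "(\<And>k. X k \<in> closure tests) \<Longrightarrow> X \<longlonglongrightarrow> F \<Longrightarrow> F \<in> closure tests"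
  by (metis closed_closure closed_sequential_limits)

lemma closure_tests_0: "0 \<in> closure tests"
proof -
  have "test_function (\<lambda>x::real^'a. 0 * box_bump 0 0 0 x)"
    by (intro test_function_cmult test_function_box_bump) auto
  then show ?thesis
    using closure_subset[of tests] abs_l2_zero by (force simp: tests_def)
qed

section \<open>From boxes to measurable sets, simple functions and all of \<open>l2\<close>\<close>

definition ind :: "(real^'n) set \<Rightarrow> (real^'n) l2" where
  "ind A = abs_l2 (indicator A)"

lemma L2_indicator:
  fixes A :: "'a::euclidean_space set"
  assumes "A \<in> sets borel" "emeasure lborel A < \<infinity>"
  shows "(indicator A :: 'a \<Rightarrow> complex) \<in> L2"
proof (rule L2_bound)
  show "integrable lborel (indicator A :: 'a \<Rightarrow> real)"
    using assms by (auto intro: integrable_real_indicator)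
qed (use assms in \<open>auto simp: indicator_def\<close>)

lemma ind_empty: "ind {} = 0"
proof -
  have "(indicator {} :: real^'a \<Rightarrow> complex) = (\<lambda>_. 0)" by auto
  then show ?thesis by (simp add: ind_def abs_l2_zero)
qed

lemma ind_box_closure_tests: "ind (box a b) \<in> closure tests"
proof (cases "\<forall>i. a $ i \<le> b $ i")
  case True
  have L2: "(indicator (box a b) :: real^'a \<Rightarrow> complex) \<in> L2"
    by (intro L2_indicator emeasure_lborel_box_finite) auto
  have "(\<lambda>m. abs_l2 (box_bump a b m)) \<longlonglongrightarrow> ind (box a b)"
    unfolding ind_def
  proof (rule abs_l2_dominated)
    show "box_bump a b m \<in> L2" for m
      using True by (intro test_function_L2 test_function_box_bump) auto
    show "(\<lambda>m. box_bump a b m x) \<longlonglongrightarrow> indicator (box a b) x" for x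
      using True by (intro box_bump_tendsto) auto
    \<comment> \<open>Both functions have modulus at most 1 and vanish off the box, so their
      difference is at most 2 and its square at most 4 there.\<close>
    show "integrable lborel (\<lambda>x. 4 * indicator (box a b) x :: real)"
      by (intro integrable_mult_right integrable_real_indicator emeasure_lborel_box_finite) auto
    show "(norm (box_bump a b m x - indicator (box a b) x))\<^sup>2 \<le> 4 * indicator (box a b) x" for m x
    proof -
      have "norm (box_bump a b m x - indicator (box a b) x) \<le> norm (box_bump a b m x) + norm (indicator (box a b) x :: complex)"
        by (rule norm_triangle_ineq4)
      also have "\<dots> \<le> 2 * indicator (box a b) x"
        using norm_box_bump_le[of a b m x] True by (cases "x \<in> box a b") auto
      finally have "(norm (box_bump a b m x - indicator (box a b) x))\<^sup>2 \<le> (2 * indicator (box a b) x)\<^sup>2"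
        by (intro power_mono) auto
      then show ?thesis by (cases "x \<in> box a b") auto
    qed
  qed (rule L2)
  moreover have "abs_l2 (box_bump a b m) \<in> closure tests" for m
    using True by (intro subsetD[OF closure_subset]) (auto simp: tests_def intro!: imageI test_function_box_bump)
  ultimately show ?thesis
    by (rule closure_tests_limit[rotated])
next
  case False
  then obtain i where "b $ i < a $ i"
    by (auto simp: not_le)
  then have "x \<notin> box a b" for x
    by (auto simp: mem_box_cart intro!: exI[of _ i])
  then have "box a b = {}"
    by blast
  then show ?thesis
    by (simp add: ind_empty closure_tests_0)
qed

lemma ind_diff:
  assumes "A \<in> sets borel" "B \<in> sets borel" "A \<subseteq> B" "emeasure lborel B < \<infinity>"
  shows "ind (B - A) = ind B + cmul (-1) (ind A)"
proof -
  have "emeasure lborel A < \<infinity>"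
    using emeasure_mono[of A B lborel] assms by (auto intro: order_le_less_trans)
  note L2 = L2_indicator[OF assms(2,4)] L2_indicator[OF assms(1) this]
  have "indicator (B - A) = (\<lambda>x. indicator B x + (-1) * indicator A x :: complex)"
    using assms(3) by (auto simp: indicator_def fun_eq_iff)
  then show ?thesis
    unfolding ind_def by (simp only: abs_l2_add abs_l2_cmult L2_cmult L2)
qed

lemma ind_Un:
  assumes "A \<in> sets borel" "B \<in> sets borel" "A \<inter> B = {}" "emeasure lborel A < \<infinity>" "emeasure lborel B < \<infinity>"
  shows "ind (A \<union> B) = ind A + ind B"
proof -
  note L2 = L2_indicator[OF assms(1,4)] L2_indicator[OF assms(2,5)]
  have "indicator (A \<union> B) = (\<lambda>x. indicator A x + indicator B x :: complex)"
    using assms(3) by (auto simp: indicator_def fun_eq_iff)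
  then show ?thesis
    unfolding ind_def by (simp only: abs_l2_add L2)
qed

lemma ind_incseq:
  assumes A: "\<And>k. A k \<in> sets borel" "incseq A" and fin: "emeasure lborel (\<Union>k. A k) < \<infinity>"
  shows "(\<lambda>k. ind (A k)) \<longlonglongrightarrow> ind (\<Union>k. A k)"
  unfolding ind_def
proof (rule abs_l2_dominated)
  have "emeasure lborel (A k) < \<infinity>" for k
    using emeasure_mono[of "A k" "\<Union>k. A k" lborel] A fin by (auto intro: order_le_less_trans)
  then show "(indicator (A k) :: _ \<Rightarrow> complex) \<in> L2" for k
    by (intro L2_indicator A)
  show "(indicator (\<Union>k. A k) :: _ \<Rightarrow> complex) \<in> L2"
    using A fin by (intro L2_indicator) auto
  show "integrable lborel (indicator (\<Union>k. A k) :: _ \<Rightarrow> real)"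
    using A fin by (intro integrable_real_indicator) auto
  show "(norm (indicator (A k) x - indicator (\<Union>k. A k) x :: complex))\<^sup>2 \<le> indicator (\<Union>k. A k) x" for k x
    by (auto simp: indicator_def)
  show "(\<lambda>k. indicator (A k) x :: complex) \<longlonglongrightarrow> indicator (\<Union>k. A k) x" for x
    by (rule LIMSEQ_indicator_incseq[OF A(2)])
qed

text \<open>Dynkin's argument: open boxes are stable under intersection and generate the Borel sets,
  and the property passes to complements and disjoint countable unions. Intersecting with a fixed
  box keeps all measures finite, so complements stay in \<open>L2\<close>.\<close>

lemma ind_bounded_closure_tests:
  assumes "A \<in> sets borel"
  shows "ind (A \<inter> box a b) \<in> closure tests"
proof -
  let ?G = "range (\<lambda>(a, b). box a b :: (real^'a) set)"
  have borel: "sets borel = sigma_sets UNIV ?G"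
    by (subst borel_eq_box) (simp add: sets_measure_of)
  have meas: "X \<in> sigma_sets UNIV ?G \<Longrightarrow> X \<in> sets borel" for X
    by (simp add: borel)
  have fin: "emeasure lborel (X \<inter> box a b) < \<infinity>" for X
    by (intro emeasure_bounded_finite bounded_Int) (auto)
  have "Int_stable ?G"
    by (auto simp: Int_stable_def box_Int_box)
  moreover have "?G \<subseteq> Pow UNIV" by simp
  moreover have "A \<in> sigma_sets UNIV ?G"
    using assms by (simp add: borel)
  ultimately show ?thesis
  proof (induction rule: sigma_sets_induct_disjoint)
    case (basic A)
    then show ?case
      by (auto simp: box_Int_box ind_box_closure_tests)
  next
    case empty
    then show ?case
      by (simp add: ind_empty closure_tests_0)
  next
    case (compl A)
    have "ind ((UNIV - A) \<inter> box a b) = ind (box a b - A \<inter> box a b)"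
      by (rule arg_cong[where f = ind]) auto
    also have "\<dots> = ind (box a b) + cmul (-1) (ind (A \<inter> box a b))"
      using meas[OF compl(1)] by (intro ind_diff emeasure_lborel_box_finite) auto
    finally show ?case
      using compl(2) by (simp add: closure_tests_add closure_tests_cmul ind_box_closure_tests)
  next
    case (union A)
    have A: "A i \<in> sets borel" for i
      using union(2) meas by auto
    \<comment> \<open>Finite unions are handled by additivity, their increasing limit by dominated
      convergence.\<close>
    have part: "ind ((\<Union>i<m. A i) \<inter> box a b) \<in> closure tests" for m
    proof (induction m)
      case 0
      then show ?case
        by (simp add: ind_empty closure_tests_0)
    next
      case (Suc m)
      have "ind ((\<Union>i<Suc m. A i) \<inter> box a b) = ind (((\<Union>i<m. A i) \<inter> box a b) \<union> (A m \<inter> box a b))"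
        by (rule arg_cong[where f = ind]) (auto simp: lessThan_Suc)
      also have "\<dots> = ind ((\<Union>i<m. A i) \<inter> box a b) + ind (A m \<inter> box a b)"
      proof (intro ind_Un fin)
        have "A i \<inter> A m = {}" if "i < m" for i
          using union(1) that by (auto simp: disjoint_family_on_def)
        then show "((\<Union>i<m. A i) \<inter> box a b) \<inter> (A m \<inter> box a b) = {}"
          by auto
      qed (use A in auto)
      finally show ?case
        using Suc union(3) by (simp add: closure_tests_add)
    qed
    have "(\<lambda>m. ind ((\<Union>i<m. A i) \<inter> box a b)) \<longlonglongrightarrow> ind (\<Union>m. (\<Union>i<m. A i) \<inter> box a b)"
    proof (rule ind_incseq)
      show "incseq (\<lambda>m. (\<Union>i<m. A i) \<inter> box a b)"
        by (auto simp: incseq_def intro: less_le_trans)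
      have "(\<Union>m. (\<Union>i<m. A i) \<inter> box a b) = (\<Union>m. \<Union>i<m. A i) \<inter> box a b" by auto
      then show "emeasure lborel (\<Union>m. (\<Union>i<m. A i) \<inter> box a b) < \<infinity>"
        using fin by simp
    qed (use A in auto)
    moreover have "(\<Union>m. (\<Union>i<m. A i) \<inter> box a b) = (\<Union>i. A i) \<inter> box a b"
      by auto
    ultimately show ?case
      using closure_tests_limit[OF part] by simp
  qed
qed

lemma ind_closure_tests:
  assumes A: "A \<in> sets borel" and fin: "emeasure lborel A < \<infinity>"
  shows "ind A \<in> closure tests"
proof -
  let ?B = "\<lambda>k::nat. box (- (real k *\<^sub>R One)) (real k *\<^sub>R One) :: (real^'a) set"
  have eq: "(\<Union>k. A \<inter> ?B k) = A"
    using UN_box_eq_UNIV[where 'a = "real^'a"] by auto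
  have "(\<lambda>k. ind (A \<inter> ?B k)) \<longlonglongrightarrow> ind (\<Union>k. A \<inter> ?B k)"
  proof (rule ind_incseq)
    have "?B m \<subseteq> ?B n" if "m \<le> n" for m n
      by (rule subset_box_imp(4)) (use that in auto)
    then show "incseq (\<lambda>k. A \<inter> ?B k)"
      unfolding incseq_def by blast
    show "emeasure lborel (\<Union>k. A \<inter> ?B k) < \<infinity>"
      unfolding eq by (rule fin)
  qed (use A in auto)
  then show ?thesis
    unfolding eq by (rule closure_tests_limit[OF ind_bounded_closure_tests[OF A]])
qed

text \<open>A simple function combines the indicators of its level sets. For values other than 0
  these have finite measure by square integrability; the level set of 0, possibly of infinite
  measure, contributes nothing.\<close>

lemma simple_L2_closure_tests:
  fixes g :: "real^'n \<Rightarrow> complex"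
  assumes g: "simple_function lborel g" "g \<in> L2"
  shows "abs_l2 g \<in> closure tests"
proof -
  have g_meas: "g -` {y} \<in> sets borel" for y
    using simple_functionD(2)[OF g(1), of "{y}"] by simp
  have P: "(\<lambda>x. \<Sum>y\<in>Y. y * indicator (g -` {y}) x) \<in> L2 \<and>
      abs_l2 (\<lambda>x. \<Sum>y\<in>Y. y * indicator (g -` {y}) x) \<in> closure tests" (is "?P Y") if "finite Y" for Y
    using that
  proof (induction Y)
    case empty
    then show ?case
      by (simp add: L2_zero abs_l2_zero closure_tests_0)
  next
    case (insert y Y)
    have "(\<lambda>x. y * indicator (g -` {y}) x) \<in> L2 \<and> abs_l2 (\<lambda>x. y * indicator (g -` {y}) x) \<in> closure tests"
    proof (cases "y = 0")
      case True
      then show ?thesis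
        by (simp add: L2_zero abs_l2_zero closure_tests_0)
    next
      case False
      have "integrable lborel (\<lambda>x. indicator (g -` {y}) x * (norm y)\<^sup>2 :: real)"
      proof (rule Bochner_Integration.integrable_bound[OF L2_integrable[OF g(2)]])
        show "AE x in lborel. norm (indicator (g -` {y}) x * (norm y)\<^sup>2 :: real) \<le> norm ((norm (g x))\<^sup>2)"
          by (intro AE_I2) (auto simp: indicator_def)
      qed (use g_meas in measurable)
      then have "integrable lborel (indicator (g -` {y}) :: _ \<Rightarrow> real)"
        using False by simp
      then have "emeasure lborel (g -` {y}) < \<infinity>"
        using g_meas by (simp add: integrable_indicator_iff)
      then show ?thesis
        using L2_indicator[OF g_meas] ind_closure_tests[OF g_meas]
        by (auto simp: ind_def abs_l2_cmult intro!: L2_cmult closure_tests_cmul)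
    qed
    then show ?case
      using insert(3) by (simp only: sum.insert[OF insert(1,2)] L2_add abs_l2_add closure_tests_add simp_thms)
  qed
  have fin: "finite (range g)"
    using simple_functionD(1)[OF g(1)] by simp
  have "(\<Sum>y\<in>range g. y * indicator (g -` {y}) x) = g x" for x
  proof -
    have "(\<Sum>y\<in>range g. y * indicator (g -` {y}) x) = (\<Sum>y\<in>{g x}. y * indicator (g -` {y}) x)"
      using fin by (intro sum.mono_neutral_right) (auto simp: indicator_def)
    then show ?thesis by simp
  qed
  then have "(\<lambda>x. \<Sum>y\<in>range g. y * indicator (g -` {y}) x) = g"
    by (rule ext)
  then show ?thesis using P[OF fin] by (simp only:)
qed

lemma closure_tests: "closure tests = (UNIV :: (real^'n::finite) l2 set)"
proof -
  have "F \<in> closure tests" for F :: "(real^'n) l2"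
  proof (cases rule: l2_cases[of F])
    fix f assume f: "f \<in> L2" "F = abs_l2 f"
    obtain s where s: "\<And>i. simple_function lborel (s i)" "\<And>x. (\<lambda>i. s i x) \<longlonglongrightarrow> f x"
        "\<And>i x. dist (s i x) 0 \<le> 2 * dist (f x) 0"
      using borel_measurable_implies_sequence_metric[of f lborel 0] L2_measurable[OF f(1)] by auto
    \<comment> \<open>The approximants satisfy \<open>norm (s i x) \<le> 2 * norm (f x)\<close>, so
      they and their differences from \<open>f\<close> stay below \<open>3 * norm (f x)\<close>;
      hence the constant 9.\<close>
    have int: "integrable lborel (\<lambda>x. 9 * (norm (f x))\<^sup>2)"
      using f by (simp add: L2_integrable)
    have s_L2: "s i \<in> L2" for i
    proof (rule L2_bound[OF _ int])
      show "s i \<in> borel_measurable borel"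
        using borel_measurable_simple_function[OF s(1)] by simp
      fix x
      have "norm (s i x) \<le> 3 * norm (f x)"
        using s(3)[of i x] norm_ge_zero[of "f x"] unfolding dist_0_norm dist_commute[of _ 0] by linarith
      then have "(norm (s i x))\<^sup>2 \<le> (3 * norm (f x))\<^sup>2"
        by (intro power_mono) auto
      then show "(norm (s i x))\<^sup>2 \<le> 9 * (norm (f x))\<^sup>2"
        by (simp add: power_mult_distrib)
    qed
    have "(\<lambda>i. abs_l2 (s i)) \<longlonglongrightarrow> abs_l2 f"
    proof (rule abs_l2_dominated[OF s_L2 f(1) int _ s(2)])
      fix i x
      have "norm (s i x - f x) \<le> 3 * norm (f x)"
        using norm_triangle_ineq4[of "s i x" "f x"] s(3)[of i x] by simp
      then have "(norm (s i x - f x))\<^sup>2 \<le> (3 * norm (f x))\<^sup>2"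
        by (intro power_mono) auto
      then show "(norm (s i x - f x))\<^sup>2 \<le> 9 * (norm (f x))\<^sup>2"
        by (simp add: power_mult_distrib)
    qed
    then show ?thesis
      unfolding f(2) by (rule closure_tests_limit[OF simple_L2_closure_tests[OF s(1) s_L2]])
  qed
  then show ?thesis by auto
qed

section \<open>Weak derivatives and difference quotients\<close>

lemma l2_approx:
  fixes F :: "(real^'n::finite) l2"
  obtains \<phi> where "\<And>n::nat. test_function (\<phi> n)" "(\<lambda>n. abs_l2 (\<phi> n)) \<longlonglongrightarrow> F"
proof -
  have "F \<in> closure tests" by (simp add: closure_tests)
  then obtain X where X: "\<And>n. X n \<in> tests" "X \<longlonglongrightarrow> F"
    unfolding closure_sequential by blast
  then obtain \<phi> where "\<And>n. test_function (\<phi> n) \<and> X n = abs_l2 (\<phi> n)"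
    unfolding tests_def image_iff by (metis mem_Collect_eq)
  then have "\<And>n. test_function (\<phi> n)" "X = (\<lambda>n. abs_l2 (\<phi> n))"
    by auto
  then show thesis using that[of \<phi>] X(2) by simp
qed

text \<open>Duality with a dense set: testing against approximations of \<open>F\<close> itself
  yields \<open>norm F * norm F \<le> c * norm F\<close>.\<close>

lemma norm_le_tests:
  fixes F :: "(real^'n::finite) l2"
  assumes le: "\<And>\<phi>. test_function \<phi> \<Longrightarrow> inner F (abs_l2 \<phi>) \<le> c * norm (abs_l2 \<phi>)" and "0 \<le> c"
  shows "norm F \<le> c"
proof -
  obtain \<phi> where \<phi>: "\<And>n::nat. test_function (\<phi> n)" "(\<lambda>n. abs_l2 (\<phi> n)) \<longlonglongrightarrow> F"
    using l2_approx[of F] by blast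
  have "inner F F \<le> c * norm F"
    by (rule LIMSEQ_le[of "\<lambda>n. inner F (abs_l2 (\<phi> n))" _ "\<lambda>n. c * norm (abs_l2 (\<phi> n))"])
       (auto intro!: tendsto_intros \<phi> le)
  then have "norm F * norm F \<le> c * norm F"
    by (simp add: power2_norm_eq_inner[symmetric] power2_eq_square)
  then show ?thesis
    using \<open>0 \<le> c\<close> by (cases "norm F = 0") (auto simp: mult_le_cancel_right)
qed

lemma eq_0_tests:
  fixes F :: "(real^'n::finite) l2"
  assumes "\<And>\<phi>. test_function \<phi> \<Longrightarrow> inner F (abs_l2 \<phi>) = 0"
  shows "F = 0"
  using norm_le_tests[of F 0] assms by simp

lemma has_vector_derivative_quadratic:
  fixes f :: "real \<Rightarrow> 'a::real_normed_vector"
  assumes "\<And>h. \<bar>h\<bar> \<le> 1 \<Longrightarrow> norm (f (s + h) - f s - h *\<^sub>R v) \<le> C * h\<^sup>2"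
  shows "(f has_vector_derivative v) (at s)"
proof -
  have "((\<lambda>h. norm (f (s + h) - f s - h *\<^sub>R v) / norm h) \<longlongrightarrow> 0) (at 0)"
  proof (rule tendsto_0_le[where K = "\<bar>C\<bar>"])
    show "((\<lambda>h::real. h) \<longlongrightarrow> 0) (at 0)" by (rule tendsto_ident_at)
    have "eventually (\<lambda>h::real. \<bar>h\<bar> \<le> 1) (at 0)"
      by (auto simp: eventually_at intro!: exI[of _ 1])
    then show "eventually (\<lambda>h. norm (norm (f (s + h) - f s - h *\<^sub>R v) / norm h) \<le> norm h * \<bar>C\<bar>) (at 0)"
    proof eventually_elim
      case (elim h)
      have "norm (f (s + h) - f s - h *\<^sub>R v) \<le> \<bar>C\<bar> * h\<^sup>2"
        using assms[OF elim] by (rule order_trans) (auto intro: mult_right_mono)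
      also have "\<dots> = norm h * \<bar>C\<bar> * norm h"
        by (simp add: power2_eq_square)
      finally show ?case
        by (cases "h = 0") (auto simp: divide_simps mult_ac)
    qed
  qed
  then show ?thesis
    unfolding has_vector_derivative_def has_derivative_at
    by (simp add: bounded_linear_scaleR_left)
qed

text \<open>The Taylor bound is uniform in \<open>x\<close> and everything is supported in one ball,
  so it holds in \<open>l2\<close> with remainder \<open>C * h^2\<close>. The group property moves
  the derivative from 0 to an arbitrary \<open>s\<close>.\<close>

lemma shift_test_deriv:
  fixes \<phi> :: "real^'n::finite \<Rightarrow> complex"
  assumes \<phi>: "test_function \<phi>"
  shows "((\<lambda>s. shift (s *\<^sub>R axis i 1) (abs_l2 \<phi>)) has_vector_derivative
     shift (s *\<^sub>R axis i 1) (abs_l2 (pd i \<phi>))) (at s)"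
proof -
  let ?e = "axis i 1 :: real^'n"
  obtain K where K: "compact K" "\<And>x. x \<notin> K \<Longrightarrow> \<phi> x = 0"
    using \<phi> by (auto simp: test_function_def)
  obtain R where R: "\<And>x. x \<in> K \<Longrightarrow> norm x \<le> R"
    using compact_imp_bounded[OF K(1)] by (auto simp: bounded_iff)
  obtain B where B: "0 \<le> B" "\<And>x. norm (pd i (pd i \<phi>) x) \<le> B"
    using test_function_bounded[OF test_function_pd[OF test_function_pd[OF \<phi>]]] by metis
  note [simp] = test_function_L2 \<phi> test_function_pd
  have outside: "\<phi> x = 0" "pd i \<phi> x = 0" if "norm x > R" for x
  proof -
    show "\<phi> x = 0" using K(2) R that by force
    have "((\<lambda>_. 0) has_derivative (\<lambda>_. 0)) (at x)" by simp
    then have "(\<phi> has_derivative (\<lambda>_. 0)) (at x)"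
      by (rule has_derivative_transform_within_open[of _ _ _ _ "- cball 0 R"])
         (use K(2) R that in \<open>force+\<close>)
    then show "pd i \<phi> x = 0" by (simp add: pd_eqI)
  qed
  \<comment> \<open>The radius is \<open>R + 1\<close> because shifts with
    \<open>\<bar>h\<bar> \<le> 1\<close> move the support by at most 1.\<close>
  define C where "C = B * sqrt (measure lborel (cball (0::real^'n) (R + 1)))"
  have bound: "norm (shift (h *\<^sub>R ?e) (abs_l2 \<phi>) - abs_l2 \<phi> - h *\<^sub>R abs_l2 (pd i \<phi>)) \<le> C * h\<^sup>2" if h: "\<bar>h\<bar> \<le> 1" for h
  proof -
    let ?f = "\<lambda>x. \<phi> (x + h *\<^sub>R ?e) - \<phi> x - h *\<^sub>R pd i \<phi> x"
    have L2: "?f \<in> L2"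
      by (intro L2_diff L2_scaleR L2_shift) auto
    have "L2_norm ?f \<le> (h\<^sup>2 * B) * sqrt (measure lborel (cball (0::real^'n) (R + 1)))"
    proof (rule L2_bounded_support(2))
      show "?f \<in> borel_measurable borel" by (rule L2_measurable[OF L2])
      show "norm (?f x) \<le> h\<^sup>2 * B" for x
        by (rule test_function_taylor[OF \<phi> B(2)])
      fix x :: "real^'n" assume "x \<notin> cball 0 (R + 1)"
      then have x: "norm x > R + 1" by simp
      have "norm x \<le> norm (x + h *\<^sub>R ?e) + norm (h *\<^sub>R ?e)"
        by (metis add_diff_cancel_right' norm_triangle_ineq4)
      then have "norm (x + h *\<^sub>R ?e) > R"
        using x h by (simp add: norm_axis_1)
      then show "?f x = 0"
        using outside x by simp
    qed auto
    moreover have "abs_l2 ?f = shift (h *\<^sub>R ?e) (abs_l2 \<phi>) - abs_l2 \<phi> - h *\<^sub>R abs_l2 (pd i \<phi>)"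
      by (simp add: abs_l2_diff abs_l2_scaleR abs_l2_shift L2_diff L2_scaleR L2_shift)
    ultimately show ?thesis
      using norm_abs_l2[OF L2] by (simp add: C_def mult_ac)
  qed
  show ?thesis
  proof (rule has_vector_derivative_quadratic)
    fix h :: real assume h: "\<bar>h\<bar> \<le> 1"
    have "shift ((s + h) *\<^sub>R ?e) (abs_l2 \<phi>) - shift (s *\<^sub>R ?e) (abs_l2 \<phi>) - h *\<^sub>R shift (s *\<^sub>R ?e) (abs_l2 (pd i \<phi>))
        = shift (s *\<^sub>R ?e) (shift (h *\<^sub>R ?e) (abs_l2 \<phi>) - abs_l2 \<phi> - h *\<^sub>R abs_l2 (pd i \<phi>))"
      by (simp add: linear_diff[OF linear_shift] shift_scaleR shift_shift scaleR_add_left)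
    then show "norm (shift ((s + h) *\<^sub>R ?e) (abs_l2 \<phi>) - shift (s *\<^sub>R ?e) (abs_l2 \<phi>) - h *\<^sub>R shift (s *\<^sub>R ?e) (abs_l2 (pd i \<phi>))) \<le> C * h\<^sup>2"
      using bound[OF h] by simp
  qed
qed

text \<open>Strong continuity of the translation group: it holds on the dense set of test functions,
  and translations are isometries.\<close>

lemma shift_tendsto:
  fixes F :: "(real^'n::finite) l2"
  shows "((\<lambda>s. shift (s *\<^sub>R axis i 1) F) \<longlongrightarrow> F) (at 0)"
proof (rule tendstoI)
  fix e :: real assume e: "0 < e"
  obtain \<phi> where \<phi>: "\<And>n::nat. test_function (\<phi> n)" "(\<lambda>n. abs_l2 (\<phi> n)) \<longlonglongrightarrow> F"
    using l2_approx[of F] by blast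
  obtain n where n: "dist (abs_l2 (\<phi> n)) F < e / 3"
    using tendstoD[OF \<phi>(2), of "e / 3"] e by (auto simp: eventually_sequentially)
  define \<Phi> where "\<Phi> = abs_l2 (\<phi> n)"
  have "isCont (\<lambda>s. shift (s *\<^sub>R axis i 1) \<Phi>) 0"
    unfolding \<Phi>_def by (rule has_vector_derivative_continuous[OF shift_test_deriv[OF \<phi>(1)]])
  then have "((\<lambda>s. shift (s *\<^sub>R axis i 1) \<Phi>) \<longlongrightarrow> \<Phi>) (at 0)"
    by (simp add: isCont_def)
  then have "eventually (\<lambda>s. dist (shift (s *\<^sub>R axis i 1) \<Phi>) \<Phi> < e / 3) (at 0)"
    using e by (intro tendstoD) auto
  then show "eventually (\<lambda>s. dist (shift (s *\<^sub>R axis i 1) F) F < e) (at 0)"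
  proof eventually_elim
    case (elim s)
    have "dist (shift (s *\<^sub>R axis i 1) F) (shift (s *\<^sub>R axis i 1) \<Phi>) = dist F \<Phi>"
      by (simp add: dist_norm linear_diff[OF linear_shift, symmetric])
    then show ?case
      using n elim dist_triangle[of "shift (s *\<^sub>R axis i 1) F" F "shift (s *\<^sub>R axis i 1) \<Phi>"]
        dist_triangle[of "shift (s *\<^sub>R axis i 1) \<Phi>" F \<Phi>]
      by (simp add: \<Phi>_def dist_commute)
  qed
qed

section \<open>Weak derivatives in the quotient\<close>

definition wd :: "'n::finite \<Rightarrow> (real^'n) l2 \<Rightarrow> (real^'n) l2 \<Rightarrow> bool" where
  "wd i F G \<longleftrightarrow> (\<forall>\<phi>. test_function \<phi> \<longrightarrow> inner F (abs_l2 (pd i \<phi>)) = - inner G (abs_l2 \<phi>))"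

lemma inner_abs_l2_Re:
  assumes "f \<in> L2" "g \<in> L2"
  shows "inner (abs_l2 f) (abs_l2 g) = Re (LINT x|lborel. f x * cnj (g x))"
  by (simp add: inner_abs_l2 assms integral_Re[OF L2_mult_integrable[OF assms(1) L2_cnj[OF assms(2)]]] del: times_complex.sel)

text \<open>The real inner product sees only real parts, but a test function times
  \<open>- \<i>\<close> is again one, which supplies the imaginary parts. Conjugations appear
  because \<open>weak_pd\<close> pairs bilinearly while \<open>inner\<close> conjugates its second
  argument.\<close>

lemma weak_pd_iff_wd:
  assumes f: "f \<in> L2" "g \<in> L2"
  shows "weak_pd i f g \<longleftrightarrow> wd i (abs_l2 f) (abs_l2 g)"
proof
  assume weak: "weak_pd i f g"
  show "wd i (abs_l2 f) (abs_l2 g)"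
    unfolding wd_def
  proof (intro allI impI)
    fix \<phi> :: "real^'a \<Rightarrow> complex" assume \<phi>: "test_function \<phi>"
    have "(LINT x|lborel. f x * cnj (pd i \<phi> x)) = - (LINT x|lborel. g x * cnj (\<phi> x))"
      using weak[unfolded weak_pd_def, rule_format, OF test_function_cnj(1)[OF \<phi>]] by (simp add: test_function_cnj(2)[OF \<phi>])
    then show "inner (abs_l2 f) (abs_l2 (pd i \<phi>)) = - inner (abs_l2 g) (abs_l2 \<phi>)"
      using f \<phi> by (simp add: inner_abs_l2_Re test_function_L2 test_function_pd)
  qed
next
  assume wd: "wd i (abs_l2 f) (abs_l2 g)"
  have re: "Re (LINT x|lborel. f x * pd i \<phi> x) = - Re (LINT x|lborel. g x * \<phi> x)" if "test_function \<phi>" for \<phi>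
    using wd[unfolded wd_def, rule_format, OF test_function_cnj(1)[OF that]] f that
    by (simp add: inner_abs_l2_Re test_function_L2 test_function_pd test_function_cnj L2_cnj)
  show "weak_pd i f g"
    unfolding weak_pd_def
  proof (intro allI impI)
    fix \<phi> :: "real^'a \<Rightarrow> complex" assume \<phi>: "test_function \<phi>"
    have "Re (LINT x|lborel. f x * (- \<i> * pd i \<phi> x)) = - Re (LINT x|lborel. g x * (- \<i> * \<phi> x))"
      using re[OF test_function_cmult(1)[OF \<phi>, of "- \<i>"]] by (simp only: test_function_cmult(2)[OF \<phi>])
    moreover have "(LINT x|lborel. f x * (- \<i> * pd i \<phi> x)) = - \<i> * (LINT x|lborel. f x * pd i \<phi> x)"
      by (simp add: mult.left_commute flip: integral_mult_right_zero)
    moreover have "(LINT x|lborel. g x * (- \<i> * \<phi> x)) = - \<i> * (LINT x|lborel. g x * \<phi> x)"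
      by (simp add: mult.left_commute flip: integral_mult_right_zero)
    ultimately have "Im (LINT x|lborel. f x * pd i \<phi> x) = - Im (LINT x|lborel. g x * \<phi> x)"
      by simp
    then show "(LINT x|lborel. f x * pd i \<phi> x) = - (LINT x|lborel. g x * \<phi> x)"
      using re[OF \<phi>] by (simp add: complex_eq_iff)
  qed
qed

lemma wd_add: "wd i F G \<Longrightarrow> wd i F' G' \<Longrightarrow> wd i (F + F') (G + G')"
  by (simp add: wd_def inner_add_left)

lemma wd_scaleR: "wd i F G \<Longrightarrow> wd i (r *\<^sub>R F) (r *\<^sub>R G)"
  by (simp add: wd_def)

lemma wd_0: "wd i 0 0"
  by (simp add: wd_def)

lemma wd_diff: "wd i F G \<Longrightarrow> wd i F' G' \<Longrightarrow> wd i (F - F') (G - G')"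
  by (simp add: wd_def inner_diff_left)

lemma wd_sum: "(\<And>j. j \<in> J \<Longrightarrow> wd i (F j) (G j)) \<Longrightarrow> wd i (\<Sum>j\<in>J. F j) (\<Sum>j\<in>J. G j)"
  by (induction J rule: infinite_finite_induct) (auto simp: wd_0 wd_add)

lemma wd_unique:
  assumes "wd i F G" "wd i F G'"
  shows "G = G'"
proof -
  have "G - G' = 0"
    using assms by (intro eq_0_tests) (simp add: wd_def inner_diff_left)
  then show ?thesis by simp
qed

lemma wd_shift:
  assumes "wd i F G"
  shows "wd i (shift y F) (shift y G)"
  unfolding wd_def
proof (intro allI impI)
  fix \<phi> :: "real^'a \<Rightarrow> complex" assume \<phi>: "test_function \<phi>"
  have "inner F (abs_l2 (pd i (\<lambda>x. \<phi> (x + - y)))) = - inner G (abs_l2 (\<lambda>x. \<phi> (x + - y)))"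
    using assms test_function_shift(1)[OF \<phi>] unfolding wd_def by blast
  then show "inner (shift y F) (abs_l2 (pd i \<phi>)) = - inner (shift y G) (abs_l2 \<phi>)"
    by (simp only: test_function_shift(2)[OF \<phi>] abs_l2_shift test_function_L2 test_function_pd \<phi> inner_shift_left)
qed

text \<open>\<open>F\<close> need not be smooth, so the translation is moved onto the test function
  and differentiated there; the definition of \<open>wd\<close> moves the derivative back, and the
  two minus signs cancel.\<close>

lemma wd_inner_shift_deriv:
  assumes "wd i F G" and \<phi>: "test_function \<phi>"
  shows "((\<lambda>s. inner (shift (s *\<^sub>R axis i 1) F) (abs_l2 \<phi>)) has_vector_derivative
     inner (shift (s *\<^sub>R axis i 1) G) (abs_l2 \<phi>)) (at s within S)"
proof -
  let ?e = "axis i 1 :: real^'a"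
  have "((\<lambda>s. shift (s *\<^sub>R ?e) (abs_l2 \<phi>)) \<circ> uminus has_vector_derivative
      (-1) *\<^sub>R shift (- s *\<^sub>R ?e) (abs_l2 (pd i \<phi>))) (at s)"
  proof (rule vector_diff_chain_at)
    show "(uminus has_vector_derivative - 1) (at s)"
      by (auto intro!: derivative_eq_intros)
    show "((\<lambda>s. shift (s *\<^sub>R ?e) (abs_l2 \<phi>)) has_vector_derivative shift (- s *\<^sub>R ?e) (abs_l2 (pd i \<phi>))) (at (- s))"
      by (rule shift_test_deriv[OF \<phi>])
  qed
  then have "((\<lambda>s. shift (- s *\<^sub>R ?e) (abs_l2 \<phi>)) has_vector_derivative
      - shift (- s *\<^sub>R ?e) (abs_l2 (pd i \<phi>))) (at s)"
    by (simp add: o_def)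
  then have "((\<lambda>s. inner F (shift (- s *\<^sub>R ?e) (abs_l2 \<phi>))) has_vector_derivative
      inner F (- shift (- s *\<^sub>R ?e) (abs_l2 (pd i \<phi>)))) (at s)"
    by (rule bounded_linear.has_vector_derivative[OF bounded_linear_inner_right])
  then have "((\<lambda>s. inner (shift (s *\<^sub>R ?e) F) (abs_l2 \<phi>)) has_vector_derivative
      - inner (shift (s *\<^sub>R ?e) F) (abs_l2 (pd i \<phi>))) (at s)"
    by (simp add: inner_shift_left)
  moreover have "- inner (shift (s *\<^sub>R ?e) F) (abs_l2 (pd i \<phi>)) = inner (shift (s *\<^sub>R ?e) G) (abs_l2 \<phi>)"
    using wd_shift[OF assms(1), of "s *\<^sub>R ?e"] \<phi> by (simp add: wd_def)
  ultimately show ?thesis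
    by (metis has_vector_derivative_at_within)
qed

text \<open>A mean value inequality for weak derivatives: testing reduces it to a real function of
  \<open>s\<close>, and \<open>norm_le_tests\<close> returns to the norm.\<close>

lemma wd_difference_quotient:
  assumes wd: "wd i F G" and \<epsilon>: "\<And>s. \<bar>s\<bar> \<le> \<bar>h\<bar> \<Longrightarrow> norm (shift (s *\<^sub>R axis i 1) G - G') \<le> \<epsilon>"
  shows "norm (shift (h *\<^sub>R axis i 1) F - F - h *\<^sub>R G') \<le> \<bar>h\<bar> * \<epsilon>"
proof (rule norm_le_tests)
  let ?e = "axis i 1 :: real^'a"
  show "0 \<le> \<bar>h\<bar> * \<epsilon>"
    using order_trans[OF norm_ge_zero \<epsilon>[of 0]] by simp
  fix \<phi> :: "real^'a \<Rightarrow> complex" assume \<phi>: "test_function \<phi>"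
  let ?k = "\<lambda>s. inner (shift (s *\<^sub>R ?e) F) (abs_l2 \<phi>) - s *\<^sub>R inner G' (abs_l2 \<phi>)"
  have deriv: "(?k has_vector_derivative inner (shift (s *\<^sub>R ?e) G) (abs_l2 \<phi>) - inner G' (abs_l2 \<phi>)) (at s within closed_segment 0 h)" for s
    by (intro has_vector_derivative_diff wd_inner_shift_deriv wd \<phi>) (auto intro!: derivative_eq_intros)
  have "norm (?k h - ?k 0) \<le> \<epsilon> * norm (abs_l2 \<phi>) * norm (h - 0)"
  proof (rule differentiable_bound)
    show "convex (closed_segment 0 h)" by simp
    show "(?k has_derivative (\<lambda>x. x *\<^sub>R (inner (shift (s *\<^sub>R ?e) G) (abs_l2 \<phi>) - inner G' (abs_l2 \<phi>)))) (at s within closed_segment 0 h)" for s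
      using deriv[of s] unfolding has_vector_derivative_def .
    show "onorm (\<lambda>x. x *\<^sub>R (inner (shift (s *\<^sub>R ?e) G) (abs_l2 \<phi>) - inner G' (abs_l2 \<phi>))) \<le> \<epsilon> * norm (abs_l2 \<phi>)"
      if "s \<in> closed_segment 0 h" for s
    proof (rule onorm_le)
      fix x :: real
      have "\<bar>inner (shift (s *\<^sub>R ?e) G) (abs_l2 \<phi>) - inner G' (abs_l2 \<phi>)\<bar> = \<bar>inner (shift (s *\<^sub>R ?e) G - G') (abs_l2 \<phi>)\<bar>"
        by (simp add: inner_diff_left)
      also have "\<dots> \<le> norm (shift (s *\<^sub>R ?e) G - G') * norm (abs_l2 \<phi>)"
        by (rule Cauchy_Schwarz_ineq2)
      also have "\<dots> \<le> \<epsilon> * norm (abs_l2 \<phi>)"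
        using that by (intro mult_right_mono \<epsilon>) (auto simp: closed_segment_eq_real_ivl split: if_splits)
      finally show "norm (x *\<^sub>R (inner (shift (s *\<^sub>R ?e) G) (abs_l2 \<phi>) - inner G' (abs_l2 \<phi>))) \<le> \<epsilon> * norm (abs_l2 \<phi>) * norm x"
        by (simp add: abs_mult mult.commute mult_left_mono)
    qed
  qed auto
  then show "inner (shift (h *\<^sub>R ?e) F - F - h *\<^sub>R G') (abs_l2 \<phi>) \<le> \<bar>h\<bar> * \<epsilon> * norm (abs_l2 \<phi>)"
    by (simp add: inner_diff_left mult_ac)
qed

text \<open>Compactness makes the continuity of translations uniform over the derivatives \<open>G t\<close>.\<close>

lemma wd_difference_quotient_uniform:
  fixes U G :: "real \<Rightarrow> (real^'n::finite) l2"
  assumes wd: "\<And>t. t \<in> I \<Longrightarrow> wd i (U t) (G t)"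
    and I: "compact I" and cont: "continuous_on I G" and e: "0 < e"
  shows "eventually (\<lambda>h. \<forall>t\<in>I. norm (shift (h *\<^sub>R axis i 1) (U t) - U t - h *\<^sub>R G t) \<le> \<bar>h\<bar> * e) (at 0)"
proof -
  let ?e = "axis i 1 :: real^'n"
  \<comment> \<open>A finite net of the compact image leaves finitely many vectors to which
    \<open>shift_tendsto\<close> is applied.\<close>
  obtain T where T: "finite T" "G ` I \<subseteq> (\<Union>x\<in>T. ball x (e / 3))"
    using compact_continuous_image[OF cont I] e unfolding compact_eq_totally_bounded
    by (metis divide_pos_pos zero_less_numeral)
  have "eventually (\<lambda>h. dist (shift (h *\<^sub>R ?e) F) F < e / 3) (at 0)" for F
    using shift_tendsto[of i F] e by (intro tendstoD) auto
  then have "eventually (\<lambda>h. \<forall>F\<in>T. dist (shift (h *\<^sub>R ?e) F) F < e / 3) (at 0)"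
    by (intro eventually_ball_finite T) auto
  then obtain d where d: "0 < d" "\<And>h F. F \<in> T \<Longrightarrow> h \<noteq> 0 \<Longrightarrow> \<bar>h\<bar> < d \<Longrightarrow> dist (shift (h *\<^sub>R ?e) F) F < e / 3"
    unfolding eventually_at by auto
  \<comment> \<open>The filter \<open>at 0\<close> leaves out 0, which the mean value inequality
    needs as a point of the segment.\<close>
  have d': "dist (shift (h *\<^sub>R ?e) F) F < e / 3" if "F \<in> T" "\<bar>h\<bar> < d" for h F
    using d(2)[of F h] that e by (cases "h = 0") auto
  have "norm (shift (h *\<^sub>R ?e) (U t) - U t - h *\<^sub>R G t) \<le> \<bar>h\<bar> * e" if t: "t \<in> I" and h: "\<bar>h\<bar> < d" for t h
  proof (rule wd_difference_quotient[OF wd[OF t]])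
    fix s assume s: "\<bar>s\<bar> \<le> \<bar>h\<bar>"
    obtain F where F: "F \<in> T" "dist F (G t) < e / 3"
      using T(2) t by (force simp: dist_commute)
    have "dist (shift (s *\<^sub>R ?e) (G t)) (shift (s *\<^sub>R ?e) F) = dist (G t) F"
      by (simp add: dist_norm linear_diff[OF linear_shift, symmetric])
    then have "dist (shift (s *\<^sub>R ?e) (G t)) (G t) < e"
      using d'[OF F(1), of s] s h F(2) dist_triangle[of "shift (s *\<^sub>R ?e) (G t)" "G t" "shift (s *\<^sub>R ?e) F"]
        dist_triangle[of "shift (s *\<^sub>R ?e) F" "G t" F]
      by (simp add: dist_commute)
    then show "norm (shift (s *\<^sub>R ?e) (G t) - G t) \<le> e"
      by (simp add: dist_norm)
  qed
  then show ?thesis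
    using d(1) unfolding eventually_at by (intro exI[of _ d]) auto
qed

section \<open>A discrete heat semigroup\<close>

text \<open>\<open>avg h = 1 - B / N\<close>, where \<open>- B\<close> is the discrete Laplacian of mesh \<open>h\<close> and \<open>N = 4 n / h\<^sup>2\<close> bounds \<open>B\<close>.\<close>

definition avg :: "real \<Rightarrow> (real^'n::finite) l2 \<Rightarrow> (real^'n) l2" where
  "avg h F = (1/2) *\<^sub>R F + (1 / (4 * real CARD('n))) *\<^sub>R
     (\<Sum>j\<in>UNIV. shift (h *\<^sub>R axis j 1) F + shift (- (h *\<^sub>R axis j 1)) F)"

text \<open>The sequence \<open>q_m(t)\<close> is its diagonal at \<open>u(t)\<close>; the polarised
  form is needed for time derivatives and for Cauchy-Schwarz.\<close>

definition form :: "real \<Rightarrow> nat \<Rightarrow> (real^'n::finite) l2 \<Rightarrow> (real^'n) l2 \<Rightarrow> real" where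
  "form h m F G = inner ((avg h ^^ m) F) G"

lemma linear_avg: "linear (avg h)"
  by (rule linearI)
     (simp_all add: avg_def shift_add shift_scaleR scaleR_add_right sum.distrib scaleR_sum_right mult.commute)

lemma linear_avg_pow: "linear (avg h ^^ m)"
proof (induction m)
  case 0
  show ?case by (simp add: linear_id[unfolded id_def] id_def)
next
  case (Suc m)
  then show ?case using linear_compose[OF Suc linear_avg] by (simp add: o_def)
qed

lemma avg_shift: "avg h (shift y F) = shift y (avg h F)"
  by (simp add: avg_def shift_add shift_scaleR linear_sum[OF linear_shift] shift_shift add.commute)

lemma avg_pow_shift: "(avg h ^^ m) (shift y F) = shift y ((avg h ^^ m) F)"
  by (induction m) (simp_all add: avg_shift)

lemma linear_cmul: "linear (cmul c)"
  by (intro linearI cmul_add cmul_scaleR)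

lemma avg_cmul: "avg h (cmul c F) = cmul c (avg h F)"
  by (simp add: avg_def cmul_add cmul_scaleR linear_sum[OF linear_cmul] shift_cmul)

lemma avg_pow_cmul: "(avg h ^^ m) (cmul c F) = cmul c ((avg h ^^ m) F)"
  by (induction m) (simp_all add: avg_cmul)

text \<open>Translations by \<open>y\<close> and \<open>- y\<close> are adjoint to each other and
  occur in \<open>avg\<close> with equal weights.\<close>

lemma inner_avg: "inner (avg h F) G = inner F (avg h G)"
proof -
  have "inner (shift y F) G + inner (shift (- y) F) G = inner F (shift y G) + inner F (shift (- y) G)" for y
    by (simp add: inner_shift_left)
  then show ?thesis
    by (simp add: avg_def inner_add_left inner_add_right inner_sum_left inner_sum_right)
qed

lemma inner_avg_pow: "inner ((avg h ^^ m) F) G = inner F ((avg h ^^ m) G)"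
proof (induction m arbitrary: F G)
  case (Suc m)
  then show ?case by (simp add: inner_avg) (simp add: funpow_swap1)
qed simp

lemma norm_avg_le: "norm (avg h (F :: (real^'n::finite) l2)) \<le> norm F"
proof -
  have "norm (\<Sum>j\<in>(UNIV::'n set). shift (h *\<^sub>R axis j 1) F + shift (- (h *\<^sub>R axis j 1)) F) \<le> (\<Sum>j\<in>(UNIV::'n set). 2 * norm F)"
    by (intro sum_norm_le order_trans[OF norm_triangle_ineq]) simp
  then have "norm (avg h F) \<le> (1/2) * norm F + (1 / (4 * real CARD('n))) * (\<Sum>j\<in>(UNIV::'n set). 2 * norm F)"
    unfolding avg_def by (intro order_trans[OF norm_triangle_ineq] add_mono) (auto simp: field_simps)
  then show ?thesis by simp
qed

lemma norm_avg_pow_le: "norm ((avg h ^^ m) F) \<le> norm F"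
  by (induction m) (auto intro: order_trans[OF norm_avg_le])

lemma bounded_linear_avg_pow: "bounded_linear (avg h ^^ m)"
  using linear_avg_pow[of m h] norm_avg_pow_le[of m h]
  by (auto simp: bounded_linear_def bounded_linear_axioms_def linear_linear intro!: exI[of _ 1])

lemma form_sym: "form h m F G = form h m G F"
  unfolding form_def by (metis inner_avg_pow inner_commute)

lemma form_add: "form h m (F + F') G = form h m F G + form h m F' G" "form h m G (F + F') = form h m G F + form h m G F'"
  by (simp_all add: form_def linear_add[OF linear_avg_pow] inner_add_left inner_add_right)

lemma form_diff: "form h m (F - F') G = form h m F G - form h m F' G" "form h m G (F - F') = form h m G F - form h m G F'"
  by (simp_all add: form_def linear_diff[OF linear_avg_pow] inner_diff_left inner_diff_right)

lemma form_scaleR: "form h m (r *\<^sub>R F) G = r * form h m F G" "form h m G (r *\<^sub>R F) = r * form h m G F"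
  by (simp_all add: form_def linear_scale[OF linear_avg_pow])

lemma form_sum: "form h m (\<Sum>j\<in>J. F j) G = (\<Sum>j\<in>J. form h m (F j) G)"
  by (simp add: form_def linear_sum[OF linear_avg_pow] inner_sum_left)

lemma form_shift: "form h m (shift y F) (shift y G) = form h m F G"
  by (simp add: form_def avg_pow_shift)

lemma form_shift_right: "form h m F (shift y G) = form h m (shift (- y) F) G"
  using form_shift[of h m y "shift (- y) F" G] by (simp add: shift_shift)

lemma form_cmul: "form h m (cmul c F) (cmul c F) = (norm c)\<^sup>2 * form h m F F"
  by (simp add: form_def avg_pow_cmul inner_cmul_cmul)

lemma form_Suc: "form h (Suc m) F G = form h m (avg h F) G"
  by (simp add: form_def funpow_swap1)

lemma form_avg_right: "form h m F (avg h G) = form h m (avg h F) G"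
  by (simp add: form_def flip: inner_avg) (simp add: funpow_swap1)

lemma form_avg: "form h m (avg h F) G = form h m F G / 2
    + (\<Sum>j\<in>UNIV. form h m (shift (h *\<^sub>R axis j 1) F) G + form h m (shift (- (h *\<^sub>R axis j 1)) F) G) / (4 * real CARD('n))"
  for F :: "(real^'n::finite) l2"
  unfolding avg_def by (simp add: form_add form_scaleR form_sum)

text \<open>The operator \<open>4 n Q\<close> is the sum over \<open>j\<close> of
  \<open>1 + S_j\<close> composed with its adjoint, \<open>S_j\<close> being the translation by
  \<open>h\<close> along axis \<open>j\<close>. So a claim about \<open>Q^(m+1)\<close> at
  \<open>F\<close> reduces to \<open>Q^m\<close> at the vectors \<open>F + S_j F\<close>, which is
  the induction behind the positivity statements.\<close>

lemma form_step:
  fixes F G :: "(real^'n::finite) l2"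
  shows "form h (Suc m) F G = (\<Sum>j\<in>UNIV. form h m (F + shift (h *\<^sub>R axis j 1) F) (G + shift (h *\<^sub>R axis j 1) G)) / (4 * real CARD('n))"
proof -
  have "form h m (F + shift (h *\<^sub>R axis j 1) F) (G + shift (h *\<^sub>R axis j 1) G)
      = 2 * form h m F G + (form h m (shift (h *\<^sub>R axis j 1) F) G + form h m (shift (- (h *\<^sub>R axis j 1)) F) G)" for j
    by (simp add: form_add form_shift form_shift_right[of h m F])
  then show ?thesis
    by (simp add: form_Suc form_avg sum.distrib add_divide_distrib)
qed

text \<open>The companion of \<open>form_step\<close> for \<open>1 - Q\<close>: the discrete
  Dirichlet form, up to the factor \<open>4 n / h^2\<close>. It gives monotonicity in
  \<open>m\<close> and brings in the difference quotients.\<close>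

lemma form_difference:
  fixes F G :: "(real^'n::finite) l2"
  shows "form h m F G - form h (Suc m) F G
    = (\<Sum>j\<in>UNIV. form h m (shift (h *\<^sub>R axis j 1) F - F) (shift (h *\<^sub>R axis j 1) G - G)) / (4 * real CARD('n))"
proof -
  have "form h m (shift (h *\<^sub>R axis j 1) F - F) (shift (h *\<^sub>R axis j 1) G - G)
      = 2 * form h m F G - (form h m (shift (h *\<^sub>R axis j 1) F) G + form h m (shift (- (h *\<^sub>R axis j 1)) F) G)" for j
    by (simp add: form_diff form_shift form_shift_right[of h m F])
  then show ?thesis
    by (simp add: form_Suc form_avg sum_subtractf diff_divide_distrib)
qed

text \<open>Transfers ellipticity from vectors of numbers to vectors of functions. For
  \<open>m = 0\<close> it is applied pointwise to real and imaginary parts; \<open>form_step\<close>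
  propagates it, since the same shift acts on all components of \<open>G\<close>.\<close>

lemma form_trace:
  fixes c :: "'n::finite \<Rightarrow> 'n \<Rightarrow> real" and G :: "'n \<Rightarrow> (real^'n) l2"
  assumes c: "\<And>\<xi>::real^'n. 0 \<le> (\<Sum>i\<in>UNIV. \<Sum>j\<in>UNIV. c i j * \<xi> $ i * \<xi> $ j)"
  shows "0 \<le> (\<Sum>i\<in>UNIV. \<Sum>j\<in>UNIV. c i j * form h m (G j) (G i))"
proof (induction m arbitrary: G)
  case 0
  define g where "g i = rep_l2 (G i)" for i
  have g: "g i \<in> L2" "G i = abs_l2 (g i)" for i
    by (simp_all add: g_def rep_l2_L2)
  note int = integrable_Re_mult_cnj[OF g(1) g(1)]
  have "0 \<le> (LINT x|lborel. (\<Sum>i\<in>UNIV. \<Sum>j\<in>UNIV. c i j * Re (g j x * cnj (g i x))))"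
  proof (rule integral_nonneg_AE, rule AE_I2)
    fix x
    have "(\<Sum>i\<in>UNIV. \<Sum>j\<in>UNIV. c i j * Re (g j x * cnj (g i x)))
        = (\<Sum>i\<in>UNIV. \<Sum>j\<in>UNIV. c i j * (\<chi> i. Re (g i x)) $ i * (\<chi> i. Re (g i x)) $ j)
        + (\<Sum>i\<in>UNIV. \<Sum>j\<in>UNIV. c i j * (\<chi> i. Im (g i x)) $ i * (\<chi> i. Im (g i x)) $ j)"
      by (simp add: sum.distrib[symmetric] algebra_simps)
    also have "\<dots> \<ge> 0"
      by (intro add_nonneg_nonneg c)
    finally show "0 \<le> (\<Sum>i\<in>UNIV. \<Sum>j\<in>UNIV. c i j * Re (g j x * cnj (g i x)))" .
  qed
  also have "\<dots> = (\<Sum>i\<in>UNIV. \<Sum>j\<in>UNIV. c i j * (LINT x|lborel. Re (g j x * cnj (g i x))))"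
    by (simp only: Bochner_Integration.integral_sum Bochner_Integration.integrable_sum integrable_mult_right int integral_mult_right_zero)
  finally show ?case
    by (simp add: form_def g(2) inner_abs_l2 g(1) del: times_complex.sel)
next
  case (Suc m)
  let ?s = "\<lambda>l i. G i + shift (h *\<^sub>R axis l 1) (G i)"
  have "(\<Sum>i\<in>UNIV. \<Sum>j\<in>UNIV. c i j * form h (Suc m) (G j) (G i))
      = (\<Sum>i\<in>UNIV. \<Sum>j\<in>UNIV. \<Sum>l\<in>UNIV. c i j * form h m (?s l j) (?s l i)) / (4 * real CARD('n))"
    by (simp add: form_step sum_divide_distrib sum_distrib_left)
  also have "(\<Sum>i\<in>UNIV. \<Sum>j\<in>UNIV. \<Sum>l\<in>UNIV. c i j * form h m (?s l j) (?s l i))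
      = (\<Sum>i\<in>UNIV. \<Sum>l\<in>UNIV. \<Sum>j\<in>UNIV. c i j * form h m (?s l j) (?s l i))"
    by (intro sum.cong refl sum.swap)
  also have "\<dots> = (\<Sum>l\<in>UNIV. \<Sum>i\<in>UNIV. \<Sum>j\<in>UNIV. c i j * form h m (?s l j) (?s l i))"
    by (rule sum.swap)
  also have "\<dots> / (4 * real CARD('n)) \<ge> 0"
    by (intro divide_nonneg_nonneg sum_nonneg Suc.IH) auto
  finally show ?case .
qed

lemma form_nonneg: "0 \<le> form h m F F"
proof (induction m arbitrary: F)
  case (Suc m)
  then show ?case
    unfolding form_step by (intro divide_nonneg_nonneg sum_nonneg) auto
qed (simp add: form_def)

lemma form_Suc_le: "form h (Suc m) F F \<le> form h m F F"
proof -
  have "0 \<le> form h m F F - form h (Suc m) F F"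
    unfolding form_difference by (intro divide_nonneg_nonneg sum_nonneg form_nonneg) auto
  then show ?thesis by simp
qed

lemma form_le: "form h m F F \<le> (norm F)\<^sup>2"
proof (induction m)
  case (Suc m)
  then show ?case using form_Suc_le[of h m F] by linarith
qed (simp add: form_def power2_norm_eq_inner)

text \<open>Only semidefiniteness is available, so the discriminant argument divides by whichever
  diagonal value is positive; if both vanish, the signs of \<open>F + G\<close> and
  \<open>F - G\<close> force the mixed value to be 0.\<close>

lemma form_Cauchy_Schwarz: "(form h m F G)\<^sup>2 \<le> form h m F F * form h m G G"
proof -
  define a b c where "a = form h m F F" and "b = form h m F G" and "c = form h m G G"
  have nonneg: "0 \<le> a" "0 \<le> c"
    by (simp_all add: a_def c_def form_nonneg)
  have quad: "0 \<le> x * x * a + 2 * x * y * b + y * y * c" for x y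
    using form_nonneg[of h m "x *\<^sub>R F + y *\<^sub>R G"]
    by (simp add: form_add form_scaleR form_sym[of h m G F] a_def b_def c_def algebra_simps)
  have "b\<^sup>2 \<le> a * c"
  proof (cases "a = 0 \<and> c = 0")
    case True
    then show ?thesis using quad[of 1 1] quad[of 1 "-1"] by simp
  next
    case False
    then consider "0 < a" | "0 < c" using nonneg by force
    then show ?thesis
    proof cases
      case 1
      have "0 \<le> a * (a * c - b\<^sup>2)"
        using quad[of "- b" a] by (simp add: power2_eq_square algebra_simps)
      then show ?thesis using 1 by (simp add: zero_le_mult_iff)
    next
      case 2
      have "0 \<le> c * (a * c - b\<^sup>2)"
        using quad[of c "- b"] by (simp add: power2_eq_square algebra_simps)
      then show ?thesis using 2 by (simp add: zero_le_mult_iff)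
    qed
  qed
  then show ?thesis by (simp add: a_def b_def c_def)
qed

text \<open>Index \<open>m + 1\<close> is the mixed value of \<open>Q F\<close> and \<open>F\<close>
  at index \<open>m\<close>, and \<open>Q F\<close> paired with itself has index
  \<open>m + 2\<close>.\<close>

lemma form_log_convex: "(form h (Suc m) F F)\<^sup>2 \<le> form h m F F * form h (Suc (Suc m)) F F"
  using form_Cauchy_Schwarz[of h m "avg h F" F]
  by (simp add: form_Suc form_avg_right mult.commute)

lemma form_abs_le: "\<bar>form h m F G\<bar> \<le> norm F * norm G"
proof (rule power2_le_imp_le)
  have "(form h m F G)\<^sup>2 \<le> (norm F)\<^sup>2 * (norm G)\<^sup>2"
    by (intro order_trans[OF form_Cauchy_Schwarz] mult_mono form_le form_nonneg) auto
  then show "\<bar>form h m F G\<bar>\<^sup>2 \<le> (norm F * norm G)\<^sup>2"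
    by (simp add: power_mult_distrib)
qed auto

lemma form_abs_diff_le: "\<bar>form h m F F - form h m G G\<bar> \<le> (norm F + norm G) * norm (F - G)"
proof -
  have "form h m F F - form h m G G = form h m (F + G) (F - G)"
    by (simp add: form_add form_diff form_sym[of h m G F])
  also have "\<bar>\<dots>\<bar> \<le> norm (F + G) * norm (F - G)"
    by (rule form_abs_le)
  also have "\<dots> \<le> (norm F + norm G) * norm (F - G)"
    by (intro mult_right_mono norm_triangle_ineq) auto
  finally show ?thesis .
qed

lemma form_deriv:
  assumes "(U has_vector_derivative W) (at t)"
  shows "((\<lambda>t. form h m (U t) (U t)) has_real_derivative 2 * form h m W (U t)) (at t)"
proof -
  have "((\<lambda>t. inner ((avg h ^^ m) (U t)) (U t)) has_vector_derivative
      inner ((avg h ^^ m) (U t)) W + inner ((avg h ^^ m) W) (U t)) (at t)"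
    by (intro bounded_bilinear.has_vector_derivative[OF bounded_bilinear_inner]
        bounded_linear.has_vector_derivative[OF bounded_linear_avg_pow] assms)
  moreover have "inner ((avg h ^^ m) (U t)) W = inner ((avg h ^^ m) W) (U t)"
    using form_sym[of h m "U t" W] by (simp add: form_def)
  ultimately show ?thesis
    by (simp add: form_def has_real_derivative_iff_has_vector_derivative)
qed

lemma continuous_on_form:
  assumes "continuous_on S U" "continuous_on S V"
  shows "continuous_on S (\<lambda>t. form h m (U t) (V t))"
  unfolding form_def
  by (intro continuous_on_inner bounded_linear.continuous_on[OF bounded_linear_avg_pow] assms)

lemma wd_avg_pow:
  assumes "wd i F G"
  shows "wd i ((avg h ^^ m) F) ((avg h ^^ m) G)"
proof (induction m)
  case (Suc m)
  have "wd i (avg h F) (avg h G)" if "wd i F G" for F G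
    unfolding avg_def using that by (intro wd_add wd_scaleR wd_sum wd_shift)
  then show ?case using Suc by simp
qed (simp add: assms)

text \<open>The set where \<open>f < 0\<close> is open and null, hence empty. This extends
  inequalities drawn from the equation from almost every time to all interior times.\<close>

lemma AE_continuous_nonneg:
  fixes f :: "real \<Rightarrow> real"
  assumes S: "open S" and cont: "continuous_on S f" and AE: "AE t in lborel. t \<in> S \<longrightarrow> 0 \<le> f t"
    and t: "t \<in> S"
  shows "0 \<le> f t"
proof (rule ccontr)
  let ?N = "S \<inter> f -` {..<0}"
  assume "\<not> 0 \<le> f t"
  then have ne: "?N \<noteq> {}" using t by auto
  have op: "open ?N"
    using continuous_open_preimage[OF cont S, of "{..<0}"] by simp
  have "AE t in lborel. t \<notin> ?N"
    using AE by (rule AE_mp) (auto intro!: AE_I2)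
  then have "?N \<in> null_sets lborel"
    using op by (subst AE_iff_null_sets) auto
  then have "negligible ?N"
    by (simp add: negligible_iff_null_sets null_sets_completionI)
  then show False
    using open_not_negligible[OF op ne] by simp
qed

section \<open>Interpolation for curves in the Hilbert space\<close>

lemma young:
  fixes x y z e :: real
  assumes "x\<^sup>2 \<le> B\<^sup>2 * (y * z)" "0 \<le> y" "0 \<le> z" "0 < e"
  shows "2 * \<bar>x\<bar> \<le> e * y + B\<^sup>2 / e * z"
proof -
  have "x\<^sup>2 \<le> (e * y) * (B\<^sup>2 / e * z)"
    using assms by (simp add: field_simps)
  then have "\<bar>x\<bar> \<le> sqrt ((e * y) * (B\<^sup>2 / e * z))"
    by (intro real_le_rsqrt) simp
  also have "\<dots> \<le> (e * y + B\<^sup>2 / e * z) / 2"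
    using assms by (intro arith_geo_mean_sqrt) auto
  finally show ?thesis by simp
qed

text \<open>The equation is tested with \<open>Q^m U\<close>, whose weak derivatives are
  \<open>Q^m (G i)\<close>. Young's inequality with weight \<open>kA\<close> charges the first order
  terms with \<open>kA * E\<close>, half of the elliptic gain \<open>2 * kA * E\<close>. This leaves
  the lower speed \<open>kA\<close> and produces the upper speed
  \<open>2 * inverse kA + kA\<close>.\<close>

lemma form_equation_bounds:
  fixes U W :: "(real^'n::finite) l2" and G :: "'n \<Rightarrow> (real^'n) l2" and a :: "'n \<Rightarrow> 'n \<Rightarrow> real"
    and h :: real and m :: nat
  assumes kA: "0 < kA"
    and wd: "\<And>i. wd i U (G i)"
    and ell: "\<And>\<xi>::real^'n. kA * (norm \<xi>)\<^sup>2 \<le> (\<Sum>i\<in>UNIV. \<Sum>j\<in>UNIV. a i j * \<xi> $ i * \<xi> $ j)"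
      "\<And>\<xi>::real^'n. (\<Sum>i\<in>UNIV. \<Sum>j\<in>UNIV. a i j * \<xi> $ i * \<xi> $ j) \<le> inverse kA * (norm \<xi>)\<^sup>2"
    and b: "\<And>i. norm (b i) \<le> kB" and c: "norm c \<le> kC"
    and eq: "\<And>V G'. (\<And>i. wd i V (G' i)) \<Longrightarrow> inner W V = (\<Sum>i\<in>UNIV. \<Sum>j\<in>UNIV. a i j * inner (G j) (G' i))
        - (\<Sum>j\<in>UNIV. inner (cmul (b j) (G j)) V) - inner (cmul c U) V"
  defines "E \<equiv> (\<Sum>j\<in>UNIV. form h m (G j) (G j))"
    and "C \<equiv> real CARD('n) * kB\<^sup>2 / kA + 2 * kC"
  shows "kA * E - C * form h m U U \<le> 2 * form h m W U"
    and "2 * form h m W U \<le> (2 * inverse kA + kA) * E + C * form h m U U"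
proof -
  define A where "A = (\<Sum>i\<in>UNIV. \<Sum>j\<in>UNIV. a i j * form h m (G j) (G i))"
  define X where "X = (\<Sum>j\<in>UNIV. form h m (cmul (b j) (G j)) U)"
  define Y where "Y = form h m (cmul c U) U"
  define q where "q = form h m U U"
  have q: "0 \<le> q" by (simp add: q_def form_nonneg)
  have inner_form: "inner F ((avg h ^^ m) G) = form h m F G" for F G :: "(real^'n) l2"
    by (simp add: form_def inner_avg_pow)
  have main: "2 * form h m W U = 2 * A - 2 * X - 2 * Y"
    using eq[of "(avg h ^^ m) U" "\<lambda>i. (avg h ^^ m) (G i)", OF wd_avg_pow[OF wd]]
    by (simp add: inner_form A_def X_def Y_def)
  \<comment> \<open>Scalar matrices are written as double sums so that \<open>form_trace\<close>
    applies to \<open>a - kA\<close> and to \<open>inverse kA - a\<close>.\<close>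
  have diag: "(\<Sum>i\<in>UNIV. \<Sum>j\<in>UNIV. (if i = j then r else 0) * x i j) = r * (\<Sum>i\<in>UNIV. x i i)" for r :: real and x :: "'n \<Rightarrow> 'n \<Rightarrow> real"
    by (simp add: sum_distrib_left if_distrib[of "\<lambda>z. z * _"] cong: if_cong)
  have norm_eq: "r * (norm \<xi>)\<^sup>2 = (\<Sum>i\<in>UNIV. \<Sum>j\<in>UNIV. (if i = j then r else 0) * (\<xi> $ i * \<xi> $ j))" for r and \<xi> :: "real^'n"
    unfolding diag by (simp add: power2_norm_eq_inner inner_vec_def)
  have E_eq: "r * E = (\<Sum>i\<in>UNIV. \<Sum>j\<in>UNIV. (if i = j then r else 0) * form h m (G j) (G i))" for r
    unfolding diag E_def ..
  have A_low: "kA * E \<le> A"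
  proof -
    have "0 \<le> (\<Sum>i\<in>UNIV. \<Sum>j\<in>UNIV. (a i j - (if i = j then kA else 0)) * form h m (G j) (G i))"
    proof (rule form_trace)
      fix \<xi> :: "real^'n"
      show "0 \<le> (\<Sum>i\<in>UNIV. \<Sum>j\<in>UNIV. (a i j - (if i = j then kA else 0)) * \<xi> $ i * \<xi> $ j)"
        using ell(1)[of \<xi>] unfolding norm_eq by (simp only: left_diff_distrib sum_subtractf mult.assoc diff_ge_0_iff_ge)
    qed
    then show ?thesis
      unfolding E_eq A_def by (simp only: left_diff_distrib sum_subtractf diff_ge_0_iff_ge)
  qed
  have A_up: "A \<le> inverse kA * E"
  proof -
    have "0 \<le> (\<Sum>i\<in>UNIV. \<Sum>j\<in>UNIV. ((if i = j then inverse kA else 0) - a i j) * form h m (G j) (G i))"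
    proof (rule form_trace)
      fix \<xi> :: "real^'n"
      show "0 \<le> (\<Sum>i\<in>UNIV. \<Sum>j\<in>UNIV. ((if i = j then inverse kA else 0) - a i j) * \<xi> $ i * \<xi> $ j)"
        using ell(2)[of \<xi>] unfolding norm_eq by (simp only: left_diff_distrib sum_subtractf mult.assoc diff_ge_0_iff_ge)
    qed
    then show ?thesis
      unfolding E_eq A_def by (simp only: left_diff_distrib sum_subtractf diff_ge_0_iff_ge)
  qed
  have X: "2 * \<bar>X\<bar> \<le> kA * E + real CARD('n) * kB\<^sup>2 / kA * q"
  proof -
    have "2 * \<bar>form h m (cmul (b j) (G j)) U\<bar> \<le> kA * form h m (G j) (G j) + kB\<^sup>2 / kA * q" for j
    proof (rule young[OF _ form_nonneg q kA])
      have "(form h m (cmul (b j) (G j)) U)\<^sup>2 \<le> (norm (b j))\<^sup>2 * (form h m (G j) (G j) * q)"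
        using form_Cauchy_Schwarz[of h m "cmul (b j) (G j)" U] by (simp add: form_cmul q_def mult.assoc)
      also have "\<dots> \<le> kB\<^sup>2 * (form h m (G j) (G j) * q)"
        using b[of j] by (intro mult_right_mono power_mono mult_nonneg_nonneg form_nonneg q) auto
      finally show "(form h m (cmul (b j) (G j)) U)\<^sup>2 \<le> kB\<^sup>2 * (form h m (G j) (G j) * q)" .
    qed
    then have "(\<Sum>j\<in>UNIV. 2 * \<bar>form h m (cmul (b j) (G j)) U\<bar>) \<le> (\<Sum>j\<in>(UNIV::'n set). kA * form h m (G j) (G j) + kB\<^sup>2 / kA * q)"
      by (rule sum_mono)
    also have "\<dots> = kA * E + real CARD('n) * kB\<^sup>2 / kA * q"
      by (simp add: E_def sum.distrib sum_distrib_left)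
    finally have "2 * (\<Sum>j\<in>UNIV. \<bar>form h m (cmul (b j) (G j)) U\<bar>) \<le> kA * E + real CARD('n) * kB\<^sup>2 / kA * q"
      by (simp only: sum_distrib_left)
    moreover have "\<bar>X\<bar> \<le> (\<Sum>j\<in>UNIV. \<bar>form h m (cmul (b j) (G j)) U\<bar>)"
      unfolding X_def by (rule sum_abs)
    ultimately show ?thesis by linarith
  qed
  have Y: "\<bar>Y\<bar> \<le> kC * q"
  proof (rule power2_le_imp_le)
    have "Y\<^sup>2 \<le> (norm c)\<^sup>2 * (q * q)"
      using form_Cauchy_Schwarz[of h m "cmul c U" U] by (simp add: form_cmul q_def Y_def mult.assoc)
    also have "\<dots> \<le> kC\<^sup>2 * (q * q)"
      using c by (intro mult_right_mono power_mono) auto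
    finally show "\<bar>Y\<bar>\<^sup>2 \<le> (kC * q)\<^sup>2"
      by (simp add: power2_eq_square mult_ac)
    show "0 \<le> kC * q"
      using q order_trans[OF norm_ge_zero c] by simp
  qed
  have C: "C * q = real CARD('n) * kB\<^sup>2 / kA * q + 2 * (kC * q)"
    by (simp add: C_def algebra_simps)
  show "kA * E - C * form h m U U \<le> 2 * form h m W U"
    using A_low X Y C unfolding main q_def[symmetric] by linarith
  have "(2 * inverse kA + kA) * E = 2 * (inverse kA * E) + kA * E"
    by (simp add: algebra_simps)
  then show "2 * form h m W U \<le> (2 * inverse kA + kA) * E + C * form h m U U"
    using A_up X Y C unfolding main q_def[symmetric] by linarith
qed

text \<open>The mesh \<open>h\<close>, and with it \<open>N\<close>, depends on the accuracy
  \<open>\<eta>\<close>, but the estimate for a fixed mesh contains neither, only the error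
  \<open>\<delta>\<close>. Hence \<open>\<eta>\<close> may tend to 0 at the end.\<close>

lemma l2_interpolation:
  fixes U W :: "real \<Rightarrow> (real^'n::finite) l2" and G :: "'n \<Rightarrow> real \<Rightarrow> (real^'n) l2" and a :: "'n \<Rightarrow> 'n \<Rightarrow> real \<Rightarrow> real"
  assumes t: "0 \<le> t\<^sub>1" "t\<^sub>1 \<le> t\<^sub>2" "0 < t\<^sub>2" "t\<^sub>2 < \<tau>" and kA: "0 < kA" "kA < 1"
    and cont: "continuous_on {0..\<tau>} U" "continuous_on {0..\<tau>} W" "\<And>i. continuous_on {0..\<tau>} (G i)"
    and deriv: "\<And>t. t \<in> {0<..<\<tau>} \<Longrightarrow> (U has_vector_derivative W t) (at t)"
    and wd: "\<And>i t. t \<in> {0..\<tau>} \<Longrightarrow> wd i (U t) (G i t)"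
    and ell: "\<And>t (\<xi>::real^'n). t \<in> {0..\<tau>} \<Longrightarrow> kA * (norm \<xi>)\<^sup>2 \<le> (\<Sum>i\<in>UNIV. \<Sum>j\<in>UNIV. a i j t * \<xi> $ i * \<xi> $ j)"
      "\<And>t (\<xi>::real^'n). t \<in> {0..\<tau>} \<Longrightarrow> (\<Sum>i\<in>UNIV. \<Sum>j\<in>UNIV. a i j t * \<xi> $ i * \<xi> $ j) \<le> inverse kA * (norm \<xi>)\<^sup>2"
    and b: "\<And>i t. t \<in> {0..\<tau>} \<Longrightarrow> norm (b i t) \<le> kB" and c: "\<And>t. t \<in> {0..\<tau>} \<Longrightarrow> norm (c t) \<le> kC"
    and eq: "AE t in lborel. t \<in> {0<..<\<tau>} \<longrightarrow> (\<forall>V G'. (\<forall>i. wd i V (G' i)) \<longrightarrow>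
        inner (W t) V = (\<Sum>i\<in>UNIV. \<Sum>j\<in>UNIV. a i j t * inner (G j t) (G' i))
          - (\<Sum>j\<in>UNIV. inner (cmul (b j t) (G j t)) V) - inner (cmul (c t) (U t)) V)"
    and bound: "\<And>t. t \<in> {0..\<tau>} \<Longrightarrow> norm (U t) \<le> D"
  defines "C \<equiv> real CARD('n) * kB\<^sup>2 / kA + 2 * kC"
    and "K \<equiv> 2 * inverse kA + kA"
  defines "l \<equiv> kA * (\<tau> - t\<^sub>2) / (K * \<tau>)"
  shows "(norm (U t\<^sub>1))\<^sup>2 \<le> exp (C * \<tau>) * ((D\<^sup>2) powr (1 - l) * (exp (C * \<tau>) * (norm (U 0))\<^sup>2) powr l)"
proof -
  have \<tau>: "0 < \<tau>" using t by simp
  have kC: "0 \<le> kC" using order_trans[OF norm_ge_zero c[of 0]] \<tau> by simp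
  have C: "0 \<le> C" using kA kC by (simp add: C_def)
  have K: "kA \<le> K" "0 < K" using kA by (simp_all add: K_def add_pos_pos)
  have l: "0 < l" using t kA K \<tau> by (simp add: l_def)
  obtain M where M: "\<And>i t. t \<in> {0..\<tau>} \<Longrightarrow> norm (G i t) \<le> M" "0 \<le> M"
  proof -
    have "\<exists>M. \<forall>t\<in>{0..\<tau>}. norm (G i t) \<le> M" for i
      using compact_imp_bounded[OF compact_continuous_image[OF cont(3)[of i] compact_Icc]] by (auto simp: bounded_iff)
    then obtain M where M: "\<And>i t. t \<in> {0..\<tau>} \<Longrightarrow> norm (G i t) \<le> M i"
      by metis
    show thesis
    proof (rule that[of "\<Sum>i\<in>UNIV. \<bar>M i\<bar>"])
      fix i t assume "t \<in> {0..\<tau>}"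
      then have "norm (G i t) \<le> \<bar>M i\<bar>" using M[of t i] by simp
      also have "\<dots> \<le> (\<Sum>i\<in>UNIV. \<bar>M i\<bar>)" by (rule member_le_sum) auto
      finally show "norm (G i t) \<le> (\<Sum>i\<in>UNIV. \<bar>M i\<bar>)" .
    qed (simp add: sum_nonneg)
  qed
  have step: "(norm (U t\<^sub>1))\<^sup>2 \<le> exp (C * \<tau>) * ((D\<^sup>2) powr (1 - l) * (exp (C * \<tau>) * ((norm (U 0))\<^sup>2 + \<delta> * \<tau>)) powr l + \<delta> * \<tau>)"
    if \<eta>: "0 < \<eta>" and \<delta>: "\<delta> = K * (real CARD('n) * ((2 * M + \<eta>) * \<eta>))" for \<eta> \<delta>
  proof -
    \<comment> \<open>One mesh serves all directions and all times at once.\<close>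
    have "eventually (\<lambda>h. \<forall>i\<in>(UNIV::'n set). \<forall>t\<in>{0..\<tau>}. norm (shift (h *\<^sub>R axis i 1) (U t) - U t - h *\<^sub>R G i t) \<le> \<bar>h\<bar> * \<eta>) (at 0)"
      by (intro eventually_ball_finite ballI wd_difference_quotient_uniform wd cont \<eta>) auto
    then have "eventually (\<lambda>h. h \<noteq> 0 \<and> (\<forall>i\<in>(UNIV::'n set). \<forall>t\<in>{0..\<tau>}. norm (shift (h *\<^sub>R axis i 1) (U t) - U t - h *\<^sub>R G i t) \<le> \<bar>h\<bar> * \<eta>)) (at 0)"
      by (intro eventually_conj eventually_neq_at_within)
    from eventually_happens'[OF at_neq_bot this] obtain h where h: "h \<noteq> 0" "\<And>i t. t \<in> {0..\<tau>} \<Longrightarrow> norm (shift (h *\<^sub>R axis i 1) (U t) - U t - h *\<^sub>R G i t) \<le> \<bar>h\<bar> * \<eta>"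
      by blast
    define q where "q m t = form h m (U t) (U t)" for m t
    define q' where "q' m t = 2 * form h m (W t) (U t)" for m t
    define E where "E m t = (\<Sum>j\<in>UNIV. form h m (G j t) (G j t))" for m t
    define N where "N = 4 * real CARD('n) / h\<^sup>2"
    have \<delta>0: "0 \<le> real CARD('n) * ((2 * M + \<eta>) * \<eta>)" using M(2) \<eta> by auto
    \<comment> \<open>Energy of difference quotients against energy of weak derivatives. The vectors
      have norms at most \<open>M + \<eta>\<close> and \<open>M\<close> and differ by at most
      \<open>\<eta>\<close>, whence \<open>(2 * M + \<eta>) * \<eta>\<close> per direction; the form
      is bounded by the norms for every \<open>m\<close>, so this is uniform in
      \<open>m\<close>.\<close>
    have NE: "\<bar>N * (q m t - q (Suc m) t) - E m t\<bar> \<le> real CARD('n) * ((2 * M + \<eta>) * \<eta>)" if t: "t \<in> {0..\<tau>}" for m t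
    proof -
      define Dj where "Dj j = (1 / h) *\<^sub>R (shift (h *\<^sub>R axis j 1) (U t) - U t)" for j
      have Dj_eq: "Dj j - G j t = (1 / h) *\<^sub>R (shift (h *\<^sub>R axis j 1) (U t) - U t - h *\<^sub>R G j t)" for j
        using h(1) by (simp add: Dj_def scaleR_diff_right)
      have Dj: "norm (Dj j - G j t) \<le> \<eta>" for j
        using h(2)[OF t, of j] h(1) unfolding Dj_eq norm_scaleR by (simp add: divide_simps mult.commute)
      have "N * (q m t - q (Suc m) t) = (\<Sum>j\<in>UNIV. form h m (Dj j) (Dj j))"
        using h(1) unfolding q_def form_difference
        by (simp add: N_def Dj_def form_scaleR sum_distrib_left sum_divide_distrib power2_eq_square)
      then have "N * (q m t - q (Suc m) t) - E m t = (\<Sum>j\<in>UNIV. form h m (Dj j) (Dj j) - form h m (G j t) (G j t))"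
        by (simp add: E_def sum_subtractf)
      also have "\<bar>\<dots>\<bar> \<le> (\<Sum>j\<in>(UNIV::'n set). (2 * M + \<eta>) * \<eta>)"
      proof (rule order_trans[OF sum_abs sum_mono])
        fix j
        have "norm (Dj j) \<le> M + \<eta>"
          using norm_triangle_ineq[of "Dj j - G j t" "G j t"] Dj[of j] M(1)[OF t, of j] by simp
        then show "\<bar>form h m (Dj j) (Dj j) - form h m (G j t) (G j t)\<bar> \<le> (2 * M + \<eta>) * \<eta>"
          using M Dj t \<eta> by (intro order_trans[OF form_abs_diff_le] mult_mono) (auto simp: add_mono intro: order_trans[OF add_mono])
      qed
      finally show ?thesis by simp
    qed
    have q_nonneg: "0 \<le> q m t" for m t
      by (simp add: q_def form_nonneg)
    have contq: "continuous_on {0..\<tau>} (q m)" for m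
      unfolding q_def by (intro continuous_on_form cont)
    have contq': "continuous_on {0<..<\<tau>} (q' m)" for m
      unfolding q'_def
      by (intro continuous_intros continuous_on_form) (auto intro: continuous_on_subset[OF cont(1)] continuous_on_subset[OF cont(2)])
    have contq1: "continuous_on {0<..<\<tau>} (q m)" for m
      by (rule continuous_on_subset[OF contq]) auto
    have ae: "AE t in lborel. t \<in> {0<..<\<tau>} \<longrightarrow>
        q' m t \<le> K * N * (q m t - q (Suc m) t) + C * q m t + \<delta> \<and>
        kA * N * (q m t - q (Suc m) t) - C * q m t - \<delta> \<le> q' m t" for m
      using eq
    proof (rule AE_mp, intro AE_I2 impI)
      fix t assume ev: "t \<in> {0<..<\<tau>} \<longrightarrow> (\<forall>V G'. (\<forall>i. wd i V (G' i)) \<longrightarrow>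
        inner (W t) V = (\<Sum>i\<in>UNIV. \<Sum>j\<in>UNIV. a i j t * inner (G j t) (G' i))
          - (\<Sum>j\<in>UNIV. inner (cmul (b j t) (G j t)) V) - inner (cmul (c t) (U t)) V)"
        and "t \<in> {0<..<\<tau>}"
      then have t: "t \<in> {0..\<tau>}" by simp
      have eq_t: "inner (W t) V = (\<Sum>i\<in>UNIV. \<Sum>j\<in>UNIV. a i j t * inner (G j t) (G' i))
          - (\<Sum>j\<in>UNIV. inner (cmul (b j t) (G j t)) V) - inner (cmul (c t) (U t)) V"
        if "\<And>i. wd i V (G' i)" for V G'
        using ev \<open>t \<in> {0<..<\<tau>}\<close> that by blast
      note bounds = form_equation_bounds[where a = "\<lambda>i j. a i j t" and b = "\<lambda>i. b i t" and c = "c t",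
          OF kA(1) wd[OF t] ell(1)[OF t] ell(2)[OF t] b[OF t] c[OF t] eq_t]
      have low: "kA * E m t - C * q m t \<le> q' m t" and up: "q' m t \<le> K * E m t + C * q m t"
        unfolding E_def C_def q_def q'_def K_def by (rule bounds; assumption)+
      have "K * E m t \<le> K * (N * (q m t - q (Suc m) t) + real CARD('n) * ((2 * M + \<eta>) * \<eta>))"
        using NE[OF t, of m] K by (intro mult_left_mono) auto
      moreover have "kA * (N * (q m t - q (Suc m) t) - real CARD('n) * ((2 * M + \<eta>) * \<eta>)) \<le> kA * E m t"
        using NE[OF t, of m] kA by (intro mult_left_mono) auto
      \<comment> \<open>\<open>\<delta>\<close> is scaled by the larger speed \<open>K\<close>, so
        it also covers the error in the lower inequality.\<close>
      moreover have "kA * (real CARD('n) * ((2 * M + \<eta>) * \<eta>)) \<le> \<delta>"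
        unfolding \<delta> by (rule mult_right_mono[OF K(1) \<delta>0])
      ultimately show "q' m t \<le> K * N * (q m t - q (Suc m) t) + C * q m t + \<delta> \<and>
          kA * N * (q m t - q (Suc m) t) - C * q m t - \<delta> \<le> q' m t"
        using low up unfolding \<delta>[symmetric] distrib_left right_diff_distrib by (simp add: mult.assoc)
    qed
    have up: "q' m t \<le> K * N * (q m t - q (Suc m) t) + C * q m t + \<delta>" if "t \<in> {0<..<\<tau>}" for m t
    proof -
      have "0 \<le> K * N * (q m t - q (Suc m) t) + C * q m t + \<delta> - q' m t"
      proof (rule AE_continuous_nonneg[where f = "\<lambda>t. K * N * (q m t - q (Suc m) t) + C * q m t + \<delta> - q' m t", OF _ _ _ that])
        show "continuous_on {0<..<\<tau>} (\<lambda>t. K * N * (q m t - q (Suc m) t) + C * q m t + \<delta> - q' m t)"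
          by (intro continuous_intros contq' contq1)
        show "AE t in lborel. t \<in> {0<..<\<tau>} \<longrightarrow> 0 \<le> K * N * (q m t - q (Suc m) t) + C * q m t + \<delta> - q' m t"
          by (rule eventually_mono[OF ae[of m]]) simp
      qed simp
      then show ?thesis by simp
    qed
    have low: "kA * N * (q m t - q (Suc m) t) - C * q m t - \<delta> \<le> q' m t" if "t \<in> {0<..<\<tau>}" for m t
    proof -
      have "0 \<le> q' m t - (kA * N * (q m t - q (Suc m) t) - C * q m t - \<delta>)"
      proof (rule AE_continuous_nonneg[where f = "\<lambda>t. q' m t - (kA * N * (q m t - q (Suc m) t) - C * q m t - \<delta>)", OF _ _ _ that])
        show "continuous_on {0<..<\<tau>} (\<lambda>t. q' m t - (kA * N * (q m t - q (Suc m) t) - C * q m t - \<delta>))"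
          by (intro continuous_intros contq' contq1)
        show "AE t in lborel. t \<in> {0<..<\<tau>} \<longrightarrow> 0 \<le> q' m t - (kA * N * (q m t - q (Suc m) t) - C * q m t - \<delta>)"
          by (rule eventually_mono[OF ae[of m]]) simp
      qed simp
      then show ?thesis by simp
    qed
    have "q 0 t\<^sub>1 \<le> exp (C * \<tau>) * ((D\<^sup>2) powr (1 - l) * (exp (C * \<tau>) * (q 0 0 + \<delta> * \<tau>)) powr l + \<delta> * \<tau>)"
    proof (rule interpolation_in_time[where q = q and q' = q' and N = N and \<delta> = \<delta>, OF t _ kA(1) K(1) C _ contq _ q_nonneg _ _ up low _ l_def[THEN meta_eq_to_obj_eq]])
      show "0 \<le> N" by (simp add: N_def)
      show "0 \<le> \<delta>" unfolding \<delta> using K \<delta>0 by simp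
      show "(q m has_real_derivative q' m t) (at t)" if "t \<in> {0<..<\<tau>}" for m t
        unfolding q_def q'_def by (rule form_deriv[OF deriv[OF that]])
      show "q (Suc m) t \<le> q m t" for m t
        by (simp add: q_def form_Suc_le)
      show "(q (Suc m) t)\<^sup>2 \<le> q m t * q (Suc (Suc m)) t" for m t
        unfolding q_def by (rule form_log_convex)
      show "q 0 t \<le> D\<^sup>2" if "t \<in> {0..\<tau>}" for t
        using bound[OF that] by (simp add: q_def form_def power2_norm_eq_inner[symmetric] power_mono)
    qed
    then show ?thesis
      by (simp add: q_def form_def power2_norm_eq_inner)
  qed
  define \<eta> where "\<eta> k = inverse (real (Suc k))" for k
  have \<eta>: "\<eta> \<longlonglongrightarrow> 0"
    unfolding \<eta>_def[abs_def] by (rule LIMSEQ_inverse_real_of_nat)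
  define \<delta> where "\<delta> k = K * (real CARD('n) * ((2 * M + \<eta> k) * \<eta> k))" for k
  have "\<delta> \<longlonglongrightarrow> K * (real CARD('n) * ((2 * M + 0) * 0))"
    unfolding \<delta>_def[abs_def] by (intro tendsto_intros \<eta>)
  then have \<delta>: "\<delta> \<longlonglongrightarrow> 0" by simp
  have \<delta>_nonneg: "0 \<le> \<delta> k" for k
    using M(2) K by (simp add: \<delta>_def \<eta>_def)
  \<comment> \<open>The initial value may vanish, so continuity of \<open>powr\<close> is needed at
    base 0; it holds there since \<open>l\<close> is positive and the bases are nonnegative.\<close>
  have "(\<lambda>k. exp (C * \<tau>) * ((D\<^sup>2) powr (1 - l) * (exp (C * \<tau>) * ((norm (U 0))\<^sup>2 + \<delta> k * \<tau>)) powr l + \<delta> k * \<tau>))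
      \<longlonglongrightarrow> exp (C * \<tau>) * ((D\<^sup>2) powr (1 - l) * (exp (C * \<tau>) * ((norm (U 0))\<^sup>2 + 0 * \<tau>)) powr l + 0 * \<tau>)"
    using l \<tau> \<delta>_nonneg by (intro tendsto_intros tendsto_powr2 \<delta>) (auto intro!: always_eventually)
  then have "(norm (U t\<^sub>1))\<^sup>2 \<le> exp (C * \<tau>) * ((D\<^sup>2) powr (1 - l) * (exp (C * \<tau>) * ((norm (U 0))\<^sup>2 + 0 * \<tau>)) powr l + 0 * \<tau>)"
  proof (rule LIMSEQ_le_const)
    have "(norm (U t\<^sub>1))\<^sup>2 \<le> exp (C * \<tau>) * ((D\<^sup>2) powr (1 - l) * (exp (C * \<tau>) * ((norm (U 0))\<^sup>2 + \<delta> k * \<tau>)) powr l + \<delta> k * \<tau>)" for k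
      by (rule step[where \<eta> = "\<eta> k", OF _ \<delta>_def]) (simp add: \<eta>_def)
    then show "\<exists>n. \<forall>k\<ge>n. (norm (U t\<^sub>1))\<^sup>2 \<le> exp (C * \<tau>) * ((D\<^sup>2) powr (1 - l) * (exp (C * \<tau>) * ((norm (U 0))\<^sup>2 + \<delta> k * \<tau>)) powr l + \<delta> k * \<tau>)"
      by blast
  qed
  then show ?thesis by simp
qed

section \<open>Solutions of the equation\<close>

lemma has_L2_derivative_imp:
  assumes deriv: "has_L2_derivative u w t I" and L2: "\<And>s. s \<in> I \<Longrightarrow> u s \<in> L2" and t: "t \<in> I"
  shows "((\<lambda>s. abs_l2 (u s)) has_vector_derivative abs_l2 w) (at t within I)"
proof -
  have w: "w \<in> L2" and lim: "((\<lambda>s. L2_norm (\<lambda>x. (u s x - u t x) / complex_of_real (s - t) - w x)) \<longlongrightarrow> 0) (at t within I)"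
    using deriv by (auto simp: has_L2_derivative_def)
  \<comment> \<open>The remainder of a derivative is divided by \<open>norm (s - t)\<close> instead
    of \<open>s - t\<close>; the sign is lost in the norm.\<close>
  have eq: "norm ((1 / norm (s - t)) *\<^sub>R (abs_l2 (u s) - (abs_l2 (u t) + (s - t) *\<^sub>R abs_l2 w)))
      = L2_norm (\<lambda>x. (u s x - u t x) / complex_of_real (s - t) - w x)" if "s \<in> I" "s \<noteq> t" for s
  proof -
    let ?f = "\<lambda>x. (1 / (s - t)) *\<^sub>R (u s x - u t x) - w x"
    have "(\<lambda>x. (u s x - u t x) / complex_of_real (s - t) - w x) = ?f"
      by (rule ext) (simp add: scaleR_conv_of_real)
    moreover have "?f \<in> L2"
      using that t by (intro L2_diff L2_scaleR L2 w)
    moreover have "abs_l2 ?f = (1 / (s - t)) *\<^sub>R (abs_l2 (u s) - abs_l2 (u t)) - abs_l2 w"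
      using that t by (simp only: abs_l2_diff abs_l2_scaleR L2_diff L2_scaleR L2 w)
    moreover have "(1 / (s - t)) *\<^sub>R (abs_l2 (u s) - (abs_l2 (u t) + (s - t) *\<^sub>R abs_l2 w))
        = (1 / (s - t)) *\<^sub>R (abs_l2 (u s) - abs_l2 (u t)) - abs_l2 w"
      using that by (simp add: scaleR_diff_right scaleR_add_right diff_diff_eq)
    ultimately have "L2_norm (\<lambda>x. (u s x - u t x) / complex_of_real (s - t) - w x)
        = norm ((1 / (s - t)) *\<^sub>R (abs_l2 (u s) - (abs_l2 (u t) + (s - t) *\<^sub>R abs_l2 w)))"
      by (simp add: norm_abs_l2[symmetric])
    then show ?thesis by simp
  qed
  have "((\<lambda>s. norm ((1 / norm (s - t)) *\<^sub>R (abs_l2 (u s) - (abs_l2 (u t) + (s - t) *\<^sub>R abs_l2 w)))) \<longlongrightarrow> 0) (at t within I)"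
    by (rule Lim_transform_eventually[OF lim]) (unfold eventually_at_filter, intro always_eventually allI impI eq[symmetric])
  then show ?thesis
    unfolding has_vector_derivative_def has_derivative_within
    by (auto intro: bounded_linear_scaleR_left tendsto_norm_zero_cancel)
qed

lemma cont_into_L2_imp:
  assumes "cont_into I L2 L2_norm u"
  shows "continuous_on I (\<lambda>t. abs_l2 (u t))"
  unfolding continuous_on_def
proof
  fix t assume t: "t \<in> I"
  have L2: "u s \<in> L2" if "s \<in> I" for s
    using assms that by (auto simp: cont_into_def)
  have lim: "((\<lambda>s. L2_norm (\<lambda>x. u s x - u t x)) \<longlongrightarrow> 0) (at t within I)"
    using assms t by (auto simp: cont_into_def)
  have "((\<lambda>s. norm (abs_l2 (u s) - abs_l2 (u t))) \<longlongrightarrow> 0) (at t within I)"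
    by (rule Lim_transform_eventually[OF lim])
       (auto simp: eventually_at_filter norm_abs_l2[symmetric] abs_l2_diff L2_diff L2 t)
  then show "((\<lambda>t. abs_l2 (u t)) \<longlongrightarrow> abs_l2 (u t)) (at t within I)"
    by (rule LIM_zero_cancel[OF tendsto_norm_zero_cancel])
qed

text \<open>\<open>wpd\<close> picks some representative; uniqueness of weak derivatives makes its
  class well defined.\<close>

lemma wpd_eqI:
  assumes "f \<in> L2" "g \<in> L2" "weak_pd i f g"
  shows "wpd i f \<in> L2" "abs_l2 (wpd i f) = abs_l2 g"
proof -
  have "wpd i f \<in> L2 \<and> weak_pd i f (wpd i f)"
    unfolding wpd_def by (rule someI[of _ g]) (use assms in auto)
  then show "wpd i f \<in> L2" "abs_l2 (wpd i f) = abs_l2 g"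
    using wd_unique[of i "abs_l2 f"] assms by (auto simp: weak_pd_iff_wd)
qed

lemma H1_wpd:
  assumes "f \<in> H1"
  shows "f \<in> L2" "wpd i f \<in> L2" "wd i (abs_l2 f) (abs_l2 (wpd i f))"
proof -
  obtain g where g: "g \<in> L2" "weak_pd i f g" and f: "f \<in> L2"
    using assms by (auto simp: H1_def)
  then show "f \<in> L2" "wpd i f \<in> L2" "wd i (abs_l2 f) (abs_l2 (wpd i f))"
    using wpd_eqI[OF f g] by (auto simp: weak_pd_iff_wd)
qed

lemma cont_into_H1_imp:
  fixes u :: "real \<Rightarrow> real^'n::finite \<Rightarrow> complex"
  assumes "cont_into I H1 H1_norm u"
  shows "continuous_on I (\<lambda>t. abs_l2 (wpd i (u t)))"
  unfolding continuous_on_def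
proof
  fix t assume t: "t \<in> I"
  have H1: "u s \<in> H1" if "s \<in> I" for s
    using assms that by (auto simp: cont_into_def)
  have lim: "((\<lambda>s. H1_norm (\<lambda>x. u s x - u t x)) \<longlongrightarrow> 0) (at t within I)"
    using assms t by (auto simp: cont_into_def)
  have "((\<lambda>s. norm (abs_l2 (wpd i (u s)) - abs_l2 (wpd i (u t)))) \<longlongrightarrow> 0) (at t within I)"
  proof (rule tendsto_0_le[OF lim])
    have "norm (abs_l2 (wpd i (u s)) - abs_l2 (wpd i (u t))) \<le> H1_norm (\<lambda>x. u s x - u t x)" if "s \<in> I" for s
    proof -
      let ?f = "\<lambda>x. u s x - u t x" and ?g = "\<lambda>x. wpd i (u s) x - wpd i (u t) x"
      have L2: "?f \<in> L2" "?g \<in> L2"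
        using H1_wpd[OF H1[OF that]] H1_wpd[OF H1[OF t]] by (auto intro: L2_diff)
      \<comment> \<open>\<open>wpd\<close> is linear only up to null sets: the difference of the
        chosen derivatives is a weak derivative of the difference, and \<open>wpd_eqI\<close>
        identifies the classes.\<close>
      have "weak_pd i ?f ?g"
        using H1_wpd[OF H1[OF that]] H1_wpd[OF H1[OF t]]
        by (simp add: weak_pd_iff_wd L2 abs_l2_diff wd_diff)
      from wpd_eqI[OF L2 this]
      have "norm (abs_l2 (wpd i (u s)) - abs_l2 (wpd i (u t))) = L2_norm (wpd i ?f)"
        using H1_wpd[OF H1[OF that]] H1_wpd[OF H1[OF t]]
        by (simp add: norm_abs_l2[symmetric] abs_l2_diff)
      also have "\<dots> \<le> H1_norm ?f"
      proof -
        have "(L2_norm (wpd i ?f))\<^sup>2 \<le> (\<Sum>i\<in>UNIV. (L2_norm (wpd i ?f))\<^sup>2)"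
          by (rule member_le_sum) auto
        then have "(L2_norm (wpd i ?f))\<^sup>2 \<le> (L2_norm ?f)\<^sup>2 + (\<Sum>i\<in>UNIV. (L2_norm (wpd i ?f))\<^sup>2)"
          by (rule add_increasing[OF zero_le_power2])
        then show ?thesis
          unfolding H1_norm_def by (rule real_le_rsqrt)
      qed
      finally show ?thesis .
    qed
    then show "eventually (\<lambda>s. norm (norm (abs_l2 (wpd i (u s)) - abs_l2 (wpd i (u t)))) \<le> norm (H1_norm (\<lambda>x. u s x - u t x)) * 1) (at t within I)"
      by (auto simp: eventually_at_filter intro!: always_eventually order_trans[OF _ abs_ge_self])
  qed
  then show "((\<lambda>t. abs_l2 (wpd i (u t))) \<longlongrightarrow> abs_l2 (wpd i (u t))) (at t within I)"
    by (rule LIM_zero_cancel[OF tendsto_norm_zero_cancel])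
qed

lemma weak_pd_cnj:
  assumes "weak_pd i f g"
  shows "weak_pd i (\<lambda>x. cnj (f x)) (\<lambda>x. cnj (g x))"
  unfolding weak_pd_def
proof (intro allI impI)
  fix \<phi> :: "real^'a \<Rightarrow> complex" assume \<phi>: "test_function \<phi>"
  have "(LINT x|lborel. cnj (cnj (f x) * pd i \<phi> x)) = - (LINT x|lborel. cnj (cnj (g x) * \<phi> x))"
    using assms[unfolded weak_pd_def, rule_format, OF test_function_cnj(1)[OF \<phi>]]
    by (simp add: test_function_cnj(2)[OF \<phi>])
  then have "cnj (LINT x|lborel. cnj (f x) * pd i \<phi> x) = cnj (- (LINT x|lborel. cnj (g x) * \<phi> x))"
    by (simp del: complex_cnj_mult)
  then show "(LINT x|lborel. cnj (f x) * pd i \<phi> x) = - (LINT x|lborel. cnj (g x) * \<phi> x)"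
    by (simp only: complex_cnj_cancel_iff)
qed

lemma Re_integral_mult:
  assumes f: "f \<in> L2" and g: "g \<in> L2" "AE x in lborel. g x = cnj (rep_l2 V x)"
  shows "Re (LINT x|lborel. f x * g x) = inner (abs_l2 f) V"
proof -
  have "(LINT x|lborel. f x * g x) = (LINT x|lborel. f x * cnj (rep_l2 V x))"
  proof (rule integral_cong_AE)
    show "AE x in lborel. f x * g x = f x * cnj (rep_l2 V x)"
      using g(2) by (rule AE_mp) simp
  qed (use borel_measurable_integrable[OF L2_mult_integrable[OF f g(1)]]
        borel_measurable_integrable[OF L2_mult_integrable[OF f L2_cnj[OF rep_l2_L2]]] in auto)
  then show ?thesis
    using inner_abs_l2_Re[OF f rep_l2_L2, of V] by simp
qed

text \<open>\<open>L_op\<close> pairs bilinearly, whereas \<open>inner\<close> takes a real part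
  after conjugation. So the test element is the conjugate of a representative of \<open>V\<close>,
  and the real part of the equation is the identity that \<open>l2_interpolation\<close>
  expects.\<close>

lemma L_op_inner:
  fixes u :: "real \<Rightarrow> real^'n::finite \<Rightarrow> complex"
  assumes u: "u t \<in> H1" and dt: "dt T u t \<in> L2"
    and eq: "\<And>v. v \<in> H1 \<Longrightarrow> L_op a b c T u t v = 0"
    and V: "\<And>i. wd i V (G' i)"
  shows "inner (abs_l2 (dt T u t)) V
    = (\<Sum>i\<in>UNIV. \<Sum>j\<in>UNIV. a i j t * inner (abs_l2 (wpd j (u t))) (G' i))
      - (\<Sum>j\<in>UNIV. inner (cmul (b j t) (abs_l2 (wpd j (u t)))) V) - inner (cmul (c t) (abs_l2 (u t))) V"
proof -
  define v where "v = (\<lambda>x. cnj (rep_l2 V x))"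
  have v: "v \<in> L2"
    unfolding v_def by (intro L2_cnj rep_l2_L2)
  have weak: "weak_pd i v (\<lambda>x. cnj (rep_l2 (G' i) x))" for i
    unfolding v_def using V[of i] by (intro weak_pd_cnj) (simp add: weak_pd_iff_wd rep_l2_L2)
  note wpd_v = wpd_eqI[OF v L2_cnj[OF rep_l2_L2] weak]
  have "v \<in> H1"
    using v weak L2_cnj[OF rep_l2_L2] unfolding H1_def by blast
  \<comment> \<open>\<open>wpd i v\<close> is an arbitrary choice, so it is known only up to a null
    set; \<open>Re_integral_mult\<close> is stated to allow for that.\<close>
  have AE: "AE x in lborel. wpd i v x = cnj (rep_l2 (G' i) x)" for i
    using wpd_v(2)[of i] abs_l2_eq_iff[OF wpd_v(1)[of i] L2_cnj[OF rep_l2_L2[of "G' i"]]] by blast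
  note w = H1_wpd(2)[OF u]
  have v': "AE x in lborel. v x = cnj (rep_l2 V x)"
    by (simp add: v_def)
  have 1: "Re (L2_embed f v) = inner (abs_l2 f) V" if "f \<in> L2" for f
    unfolding L2_embed_def by (rule Re_integral_mult[OF that v v'])
  have 2: "Re (pd_Hm1 i (\<lambda>x. complex_of_real (a i j t) * wpd j (u t) x) v) = - (a i j t * inner (abs_l2 (wpd j (u t))) (G' i))" for i j
  proof -
    have "Re (LINT x|lborel. (a i j t *\<^sub>R wpd j (u t) x) * wpd i v x) = inner (abs_l2 (\<lambda>x. a i j t *\<^sub>R wpd j (u t) x)) (G' i)"
      by (intro Re_integral_mult L2_scaleR w wpd_v AE)
    then show ?thesis
      unfolding abs_l2_scaleR[OF w] inner_scaleR_left by (simp add: pd_Hm1_def scaleR_conv_of_real)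
  qed
  have "0 = Re (L_op a b c T u t v)"
    using eq[OF \<open>v \<in> H1\<close>] by simp
  also have "\<dots> = inner (abs_l2 (dt T u t)) V
    - (\<Sum>i\<in>UNIV. \<Sum>j\<in>UNIV. a i j t * inner (abs_l2 (wpd j (u t))) (G' i))
      + (\<Sum>j\<in>UNIV. inner (cmul (b j t) (abs_l2 (wpd j (u t)))) V) + inner (cmul (c t) (abs_l2 (u t))) V"
    unfolding L_op_def plus_complex.sel Re_sum 2
    using H1_wpd(1)[OF u] by (simp add: 1 dt L2_cmult w abs_l2_cmult sum_negf)
  finally show ?thesis by simp
qed

lemma solution_interpolation:
  fixes u :: "real \<Rightarrow> real^'n::finite \<Rightarrow> complex"
  assumes kA: "0 < kA" "kA < 1" and T': "0 < T'" "T' < T"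
    and struct: "structural kA kB kC \<omega> T a b c" and sol: "solution a b c T u"
    and bound: "\<And>t. t \<in> {0..T} \<Longrightarrow> L2_norm (u t) \<le> D" and t: "t \<in> {0..T'}"
  defines "\<tau> \<equiv> (T + T') / 2"
    and "C \<equiv> real CARD('n) * kB\<^sup>2 / kA + 2 * kC"
    and "K \<equiv> 2 * inverse kA + kA"
  defines "l \<equiv> kA * (\<tau> - T') / (K * \<tau>)"
  shows "(L2_norm (u t))\<^sup>2 \<le> exp (C * \<tau>) * ((D\<^sup>2) powr (1 - l) * (exp (C * \<tau>) * (L2_norm (u 0))\<^sup>2) powr l)"
proof -
  \<comment> \<open>The midpoint lies below \<open>T\<close>, so that the weak derivatives and the
    time derivative are continuous on the compact interval \<open>{0..\<tau>}\<close>, and above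
    \<open>T'\<close>, so that \<open>l\<close> is positive.\<close>
  have \<tau>: "T' < \<tau>" "\<tau> < T" "0 < \<tau>"
    using T' by (auto simp: \<tau>_def)
  have cont: "cont_into {0..T} L2 L2_norm u" "cont_into {0..<T} H1 H1_norm u" and C1: "C1_into_L2 {0..<T} u"
    using sol by (auto simp: solution_def H0_space_def)
  have L2: "u t \<in> L2" if "t \<in> {0..T}" for t
    using cont(1) that by (auto simp: cont_into_def)
  have H1: "u t \<in> H1" if "t \<in> {0..<T}" for t
    using cont(2) that by (auto simp: cont_into_def)
  obtain u' where u': "cont_into {0..<T} L2 L2_norm u'" "\<And>t. t \<in> {0..<T} \<Longrightarrow> has_L2_derivative u (u' t) t {0..<T}"
    using C1 by (auto simp: C1_into_L2_def)
  have deriv: "((\<lambda>s. abs_l2 (u s)) has_vector_derivative abs_l2 w) (at t)"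
    if "has_L2_derivative u w t {0..<T}" "t \<in> {0<..<T}" for w t
  proof -
    have "((\<lambda>s. abs_l2 (u s)) has_vector_derivative abs_l2 w) (at t within {0..<T})"
      using that by (intro has_L2_derivative_imp L2) auto
    then have "((\<lambda>s. abs_l2 (u s)) has_vector_derivative abs_l2 w) (at t within {0<..<T})"
      by (rule has_vector_derivative_within_subset) auto
    then show ?thesis
      using that by (simp add: at_within_open[of t "{0<..<T}"])
  qed
  have dt: "has_L2_derivative u (dt T u t) t {0..<T}" if "t \<in> {0..<T}" for t
    unfolding dt_def by (rule someI[where P = "\<lambda>w. has_L2_derivative u w t {0..<T}", OF u'(2)[OF that]])
  \<comment> \<open>\<open>dt\<close> is a pointwise choice, whereas \<open>u'\<close> is a
    continuous curve. Uniqueness of derivatives lets the equation be read with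
    \<open>u'\<close>.\<close>
  have dt_eq: "abs_l2 (dt T u t) = abs_l2 (u' t)" if "t \<in> {0<..<T}" for t
    using that by (intro vector_derivative_unique_at[OF deriv[OF dt] deriv[OF u'(2)]]) auto
  have "(norm (abs_l2 (u t)))\<^sup>2 \<le> exp (C * \<tau>) * ((D\<^sup>2) powr (1 - l) * (exp (C * \<tau>) * (norm (abs_l2 (u 0)))\<^sup>2) powr l)"
    unfolding C_def l_def K_def
  proof (rule l2_interpolation[where W = "\<lambda>t. abs_l2 (u' t)" and G = "\<lambda>i t. abs_l2 (wpd i (u t))"
        and a = a and b = b and c = c and U = "\<lambda>t. abs_l2 (u t)" and \<tau> = \<tau> and t\<^sub>2 = T'])
    show "0 \<le> t" "t \<le> T'" using t by auto
    have sub: "{0..\<tau>} \<subseteq> {0..<T}" using \<tau> by auto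
    show "continuous_on {0..\<tau>} (\<lambda>t. abs_l2 (u t))"
      by (rule continuous_on_subset[OF cont_into_L2_imp[OF cont(1)]]) (use \<tau> in auto)
    show "continuous_on {0..\<tau>} (\<lambda>t. abs_l2 (u' t))"
      by (rule continuous_on_subset[OF cont_into_L2_imp[OF u'(1)] sub])
    show "continuous_on {0..\<tau>} (\<lambda>t. abs_l2 (wpd i (u t)))" for i
      by (rule continuous_on_subset[OF cont_into_H1_imp[OF cont(2)] sub])
    show "((\<lambda>t. abs_l2 (u t)) has_vector_derivative abs_l2 (u' t)) (at t)" if "t \<in> {0<..<\<tau>}" for t
      using that \<tau> by (intro deriv u'(2)) auto
    show "wd i (abs_l2 (u t)) (abs_l2 (wpd i (u t)))" if "t \<in> {0..\<tau>}" for i t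
      using that \<tau> by (intro H1_wpd(3) H1) auto
    fix t assume t: "t \<in> {0..\<tau>}"
    then have tT: "t \<in> {0..T}" using \<tau> by simp
    show "kA * (norm \<xi>)\<^sup>2 \<le> (\<Sum>i\<in>UNIV. \<Sum>j\<in>UNIV. a i j t * \<xi> $ i * \<xi> $ j)"
      "(\<Sum>i\<in>UNIV. \<Sum>j\<in>UNIV. a i j t * \<xi> $ i * \<xi> $ j) \<le> inverse kA * (norm \<xi>)\<^sup>2"
      "norm (b i t) \<le> kB" "norm (c t) \<le> kC" for \<xi> :: "real^'n" and i
      using struct tT by (auto simp: structural_def)
    show "norm (abs_l2 (u t)) \<le> D"
      using bound[OF tT] by (simp add: norm_abs_l2 L2[OF tT])
  next
    have "AE t in lborel. t \<in> {0<..<T} \<longrightarrow> (\<forall>v\<in>H1. L_op a b c T u t v = 0)"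
      using sol by (simp add: solution_def)
    then show "AE t in lborel. t \<in> {0<..<\<tau>} \<longrightarrow> (\<forall>V G'. (\<forall>i. wd i V (G' i)) \<longrightarrow>
        inner (abs_l2 (u' t)) V = (\<Sum>i\<in>UNIV. \<Sum>j\<in>UNIV. a i j t * inner (abs_l2 (wpd j (u t))) (G' i))
          - (\<Sum>j\<in>UNIV. inner (cmul (b j t) (abs_l2 (wpd j (u t)))) V) - inner (cmul (c t) (abs_l2 (u t))) V)"
    proof (rule AE_mp, intro AE_I2 impI allI)
      fix t and V :: "(real^'n) l2" and G' :: "'n \<Rightarrow> (real^'n) l2"
      assume eq: "t \<in> {0<..<T} \<longrightarrow> (\<forall>v\<in>H1. L_op a b c T u t v = 0)" and t: "t \<in> {0<..<\<tau>}"
        and V: "\<forall>i. wd i V (G' i)"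
      have tT: "t \<in> {0<..<T}" "t \<in> {0..<T}" using t \<tau> by auto
      have "dt T u t \<in> L2"
        using dt[OF tT(2)] by (simp add: has_L2_derivative_def)
      from L_op_inner[OF H1[OF tT(2)] this, of a b c V G'] eq tT V
      show "inner (abs_l2 (u' t)) V = (\<Sum>i\<in>UNIV. \<Sum>j\<in>UNIV. a i j t * inner (abs_l2 (wpd j (u t))) (G' i))
          - (\<Sum>j\<in>UNIV. inner (cmul (b j t) (abs_l2 (wpd j (u t)))) V) - inner (cmul (c t) (abs_l2 (u t))) V"
        unfolding dt_eq[OF tT(1)] by blast
    qed
  qed (use T' \<tau> kA in auto)
  moreover have "t \<in> {0..T}" "0 \<in> {0..T}" using t T' by auto
  ultimately show ?thesis
    by (simp add: norm_abs_l2 L2)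
qed

theorem theorem3p4:
  fixes T T' D kA kB kC :: real and \<omega> :: "real \<Rightarrow> real"
  assumes "T > 0"
    and "0 < kA" "kA < 1" and "kB > 0" and "kC > 0"
    and "modulus_of_continuity \<omega>" and "osgood \<omega>"
    and "0 < T'" "T' < T" and "D > 0"
  shows "\<exists>\<rho>'>0. \<exists>G :: real \<Rightarrow> real.
      G ` {0..} \<subseteq> {0..} \<and> continuous_on {0..} G \<and> strict_mono_on {0..} G \<and> G 0 = 0 \<and>
      (\<forall>(a :: 'n::finite \<Rightarrow> 'n \<Rightarrow> real \<Rightarrow> real) (b :: 'n \<Rightarrow> real \<Rightarrow> complex) (c :: real \<Rightarrow> complex)
          (u :: real \<Rightarrow> real^'n \<Rightarrow> complex).
         structural kA kB kC \<omega> T a b c \<longrightarrow> solution a b c T u \<longrightarrow>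
         (\<forall>t\<in>{0..T}. L2_norm (u t) \<le> D) \<longrightarrow> L2_norm (u 0) \<le> \<rho>' \<longrightarrow>
         (SUP t\<in>{0..T'}. (L2_norm (u t))\<^sup>2) \<le> G ((L2_norm (u 0))\<^sup>2))"
proof -
  define \<tau> C K where "\<tau> = (T + T') / 2" and "C = real CARD('n) * kB\<^sup>2 / kA + 2 * kC"
    and "K = 2 * inverse kA + kA"
  define l where "l = kA * (\<tau> - T') / (K * \<tau>)"
  \<comment> \<open>The right-hand side of \<open>solution_interpolation\<close> as a function of
    the squared initial norm. Its parameters are all fixed before the coefficients and the solution,
    as the order of quantifiers demands.\<close>
  define G where "G y = exp (C * \<tau>) * ((D\<^sup>2) powr (1 - l) * (exp (C * \<tau>) * y) powr l)" for y
  have "T' < \<tau>" "0 < \<tau>"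
    using assms by (auto simp: \<tau>_def)
  moreover have "0 < K"
    using assms by (simp add: K_def add_pos_pos)
  ultimately have l: "0 < l"
    using assms by (simp add: l_def)
  have "G ` {0..} \<subseteq> {0..}"
    by (auto simp: G_def)
  moreover have "continuous_on {0..} G"
    unfolding G_def using l by (intro continuous_intros continuous_on_powr') auto
  moreover have "strict_mono_on {0..} G"
  proof (rule strict_mono_onI)
    fix x y :: real assume "x \<in> {0..}" "y \<in> {0..}" "x < y"
    then have "(exp (C * \<tau>) * x) powr l < (exp (C * \<tau>) * y) powr l"
      using l by (intro powr_less_mono2) auto
    then show "G x < G y"
      using assms(10) by (simp add: G_def)
  qed
  moreover have "G 0 = 0"
    by (simp add: G_def)
  moreover have "(SUP t\<in>{0..T'}. (L2_norm (u t))\<^sup>2) \<le> G ((L2_norm (u 0))\<^sup>2)"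
    if "structural kA kB kC \<omega> T a b c" "solution a b c T u" "\<forall>t\<in>{0..T}. L2_norm (u t) \<le> D"
    for a :: "'n \<Rightarrow> 'n \<Rightarrow> real \<Rightarrow> real" and b :: "'n \<Rightarrow> real \<Rightarrow> complex" and c :: "real \<Rightarrow> complex"
      and u :: "real \<Rightarrow> real^'n \<Rightarrow> complex"
  proof (rule cSUP_least)
    show "(L2_norm (u t))\<^sup>2 \<le> G ((L2_norm (u 0))\<^sup>2)" if "t \<in> {0..T'}" for t
      unfolding G_def l_def K_def C_def \<tau>_def
      by (rule solution_interpolation) (use assms \<open>structural _ _ _ _ _ _ _ _\<close> \<open>solution _ _ _ _ _\<close> \<open>\<forall>t\<in>{0..T}. _\<close> that in auto)
  qed (use assms in auto)
  ultimately show ?thesis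
    by (intro exI[of _ 1] conjI exI[of _ G]) auto
qed

end
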